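(* Let $d\geqslant 2$ and let $T$ be a tiling of $\mathbb{R}^d$ with Euclidean finite local complexity. Then the rotational hull $\Omega_r$ of $T$ is a matchbox manifold with Euclidean leaves of dimension $d+d(d-1)/2$.
   Context: A tiling of $\mathbb{R}^d$ is a cover of $\mathbb{R}^d$ by compact $d$-dimensional polyhedral subsets (tiles), possibly carrying labels, meeting full face to full face and only on boundaries. A patch is a finite set of tiles of $T$; the $r$-patch at $x\in\mathbb{R}^d$ is the set of tiles meeting the closed ball of radius $r$ at $x$. A rigid motion is an orientation preserving isometry of $\mathbb{R}^d$; it acts on tilings and patches tile by tile, preserving labels. $T$ has Euclidean finite local complexity if for each $r>0$ there are only finitely many $r$-patches of $T$ up to rigid motion. The rotational hull $\Omega_r$ of $T$ is the space of tilings all of whose finite patches appear, up to rigid motion, in $T$. It carries the tiling topology, in which two tilings are close if they agree on a large ball about the origin after a small translation followed by a small rotation of either of them. A matchbox manifold of dimension $n$ is a continuum $\mathbb{M}$ (compact connected metrizable space) such that the following hold. (Charts) There is a compact, separable, totally disconnected metric space $\mathbb{X}$, and for each $x\in\mathbb{M}$ a compact subspace $X_x\subset\mathbb{X}$, an open set $U_x\subset\mathbb{M}$ and a homeomorphism $\phi_x\colon\overline{U}_x\to[-1,1]^n\times X_x$ with $\phi_x(x)=(0,w_x)$ for some $w_x\in\mathrm{int}(X_x)$; moreover $\phi_x$ extends to a homeomorphism $\hat\phi_x\colon\hat U_x\to[-2,2]^n\times X_x$ for some open $\hat U_x\subset\mathbb{M}$ with $\overline{U}_x\subset\hat U_x$.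 (Plaques) Let $\pi_x\colon\overline{U}_x\to X_x$ be $\phi_x$ followed by projection to the second factor; for $z\in\overline{U}_x$ the plaque through $z$ is $\mathbb{P}_x(z)=\pi_x^{-1}(\pi_x(z))$, topologized so that $\phi_x\colon\mathbb{P}_x(z)\to[-1,1]^n\times\{\pi_x(z)\}$ is a homeomorphism. (Compatibilities) For two charts $(U_x,\phi_x)$, $(U_y,\phi_y)$: the intersection of the interiors of plaques $\mathbb{P}_x(z)$ and $\mathbb{P}_y(z')$ is open in each plaque; each plaque in $U_x$ meets at most one plaque in $\overline{U}_y$; and for each $z$ in the interiors of both $\mathbb{P}_x(z)$ and $\mathbb{P}_y(z)$ there is a connected set $W\subset\mathbb{P}_x(z)\cap\mathbb{P}_y(z)$ containing $z$, open in the plaque topology, such that $\phi_y\circ\phi_x^{-1}$ is a smooth diffeomorphism from $\phi_x(\mathbb{P}_x(z)\cap W)$ to $\phi_y(\mathbb{P}_y(z)\cap W)$. The leaves are the unions of chains of overlapping plaques; they coincide with the path components of $\mathbb{M}$.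
   Formalization: The extended charts map the open set Û_x onto (-2,2)^n × X_x instead of [-2,2]^n × X_x; with the closed cube, Û_x would be compact and open, hence all of the connected space, which no matchbox manifold allows. Euclidean leaves means leaves locally homeomorphic to R^n. *)

theory Defs
  imports "HOL-Analysis.Analysis"
begin

section \<open>Tilings of Euclidean space\<close>

text \<open>
  A tile is a pair of a subset of \<open>\<real>\<^sup>d\<close> and a label; unlabelled tilings are the case of a
  one-element label type. Tiles are not assumed to be convex, or connected.
\<close>

type_synonym ('n, 'l) tile = "(real^'n) set \<times> 'l"
type_synonym ('n, 'l) tiling = "('n, 'l) tile set"

definition polyhedral_tile :: "(real^'n) set \<Rightarrow> bool" where
  "polyhedral_tile P \<longleftrightarrow>
     (\<exists>\<C>. finite \<C> \<and> \<C> \<noteq> {} \<and> (\<forall>C\<in>\<C>. polytope C \<and> interior C \<noteq> {}) \<and> P = \<Union>\<C>)"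

text \<open>
  Faces of a possibly non-convex polyhedral set \<open>P\<close>. The points of \<open>P\<close> are classified by the
  germ of \<open>P\<close> at them (up to translation); the connected components of the classes are the
  relatively open faces, and their closures are the faces. For a convex polytope these are its
  nonempty faces in the usual sense (the polytope itself included).
\<close>

definition same_germ :: "(real^'n) set \<Rightarrow> real^'n \<Rightarrow> real^'n \<Rightarrow> bool" where
  "same_germ P x y \<longleftrightarrow> (\<exists>e>0. \<forall>v. norm v < e \<longrightarrow> (x + v \<in> P \<longleftrightarrow> y + v \<in> P))"

definition polyhedral_faces :: "(real^'n) set \<Rightarrow> (real^'n) set set" where
  "polyhedral_faces P = {closure (connected_component_set {y. same_germ P x y} x) | x. x \<in> P}"

text \<open>
  The common points of two tiles lie on both boundaries and are made up of whole common faces.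
  (Non-convex tiles may share several faces.)
\<close>

definition meet_face_to_face :: "(real^'n) set \<Rightarrow> (real^'n) set \<Rightarrow> bool" where
  "meet_face_to_face P Q \<longleftrightarrow>
     P \<inter> Q \<subseteq> frontier P \<inter> frontier Q \<and>
     (\<exists>\<F>. \<F> \<subseteq> polyhedral_faces P \<inter> polyhedral_faces Q \<and> P \<inter> Q = \<Union>\<F>)"

definition r_patch :: "('n::finite, 'l) tiling \<Rightarrow> real \<Rightarrow> real^'n \<Rightarrow> ('n, 'l) tiling" where
  "r_patch T r x = {t \<in> T. fst t \<inter> cball x r \<noteq> {}}"

text \<open>
  The last clause says that the \<open>r\<close>-patches are patches, that is, finite sets of tiles.
\<close>

definition is_tiling :: "('n::finite, 'l) tiling \<Rightarrow> bool" where
  "is_tiling T \<longleftrightarrow>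
     (\<forall>t\<in>T. polyhedral_tile (fst t)) \<and>
     \<Union>(fst ` T) = UNIV \<and>
     (\<forall>s\<in>T. \<forall>t\<in>T. s \<noteq> t \<longrightarrow> meet_face_to_face (fst s) (fst t)) \<and>
     (\<forall>r x. finite (r_patch T r x))"

definition rigid_motion :: "(real^'n \<Rightarrow> real^'n) \<Rightarrow> bool" where
  "rigid_motion g \<longleftrightarrow>
     (\<forall>x y. dist (g x) (g y) = dist x y) \<and> det (matrix (\<lambda>x. g x - g 0)) > 0"

definition move :: "(real^'n \<Rightarrow> real^'n) \<Rightarrow> ('n::finite, 'l) tiling \<Rightarrow> ('n, 'l) tiling" where
  "move g S = (\<lambda>(P, l). (g ` P, l)) ` S"

definition euclidean_FLC :: "('n::finite, 'l) tiling \<Rightarrow> bool" where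
  "euclidean_FLC T \<longleftrightarrow>
     (\<forall>r>0. \<exists>\<P>. finite \<P> \<and> (\<forall>x. \<exists>p\<in>\<P>. \<exists>g. rigid_motion g \<and> r_patch T r x = move g p))"


section \<open>The rotational hull\<close>

definition hull_tilings :: "('n::finite, 'l) tiling \<Rightarrow> ('n, 'l) tiling set" where
  "hull_tilings T =
     {S. is_tiling S \<and> (\<forall>p. finite p \<and> p \<subseteq> S \<longrightarrow> (\<exists>g. rigid_motion g \<and> move g p \<subseteq> T))}"

text \<open>The small motions: a translation of size below \<open>e\<close> followed by a rotation \<open>e\<close>-close to 1.\<close>

definition small_motion :: "real \<Rightarrow> (real^'n \<Rightarrow> real^'n) \<Rightarrow> bool" where
  "small_motion e g \<longleftrightarrow>
     (\<exists>A v. rotation_matrix A \<and> norm (A - mat 1) < e \<and> norm v < e \<and> g = (\<lambda>x. A *v (x + v)))"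

definition agree_on_ball :: "real \<Rightarrow> ('n::finite, 'l) tiling \<Rightarrow> ('n, 'l) tiling \<Rightarrow> bool" where
  "agree_on_ball r S S' \<longleftrightarrow> r_patch S r 0 = r_patch S' r 0"

definition tilings_close :: "real \<Rightarrow> ('n::finite, 'l) tiling \<Rightarrow> ('n, 'l) tiling \<Rightarrow> bool" where
  "tilings_close e S S' \<longleftrightarrow>
     (\<exists>g. small_motion e g \<and>
          (agree_on_ball (1/e) (move g S) S' \<or> agree_on_ball (1/e) S (move g S')))"

definition rotational_hull :: "('n::finite, 'l) tiling \<Rightarrow> ('n, 'l) tiling topology" where
  "rotational_hull T = topology (\<lambda>V. V \<subseteq> hull_tilings T \<and>
     (\<forall>S\<in>V. \<exists>e>0. \<forall>S'\<in>hull_tilings T. tilings_close e S S' \<longrightarrow> S' \<in> V))"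

lemma agree_on_ball_mono:
  assumes "agree_on_ball r S S'" "s \<le> r"
  shows "agree_on_ball s S S'"
proof -
  have "r_patch Q s 0 = {t \<in> r_patch Q r 0. fst t \<inter> cball 0 s \<noteq> {}}" for Q :: "('a::finite, 'b) tiling"
    using assms(2) subset_cball[of s r "0 :: real^'a"] by (auto simp: r_patch_def)
  then show ?thesis
    using assms(1) by (simp add: agree_on_ball_def)
qed

lemma tilings_close_mono:
  assumes "tilings_close e S S'" "0 < e" "e \<le> e'"
  shows "tilings_close e' S S'"
proof -
  obtain g where g: "small_motion e g"
    "agree_on_ball (1/e) (move g S) S' \<or> agree_on_ball (1/e) S (move g S')"
    using assms(1) by (auto simp: tilings_close_def)
  have "small_motion e' g"
  proof -
    obtain A v where "rotation_matrix A" "norm (A - mat 1) < e" "norm v < e" "g = (\<lambda>x. A *v (x + v))"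
      using g(1) unfolding small_motion_def by blast
    moreover have "norm (A - mat 1) < e'" "norm v < e'"
      using calculation assms(3) by linarith+
    ultimately show ?thesis
      unfolding small_motion_def by blast
  qed
  moreover have "1/e' \<le> 1/e"
    using assms(2,3) by (simp add: frac_le)
  ultimately show ?thesis
    using g(2) agree_on_ball_mono unfolding tilings_close_def by blast
qed

lemma openin_rotational_hull:
  "openin (rotational_hull T) V \<longleftrightarrow> V \<subseteq> hull_tilings T \<and>
     (\<forall>S\<in>V. \<exists>e>0. \<forall>S'\<in>hull_tilings T. tilings_close e S S' \<longrightarrow> S' \<in> V)"
proof -
  have "istopology (\<lambda>V. V \<subseteq> hull_tilings T \<and>
     (\<forall>S\<in>V. \<exists>e>0. \<forall>S'\<in>hull_tilings T. tilings_close e S S' \<longrightarrow> S' \<in> V))" (is "istopology ?P")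
    unfolding istopology_def
  proof (intro conjI allI impI)
    fix V W assume V: "?P V" and W: "?P W"
    show "V \<inter> W \<subseteq> hull_tilings T" using V by blast
    show "\<forall>S\<in>V \<inter> W. \<exists>e>0. \<forall>S'\<in>hull_tilings T. tilings_close e S S' \<longrightarrow> S' \<in> V \<inter> W"
    proof
      fix S assume "S \<in> V \<inter> W"
      then obtain a b where "a > 0" "\<forall>S'\<in>hull_tilings T. tilings_close a S S' \<longrightarrow> S' \<in> V"
        "b > 0" "\<forall>S'\<in>hull_tilings T. tilings_close b S S' \<longrightarrow> S' \<in> W"
        using V W by blast
      then have "min a b > 0 \<and> (\<forall>S'\<in>hull_tilings T. tilings_close (min a b) S S' \<longrightarrow> S' \<in> V \<inter> W)"
        using tilings_close_mono[of "min a b" S _ a] tilings_close_mono[of "min a b" S _ b] by auto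
      then show "\<exists>e>0. \<forall>S'\<in>hull_tilings T. tilings_close e S S' \<longrightarrow> S' \<in> V \<inter> W" by blast
    qed
  next
    fix \<V> assume \<V>: "\<forall>V\<in>\<V>. ?P V"
    show "\<Union>\<V> \<subseteq> hull_tilings T" using \<V> by blast
    show "\<forall>S\<in>\<Union>\<V>. \<exists>e>0. \<forall>S'\<in>hull_tilings T. tilings_close e S S' \<longrightarrow> S' \<in> \<Union>\<V>"
    proof
      fix S assume "S \<in> \<Union>\<V>"
      then obtain V where "V \<in> \<V>" "S \<in> V" by blast
      with \<V> obtain e where "e > 0" "\<forall>S'\<in>hull_tilings T. tilings_close e S S' \<longrightarrow> S' \<in> V" by blast
      with \<open>V \<in> \<V>\<close> show "\<exists>e>0. \<forall>S'\<in>hull_tilings T. tilings_close e S S' \<longrightarrow> S' \<in> \<Union>\<V>" by blast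
    qed
  qed
  then show ?thesis
    unfolding rotational_hull_def by (simp add: topology_inverse')
qed

lemma topspace_rotational_hull: "topspace (rotational_hull T) = hull_tilings T"
proof
  show "topspace (rotational_hull T) \<subseteq> hull_tilings T"
    using openin_rotational_hull openin_topspace by blast
  have "openin (rotational_hull T) (hull_tilings T)"
    unfolding openin_rotational_hull by (auto intro: exI[of _ 1])
  then show "hull_tilings T \<subseteq> topspace (rotational_hull T)"
    by (rule openin_subset)
qed


section \<open>Smooth maps\<close>

primrec Ck_on :: "nat \<Rightarrow> 'a::real_normed_vector set \<Rightarrow> ('a \<Rightarrow> 'b::real_normed_vector) \<Rightarrow> bool" where
  "Ck_on 0 S f \<longleftrightarrow> continuous_on S f"
| "Ck_on (Suc k) S f \<longleftrightarrow>
     (\<forall>x\<in>S. f differentiable (at x)) \<and> (\<forall>v. Ck_on k S (\<lambda>x. frechet_derivative f (at x) v))"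

text \<open>
  On a set that need not be open, smooth means locally extendable to a smooth map on an open set.
\<close>

definition smooth_map_on :: "'a::real_normed_vector set \<Rightarrow> ('a \<Rightarrow> 'b::real_normed_vector) \<Rightarrow> bool" where
  "smooth_map_on A f \<longleftrightarrow>
     (\<forall>x\<in>A. \<exists>V h. open V \<and> x \<in> V \<and> (\<forall>k. Ck_on k V h) \<and> (\<forall>y\<in>A \<inter> V. h y = f y))"

definition smooth_diffeo ::
  "'a::real_normed_vector set \<Rightarrow> 'b::real_normed_vector set \<Rightarrow> ('a \<Rightarrow> 'b) \<Rightarrow> bool" where
  "smooth_diffeo A B f \<longleftrightarrow>
     bij_betw f A B \<and> smooth_map_on A f \<and> smooth_map_on B (inv_into A f)"


section \<open>Matchbox manifolds\<close>

text \<open>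
  Throughout, \<open>M\<close> is the space, \<open>U x\<close> and \<open>\<phi> x\<close> are the open set and the coordinate map of the
  chart at \<open>x\<close>, and the dimension is \<open>CARD('m)\<close>.

  The transversal space \<open>X\<close> is a topology on a subset of the type of real numbers, which serves
  only as a supply of points (the topology is arbitrary): a separable metric space has at most
  continuum many points, so nothing is lost.
\<close>

definition totally_disconnected_space :: "'a topology \<Rightarrow> bool" where
  "totally_disconnected_space X \<longleftrightarrow> (\<forall>C. connectedin X C \<longrightarrow> (\<exists>a. C \<subseteq> {a}))"

definition matchbox_chart ::
  "'a topology \<Rightarrow> real topology \<Rightarrow> 'a \<Rightarrow> 'a set \<Rightarrow> real set \<Rightarrow> ('a \<Rightarrow> (real^'m) \<times> real) \<Rightarrow> bool" where
  "matchbox_chart M X x U X\<^sub>x \<phi> \<longleftrightarrow>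
     compactin X X\<^sub>x \<and> openin M U \<and> x \<in> U \<and>
     homeomorphic_map (subtopology M (M closure_of U))
       (prod_topology (top_of_set (cbox (-1) 1)) (subtopology X X\<^sub>x)) \<phi> \<and>
     (\<exists>w \<in> X interior_of X\<^sub>x. \<phi> x = (0, w)) \<and>
     (\<exists>U' \<phi>'. openin M U' \<and> M closure_of U \<subseteq> U' \<and>
        homeomorphic_map (subtopology M U')
          (prod_topology (top_of_set (box (-2) 2)) (subtopology X X\<^sub>x)) \<phi>' \<and>
        (\<forall>z \<in> M closure_of U. \<phi>' z = \<phi> z))"

text \<open>
  In the definition above the extended chart has values in the open cube \<open>(-2,2)\<^sup>n\<close>. With the
  closed cube, \<open>U'\<close> would be compact and open, hence all of the connected space \<open>M\<close>.

  Since \<open>\<phi> x\<close> is a homeomorphism, the topology that makes it restrict to a homeomorphism from a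
  plaque to \<open>[-1,1]\<^sup>n \<times> {w}\<close> is the subspace topology. The interior of a plaque is its interior as
  a cube, not its interior in \<open>M\<close>.
\<close>

definition plaque ::
  "'a topology \<Rightarrow> ('a \<Rightarrow> 'a set) \<Rightarrow> ('a \<Rightarrow> 'a \<Rightarrow> (real^'m) \<times> real) \<Rightarrow> 'a \<Rightarrow> 'a \<Rightarrow> 'a set" where
  "plaque M U \<phi> x z = {q \<in> M closure_of U x. snd (\<phi> x q) = snd (\<phi> x z)}"

definition plaque_interior ::
  "'a topology \<Rightarrow> ('a \<Rightarrow> 'a set) \<Rightarrow> ('a \<Rightarrow> 'a \<Rightarrow> (real^'m) \<times> real) \<Rightarrow> 'a \<Rightarrow> 'a \<Rightarrow> 'a set" where
  "plaque_interior M U \<phi> x z = {q \<in> plaque M U \<phi> x z. fst (\<phi> x q) \<in> box (-1) 1}"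

abbreviation plaque_topology ::
  "'a topology \<Rightarrow> ('a \<Rightarrow> 'a set) \<Rightarrow> ('a \<Rightarrow> 'a \<Rightarrow> (real^'m) \<times> real) \<Rightarrow> 'a \<Rightarrow> 'a \<Rightarrow> 'a topology" where
  "plaque_topology M U \<phi> x z \<equiv> subtopology M (plaque M U \<phi> x z)"

text \<open>\<open>\<phi>\<^sub>y \<circ> \<phi>\<^sub>x\<^sup>-\<^sup>1\<close> in the cube coordinates, along the plaque of the chart at \<open>x\<close> through \<open>z\<close>.\<close>

definition plaque_transition ::
  "'a topology \<Rightarrow> ('a \<Rightarrow> 'a set) \<Rightarrow> ('a \<Rightarrow> 'a \<Rightarrow> (real^'m) \<times> real) \<Rightarrow> 'a \<Rightarrow> 'a \<Rightarrow> 'a \<Rightarrow>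
     real^'m \<Rightarrow> real^'m" where
  "plaque_transition M U \<phi> x y z u =
     fst (\<phi> y (inv_into (M closure_of U x) (\<phi> x) (u, snd (\<phi> x z))))"

definition compatible_charts ::
  "'a topology \<Rightarrow> ('a \<Rightarrow> 'a set) \<Rightarrow> ('a \<Rightarrow> 'a \<Rightarrow> (real^'m) \<times> real) \<Rightarrow> 'a \<Rightarrow> 'a \<Rightarrow> bool" where
  "compatible_charts M U \<phi> x y \<longleftrightarrow>
     (\<forall>z \<in> M closure_of U x. \<forall>z' \<in> M closure_of U y.
        openin (plaque_topology M U \<phi> x z)
          (plaque_interior M U \<phi> x z \<inter> plaque_interior M U \<phi> y z') \<and>
        openin (plaque_topology M U \<phi> y z')
          (plaque_interior M U \<phi> x z \<inter> plaque_interior M U \<phi> y z')) \<and>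
     (\<forall>z \<in> M closure_of U x. \<forall>z' \<in> M closure_of U y. \<forall>z'' \<in> M closure_of U y.
        plaque M U \<phi> x z \<inter> plaque M U \<phi> y z' \<noteq> {} \<and> plaque M U \<phi> x z \<inter> plaque M U \<phi> y z'' \<noteq> {} \<longrightarrow>
        plaque M U \<phi> y z' = plaque M U \<phi> y z'') \<and>
     (\<forall>z. z \<in> plaque_interior M U \<phi> x z \<inter> plaque_interior M U \<phi> y z \<longrightarrow>
       (\<exists>W. W \<subseteq> plaque M U \<phi> x z \<inter> plaque M U \<phi> y z \<and> z \<in> W \<and> connectedin M W \<and>
          openin (plaque_topology M U \<phi> x z) W \<and> openin (plaque_topology M U \<phi> y z) W \<and>
          smooth_diffeo ((fst \<circ> \<phi> x) ` W) ((fst \<circ> \<phi> y) ` W) (plaque_transition M U \<phi> x y z)))"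

definition matchbox_structure ::
  "'a topology \<Rightarrow> real topology \<Rightarrow> ('a \<Rightarrow> 'a set) \<Rightarrow> ('a \<Rightarrow> real set) \<Rightarrow>
     ('a \<Rightarrow> 'a \<Rightarrow> (real^'m) \<times> real) \<Rightarrow> bool" where
  "matchbox_structure M X U Tr \<phi> \<longleftrightarrow>
     compact_space M \<and> connected_space M \<and> metrizable_space M \<and>
     compact_space X \<and> separable_space X \<and> totally_disconnected_space X \<and> metrizable_space X \<and>
     (\<forall>x \<in> topspace M. matchbox_chart M X x (U x) (Tr x) (\<phi> x)) \<and>
     (\<forall>x \<in> topspace M. \<forall>y \<in> topspace M. compatible_charts M U \<phi> x y)"


section \<open>Leaves\<close>

definition plaques ::
  "'a topology \<Rightarrow> ('a \<Rightarrow> 'a set) \<Rightarrow> ('a \<Rightarrow> 'a \<Rightarrow> (real^'m) \<times> real) \<Rightarrow> 'a set set" where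
  "plaques M U \<phi> = {plaque M U \<phi> x z | x z. x \<in> topspace M \<and> z \<in> M closure_of U x}"

definition overlapping_plaques ::
  "'a topology \<Rightarrow> ('a \<Rightarrow> 'a set) \<Rightarrow> ('a \<Rightarrow> 'a \<Rightarrow> (real^'m) \<times> real) \<Rightarrow> ('a set \<times> 'a set) set" where
  "overlapping_plaques M U \<phi> = {(P, Q). P \<in> plaques M U \<phi> \<and> Q \<in> plaques M U \<phi> \<and> P \<inter> Q \<noteq> {}}"

definition leaves ::
  "'a topology \<Rightarrow> ('a \<Rightarrow> 'a set) \<Rightarrow> ('a \<Rightarrow> 'a \<Rightarrow> (real^'m) \<times> real) \<Rightarrow> 'a set set" where
  "leaves M U \<phi> = {\<Union>((overlapping_plaques M U \<phi>)\<^sup>* `` {P}) | P. P \<in> plaques M U \<phi>}"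

text \<open>
  The leaf topology is the one generated by the interiors of the plaques; it is in general
  finer than the subspace topology.
\<close>

definition leaf_topology ::
  "'a topology \<Rightarrow> ('a \<Rightarrow> 'a set) \<Rightarrow> ('a \<Rightarrow> 'a \<Rightarrow> (real^'m) \<times> real) \<Rightarrow> 'a set \<Rightarrow> 'a topology" where
  "leaf_topology M U \<phi> L = topology (\<lambda>V. V \<subseteq> L \<and>
     (\<forall>x \<in> topspace M. \<forall>z \<in> M closure_of U x.
        openin (plaque_topology M U \<phi> x z) (V \<inter> plaque_interior M U \<phi> x z)))"

lemma openin_leaf_topology:
  "openin (leaf_topology M U \<phi> L) V \<longleftrightarrow> V \<subseteq> L \<and>
     (\<forall>x \<in> topspace M. \<forall>z \<in> M closure_of U x.
        openin (plaque_topology M U \<phi> x z) (V \<inter> plaque_interior M U \<phi> x z))"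
proof -
  have "istopology (\<lambda>V. V \<subseteq> L \<and>
     (\<forall>x \<in> topspace M. \<forall>z \<in> M closure_of U x.
        openin (plaque_topology M U \<phi> x z) (V \<inter> plaque_interior M U \<phi> x z)))"
    (is "istopology ?P")
    unfolding istopology_def
  proof (intro conjI allI impI)
    fix V W assume V: "?P V" and W: "?P W"
    show "V \<inter> W \<subseteq> L" using V by blast
    have "V \<inter> W \<inter> I = (V \<inter> I) \<inter> (W \<inter> I)" for I by blast
    then show "\<forall>x \<in> topspace M. \<forall>z \<in> M closure_of U x.
        openin (plaque_topology M U \<phi> x z) (V \<inter> W \<inter> plaque_interior M U \<phi> x z)"
      using V W by (simp add: openin_Int)
  next
    fix \<V> assume \<V>: "\<forall>V\<in>\<V>. ?P V"
    show "\<Union>\<V> \<subseteq> L" using \<V> by blast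
    show "\<forall>x \<in> topspace M. \<forall>z \<in> M closure_of U x.
        openin (plaque_topology M U \<phi> x z) (\<Union>\<V> \<inter> plaque_interior M U \<phi> x z)"
      unfolding Int_Union2 using \<V> by (intro ballI openin_Union) auto
  qed
  then show ?thesis
    unfolding leaf_topology_def by (simp add: topology_inverse')
qed

definition locally_euclidean :: "'m::finite itself \<Rightarrow> 'a topology \<Rightarrow> bool" where
  "locally_euclidean _ Y \<longleftrightarrow>
     (\<forall>p \<in> topspace Y. \<exists>V. openin Y V \<and> p \<in> V \<and>
        subtopology Y V homeomorphic_space (euclidean :: (real^'m) topology))"

definition matchbox_manifold_with_euclidean_leaves :: "'m::finite itself \<Rightarrow> 'a topology \<Rightarrow> bool" where
  "matchbox_manifold_with_euclidean_leaves m M \<longleftrightarrow>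
     (\<exists>X U Tr (\<phi> :: 'a \<Rightarrow> 'a \<Rightarrow> (real^'m) \<times> real).
        matchbox_structure M X U Tr \<phi> \<and>
        (\<forall>L \<in> leaves M U \<phi>.
           topspace (leaf_topology M U \<phi> L) = L \<and> locally_euclidean m (leaf_topology M U \<phi> L)))"

end

theory Submission
  imports Defs
begin

text \<open>
  The group of rigid motions acts on the hull. By finite local complexity there are finitely many
  prototiles \<open>t\<close> up to rigid motion, and the tilings of the hull that contain a fixed \<open>t\<close> form a
  profinite space \<open>\<Xi>\<^sub>t\<close>, since they have finitely many patches of each radius around \<open>t\<close>. Every
  tiling of the hull is \<open>g S\<close> with \<open>S \<in> \<Xi>\<^sub>t\<close> for some \<open>t\<close>, where \<open>g\<close> may be taken from a compact set. The
  map \<open>(g, S) \<mapsto> g S\<close> is continuous and open, and it is locally injective because a small motion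
  that maps a tile to an overlapping tile of the same tiling is a symmetry of the tile, and these
  are finite in number. With a smooth parametrization \<open>P\<close> of the motions near 1, the Cayley
  transform, the maps \<open>(v, S) \<mapsto> P(v) h S\<close> are the inverses of the charts. Changes of charts along a plaque
  are right multiplications in the group, hence smooth. The hull is compact as the image of finitely
  many compact sets, metrizable since the distances from given motions to the placements of \<open>t\<close> in a tiling
  are continuous and separate tilings, and connected since the orbit of \<open>T\<close> is dense and the
  group is connected.
\<close>

section \<open>The group of rigid motions\<close>

text \<open>The action need not be free: a tiling may have symmetries, so \<open>g S\<close> does
  not determine \<open>(g, S)\<close>. What is used instead is that these ambiguities are uniformly
  discrete. One constant \<open>d\<close> in \<open>uniform_rigidity\<close> serves all prototiles,
  provided the marked tile covers the origin: conjugation by \<open>h\<close> enlarges a small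
  motion in proportion to the translation part of \<open>h\<close>, and this condition bounds it.
  The parametrization is scaled so that the cube [-2,2]^m stays within \<open>d / 4\<close> of the
  identity. The 4 comes from the uniqueness of plaques: two coincidences between a plaque of one
  chart and plaques of another differ by a product of four motions \<open>P v\<close> or their
  inverses. Injectivity of the charts, uniqueness of plaques and the form of the transitions all
  rest on \<open>place_rigid\<close>. The relation \<open>tilings_close\<close> is no distance
  function, so a metric cannot be read off. Compactness is proved first; then an injective
  continuous map into a product of lines is already an embedding. The Hausdorff property that
  results makes the closure of a chart domain the image of the closed cube.\<close>

type_synonym 'n motion = "(real^'n^'n) \<times> (real^'n)"

text \<open>A subset of the normed space of pairs of a matrix and a vector: topology and smoothness
  are inherited from there, and \<open>gmul\<close> is polynomial in the entries.\<close>

definition SE :: "'n::finite motion set" where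
  "SE = {g. rotation_matrix (fst g)}"

definition act :: "'n::finite motion \<Rightarrow> real^'n \<Rightarrow> real^'n" where
  "act g x = fst g *v x + snd g"

definition gmul :: "'n::finite motion \<Rightarrow> 'n motion \<Rightarrow> 'n motion" where
  "gmul g h = (fst g ** fst h, fst g *v snd h + snd g)"

definition gone :: "'n::finite motion" where
  "gone = (mat 1, 0)"

text \<open>The transpose stands for the matrix inverse, so that the formula is continuous on the
  whole space; it is an inverse for the elements of \<open>SE\<close>.\<close>

definition ginv :: "'n::finite motion \<Rightarrow> 'n motion" where
  "ginv g = (transpose (fst g), - (transpose (fst g) *v snd g))"

text \<open>Rotation and translation part are bounded separately, as in \<open>small_motion\<close>;
  the distance to \<open>gone\<close> in the product space agrees with this up to a factor
  2.\<close>

definition near_one :: "real \<Rightarrow> 'n::finite motion \<Rightarrow> bool" where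
  "near_one e g \<longleftrightarrow> norm (fst g - mat 1) < e \<and> norm (snd g) < e"

section \<open>Matrix algebra and the Frobenius norm\<close>

lemma matrix_diff_ldistrib: "(A::'a::ring_1^'n^'m) ** (B - C) = A ** B - A ** C"
  by (vector matrix_matrix_mult_def sum_subtractf[symmetric] algebra_simps)

lemma matrix_diff_rdistrib: "(A - B) ** (C::'a::ring_1^'n^'m) = A ** C - B ** C"
  by (vector matrix_matrix_mult_def sum_subtractf[symmetric] algebra_simps)

lemma matrix_add_rdistrib: "(A + B) ** (C::'a::ring_1^'n^'m) = A ** C + B ** C"
  by (vector matrix_matrix_mult_def sum.distrib[symmetric] algebra_simps)

lemma matrix_vector_neg: "A *v (- x) = - (A *v (x::real^'n))"
  by (metis linear_neg matrix_vector_mul_linear)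

lemma transpose_add: "transpose (A + B) = transpose A + transpose (B::'a::plus^'n^'m)"
  by (vector transpose_def)

lemma transpose_diff: "transpose (A - B) = transpose A - transpose (B::'a::minus^'n^'m)"
  by (vector transpose_def)

lemma rotation_orth: "rotation_matrix A \<Longrightarrow> orthogonal_matrix A"
  by (simp add: rotation_matrix_def)

lemma rotation_matrix_mul: "rotation_matrix A \<Longrightarrow> rotation_matrix B \<Longrightarrow> rotation_matrix ((A::real^'n^'n) ** B)"
  by (simp add: rotation_matrix_def orthogonal_matrix_mul det_mul)

lemma rotation_matrix_transpose: "rotation_matrix (A::real^'n^'n) \<Longrightarrow> rotation_matrix (transpose A)"
  by (simp add: rotation_matrix_def)

lemma rotation_matrix_one: "rotation_matrix (mat 1 :: real^'n^'n)"
  by (simp add: rotation_matrix_def orthogonal_matrix_id)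

lemma orthogonal_matrix_norm: "orthogonal_matrix (A::real^'n^'n) \<Longrightarrow> norm (A *v x) = norm x"
  using orthogonal_transformation_matrix[of "(*v) A"]
  by (simp add: orthogonal_transformation)

text \<open>The norm on matrices is the Frobenius norm, so Cauchy-Schwarz in each row
  suffices.\<close>

lemma norm_matrix_vector_le: "norm ((A::real^'n^'m) *v x) \<le> norm A * norm x"
proof -
  have "norm (A *v x) = L2_set (\<lambda>i. norm ((A *v x) $ i)) UNIV"
    by (simp add: norm_vec_def)
  also have "\<dots> \<le> L2_set (\<lambda>i. norm x * norm (A $ i)) UNIV"
  proof (rule L2_set_mono)
    fix i
    have "(A *v x) $ i = inner (A $ i) x"
      by (simp add: matrix_vector_mult_def inner_vec_def)
    then show "norm ((A *v x) $ i) \<le> norm x * norm (A $ i)"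
      using Cauchy_Schwarz_ineq2[of "A $ i" x] by (simp add: mult.commute)
  qed simp
  also have "\<dots> = norm A * norm x"
    by (simp add: norm_vec_def[of A] L2_set_right_distrib[symmetric] mult.commute)
  finally show ?thesis .
qed

lemma norm_matrix_square: "(norm A)^2 = (\<Sum>i\<in>UNIV. \<Sum>j\<in>UNIV. (A $ i $ j)^2)" for A :: "real^'n^'m"
  by (simp only: power2_norm_eq_inner inner_vec_def) (simp add: power2_eq_square)

lemma norm_transpose: "norm (transpose A) = norm (A::real^'n^'m)"
proof -
  have "(norm (transpose A))^2 = (norm A)^2"
    unfolding norm_matrix_square by (simp add: transpose_def) (rule sum.swap)
  then show ?thesis
    by (simp only: power2_eq_iff_nonneg norm_ge_zero)
qed

text \<open>Right multiplication by \<open>A\<close> applies the orthogonal matrix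
  \<open>transpose A\<close> to every row, and the Frobenius norm is built from the norms of the
  rows.\<close>

lemma norm_orthogonal_mul_right:
  assumes "orthogonal_matrix (A::real^'n^'n)"
  shows "norm ((B::real^'n^'n) ** A) = norm B"
proof -
  have "norm ((B ** A) $ i) = norm (B $ i)" for i
  proof -
    have "(B ** A) $ i = transpose A *v (B $ i)"
      by (simp add: vec_eq_iff matrix_matrix_mult_def matrix_vector_mult_def transpose_def mult.commute
          del: transpose_matrix_vector)
    then show ?thesis
      using orthogonal_matrix_norm[of "transpose A"] assms by (simp del: transpose_matrix_vector)
  qed
  then show ?thesis
    by (simp add: norm_vec_def[of B] norm_vec_def[of "B ** A"])
qed

lemma norm_orthogonal_mul_left:
  assumes "orthogonal_matrix (A::real^'n^'n)"
  shows "norm (A ** (B::real^'n^'n)) = norm B"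
  using norm_orthogonal_mul_right[of "transpose A" "transpose B"] assms
  by (metis matrix_transpose_mul norm_transpose orthogonal_matrix_transpose)

section \<open>Group laws and the action on points\<close>

lemma SE_gone: "gone \<in> SE"
  by (simp add: SE_def gone_def rotation_matrix_one)

lemma SE_gmul: "g \<in> SE \<Longrightarrow> h \<in> SE \<Longrightarrow> gmul g h \<in> SE"
  by (simp add: SE_def gmul_def rotation_matrix_mul)

lemma SE_ginv: "g \<in> SE \<Longrightarrow> ginv g \<in> SE"
  by (simp add: SE_def ginv_def rotation_matrix_transpose)

lemma gmul_assoc: "gmul (gmul a b) c = gmul a (gmul b c)"
  by (simp add: gmul_def matrix_mul_assoc matrix_vector_mul_assoc matrix_vector_right_distrib)

lemma gmul_gone [simp]: "gmul g gone = g" "gmul gone g = g"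
  by (simp_all add: gmul_def gone_def)

lemma transpose_mul_self: "g \<in> SE \<Longrightarrow> transpose (fst g) ** fst g = mat 1"
  "g \<in> SE \<Longrightarrow> fst g ** transpose (fst g) = mat 1"
  by (auto simp: SE_def rotation_matrix_def orthogonal_matrix_def)

lemma gmul_ginv_left: "g \<in> SE \<Longrightarrow> gmul (ginv g) g = gone"
  by (simp add: gmul_def gone_def ginv_def transpose_mul_self)

lemma gmul_ginv_right: "g \<in> SE \<Longrightarrow> gmul g (ginv g) = gone"
  by (simp add: gmul_def gone_def ginv_def transpose_mul_self matrix_vector_neg
      matrix_vector_mul_assoc del: transpose_matrix_vector)

lemma gmul_cancel_left: "g \<in> SE \<Longrightarrow> gmul (ginv g) (gmul g h) = h"
  by (simp add: gmul_assoc[symmetric] gmul_ginv_left)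

lemma gmul_cancel_left': "g \<in> SE \<Longrightarrow> gmul g (gmul (ginv g) h) = h"
  by (simp add: gmul_assoc[symmetric] gmul_ginv_right)

lemma ginv_ginv: "g \<in> SE \<Longrightarrow> ginv (ginv g) = g"
  by (metis SE_ginv gmul_cancel_left gmul_gone(1) gmul_ginv_left)

lemma act_gone [simp]: "act gone x = x"
  by (simp add: act_def gone_def)

lemma act_gmul: "act (gmul g h) x = act g (act h x)"
  by (simp add: act_def gmul_def matrix_vector_right_distrib matrix_vector_mul_assoc)

lemma act_ginv: "g \<in> SE \<Longrightarrow> act (ginv g) (act g x) = x" "g \<in> SE \<Longrightarrow> act g (act (ginv g) x) = x"
  by (simp_all add: act_gmul[symmetric] gmul_ginv_left gmul_ginv_right)

lemma act_inj: "act g = act h \<Longrightarrow> g = h"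
proof -
  assume eq: "act g = act h"
  have "snd g = snd h"
    using fun_cong[OF eq, of 0] by (simp add: act_def)
  moreover have "fst g = fst h"
    using eq calculation by (simp add: act_def fun_eq_iff matrix_eq)
  ultimately show ?thesis
    by (simp add: prod_eq_iff)
qed

lemma dist_act: "g \<in> SE \<Longrightarrow> dist (act g x) (act g y) = dist x y"
  by (simp add: act_def dist_norm matrix_vector_mult_diff_distrib[symmetric] SE_def rotation_matrix_def orthogonal_matrix_norm)

lemma bij_act: "g \<in> SE \<Longrightarrow> bij (act g)"
  by (rule o_bij[of "act (ginv g)"]) (auto simp: act_ginv)

lemma act_image_ginv: "g \<in> SE \<Longrightarrow> act g ` P = act (ginv g) -` P"
  by (auto simp: act_ginv image_iff) (metis act_ginv(2))

lemma act_image_image: "act g ` act h ` P = act (gmul g h) ` P"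
  by (auto simp: act_gmul image_iff)

lemma continuous_on_act: "continuous_on A (act g)"
  unfolding act_def by (intro continuous_intros linear_continuous_on matrix_vector_mul_bounded_linear)

text \<open>An isometry that fixes the origin is linear and orthogonal; its determinant is then 1 or
  -1, and the sign condition leaves 1.\<close>

lemma rigid_motion_iff: "rigid_motion f \<longleftrightarrow> (\<exists>g\<in>SE. f = act g)"
proof
  assume f: "rigid_motion f"
  define L where "L = (\<lambda>x. f x - f 0)"
  have "dist (L x) (L y) = dist x y" for x y
    using f by (simp add: L_def rigid_motion_def dist_norm)
  then have L: "orthogonal_transformation L"
    unfolding orthogonal_transformation_isometry by (simp add: L_def)
  then have lin: "linear L" "orthogonal_matrix (matrix L)"
    by (auto simp: orthogonal_transformation_matrix)
  have "det (matrix L) = 1 \<or> det (matrix L) = -1"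
    using lin(2) det_orthogonal_matrix by blast
  moreover have "det (matrix L) > 0"
    using f by (simp add: rigid_motion_def L_def)
  ultimately have "rotation_matrix (matrix L)"
    using lin by (auto simp: rotation_matrix_def)
  moreover have "f = act (matrix L, f 0)"
    using lin(1) by (auto simp: act_def fun_eq_iff matrix_works L_def)
  ultimately show "\<exists>g\<in>SE. f = act g"
    by (intro bexI[of _ "(matrix L, f 0)"]) (auto simp: SE_def)
next
  assume "\<exists>g\<in>SE. f = act g"
  then obtain g where g: "g \<in> SE" "f = act g" by blast
  have "(\<lambda>x. f x - f 0) = (*v) (fst g)"
    using g by (auto simp: act_def)
  then show "rigid_motion f"
    using g dist_act[of g] by (auto simp: rigid_motion_def SE_def rotation_matrix_def)
qed

section \<open>Estimates for motions near the identity\<close>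

lemma near_one_gmul:
  assumes "near_one d g" "near_one e h" "g \<in> SE"
  shows "near_one (d + e) (gmul g h)"
proof -
  have o: "orthogonal_matrix (fst g)"
    using assms(3) by (simp add: SE_def rotation_matrix_def)
  have "norm (fst g ** fst h - mat 1) \<le> norm (fst g ** (fst h - mat 1)) + norm (fst g - mat 1)"
    using norm_triangle_ineq[of "fst g ** (fst h - mat 1)" "fst g - mat 1"]
    by (simp add: matrix_diff_ldistrib)
  moreover have "norm (fst g *v snd h + snd g) \<le> norm (snd h) + norm (snd g)"
    using norm_triangle_ineq[of "fst g *v snd h" "snd g"] orthogonal_matrix_norm[OF o] by simp
  ultimately show ?thesis
    using assms(1,2) norm_orthogonal_mul_left[OF o] by (auto simp: near_one_def gmul_def)
qed

lemma near_one_ginv: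
  assumes "near_one e g" "g \<in> SE"
  shows "near_one e (ginv g)"
proof -
  have "transpose (fst g) - mat 1 = transpose (fst g - mat 1)"
    by (simp add: transpose_diff)
  moreover have "norm (transpose (fst g) *v snd g) = norm (snd g)"
    using assms(2) by (intro orthogonal_matrix_norm) (simp add: SE_def rotation_matrix_def)
  ultimately show ?thesis
    using assms(1) by (simp add: near_one_def ginv_def norm_transpose del: transpose_matrix_vector)
qed

text \<open>The matrix \<open>fst g - mat 1\<close> is conjugated by an orthogonal matrix and keeps
  its norm, whereas the translation part becomes \<open>(fst g - mat 1) *v snd h + snd g\<close> up
  to a rotation and grows with \<open>snd h\<close>. Hence the factor \<open>1 + c\<close>.\<close>

lemma near_one_conj:
  assumes "near_one e g" "g \<in> SE" "h \<in> SE" "norm (snd h) \<le> c"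
  shows "near_one (e * (1 + c)) (gmul (ginv h) (gmul g h))"
proof -
  have o: "orthogonal_matrix (fst h)" "orthogonal_matrix (transpose (fst h))"
    using assms(3) by (simp_all add: SE_def rotation_matrix_def)
  have e: "0 < e" and c: "0 \<le> c"
    using assms(1,4) norm_ge_zero[of "snd g"] norm_ge_zero[of "snd h"] unfolding near_one_def by linarith+
  have "fst (gmul (ginv h) (gmul g h)) - mat 1 = transpose (fst h) ** (fst g - mat 1) ** fst h"
    using assms(3) by (simp add: gmul_def ginv_def matrix_diff_ldistrib matrix_diff_rdistrib
        matrix_mul_assoc transpose_mul_self)
  then have 1: "norm (fst (gmul (ginv h) (gmul g h)) - mat 1) < e"
    using assms(1) by (simp add: norm_orthogonal_mul_left norm_orthogonal_mul_right o near_one_def)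
  have "snd (gmul (ginv h) (gmul g h)) = transpose (fst h) *v ((fst g - mat 1) *v snd h + snd g)"
    by (simp add: gmul_def ginv_def matrix_vector_mult_diff_rdistrib matrix_vector_right_distrib
       matrix_vector_mult_diff_distrib algebra_simps del: transpose_matrix_vector)
  then have "norm (snd (gmul (ginv h) (gmul g h))) = norm ((fst g - mat 1) *v snd h + snd g)"
    using o(2) orthogonal_matrix_norm by metis
  also have "\<dots> \<le> norm (fst g - mat 1) * norm (snd h) + norm (snd g)"
    by (meson add_mono norm_matrix_vector_le norm_triangle_le order_refl)
  also have "\<dots> \<le> e * c + norm (snd g)"
    using assms(1,4) e by (intro add_right_mono mult_mono) (auto simp: near_one_def)
  also have "\<dots> < e * (1 + c)"
    using assms(1) by (simp add: near_one_def algebra_simps)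
  finally have 2: "norm (snd (gmul (ginv h) (gmul g h))) < e * (1 + c)" .
  have "e \<le> e * (1 + c)"
    using e c by (simp add: algebra_simps)
  then show ?thesis
    using 1 2 by (simp add: near_one_def)
qed

lemma near_one_mono: "near_one d g \<Longrightarrow> d \<le> e \<Longrightarrow> near_one e g"
  by (auto simp: near_one_def)

lemma near_one_gone: "0 < e \<Longrightarrow> near_one e gone"
  by (simp add: near_one_def gone_def)

lemma near_one_if_dist: "dist g gone < e \<Longrightarrow> near_one e g"
  using norm_fst_le[of "fst g - mat 1" "snd g"] norm_snd_le[of "snd g" "fst g - mat 1"]
  by (cases g) (auto simp: near_one_def gone_def dist_norm)

lemma dist_if_near_one: "near_one e g \<Longrightarrow> dist g gone < 2 * e"
  using norm_Pair_le[of "fst g - mat 1" "snd g"]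
  by (cases g) (auto simp: near_one_def gone_def dist_norm)

lemma near_one_displacement:
  assumes "near_one e g"
  shows "norm (act g x - x) \<le> e * (1 + norm x)"
proof -
  have "act g x - x = (fst g - mat 1) *v x + snd g"
    by (simp add: act_def matrix_vector_mult_diff_rdistrib)
  then have "norm (act g x - x) \<le> norm (fst g - mat 1) * norm x + norm (snd g)"
    by (metis add_mono norm_matrix_vector_le norm_triangle_le order_refl)
  also have "\<dots> \<le> e * norm x + e"
    using assms by (intro add_mono mult_right_mono) (auto simp: near_one_def)
  finally show ?thesis
    by (simp add: algebra_simps)
qed

lemma norm_act_le: "g \<in> SE \<Longrightarrow> norm (act g x) \<le> norm x + norm (snd g)"
  using norm_triangle_ineq[of "fst g *v x" "snd g"]
  by (simp add: act_def SE_def rotation_matrix_def orthogonal_matrix_norm)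

text \<open>\<open>small_motion\<close> translates before it rotates, \<open>act\<close> afterwards;
  the translation parts \<open>v\<close> and \<open>A *v v\<close> have equal norm, so the bound
  \<open>e\<close> is unaffected.\<close>

lemma small_motion_iff: "small_motion e f \<longleftrightarrow> (\<exists>g\<in>SE. near_one e g \<and> f = act g)"
proof
  assume "small_motion e f"
  then obtain A v where A: "rotation_matrix A" "norm (A - mat 1) < e" "norm v < e" "f = (\<lambda>x. A *v (x + v))"
    unfolding small_motion_def by blast
  then have "(A, A *v v) \<in> SE" "near_one e (A, A *v v)" "f = act (A, A *v v)"
    by (auto simp: SE_def near_one_def act_def matrix_vector_right_distrib orthogonal_matrix_norm rotation_orth)
  then show "\<exists>g\<in>SE. near_one e g \<and> f = act g" by blast
next
  assume "\<exists>g\<in>SE. near_one e g \<and> f = act g"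
  then obtain g where g: "g \<in> SE" "near_one e g" "f = act g" by blast
  let ?v = "transpose (fst g) *v snd g"
  have "fst g *v ?v = snd g"
    using g by (simp add: matrix_vector_mul_assoc transpose_mul_self del: transpose_matrix_vector)
  moreover have "norm ?v = norm (snd g)"
    using g by (intro orthogonal_matrix_norm) (simp add: SE_def rotation_matrix_def)
  ultimately show "small_motion e f"
    unfolding small_motion_def using g
    by (intro exI[of _ "fst g"] exI[of _ ?v])
       (auto simp: SE_def near_one_def act_def fun_eq_iff matrix_vector_right_distrib
         simp del: transpose_matrix_vector)
qed

section \<open>Continuity of the group operations\<close>

lemma bilinear_matrix_mult: "bounded_bilinear ((**) :: real^'n^'m \<Rightarrow> real^'k^'n \<Rightarrow> real^'k^'m)"
  unfolding bilinear_conv_bounded_bilinear[symmetric] bilinear_def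
  by (intro conjI allI linearI)
     (simp_all add: matrix_add_ldistrib matrix_add_rdistrib scalar_matrix_assoc matrix_scalar_ac flip: scalar_mult_eq_scaleR)

lemma bilinear_matrix_vector_mult: "bounded_bilinear ((*v) :: real^'n^'m \<Rightarrow> real^'n \<Rightarrow> real^'m)"
  unfolding bilinear_conv_bounded_bilinear[symmetric] bilinear_def
  by (intro conjI allI linearI)
     (simp_all add: matrix_vector_right_distrib matrix_vector_mult_add_rdistrib matrix_vector_mult_scaleR scaleR_matrix_vector_assoc)

lemmas continuous_matrix_intros = bounded_bilinear.continuous_on[OF bilinear_matrix_mult]
  bounded_bilinear.continuous_on[OF bilinear_matrix_vector_mult]

lemma bounded_linear_transpose: "bounded_linear (transpose :: real^'n^'m \<Rightarrow> _)"
  unfolding linear_conv_bounded_linear[symmetric]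
  by (intro linearI) (simp_all add: transpose_add transpose_scalar)

lemma continuous_on_gmul:
  assumes "continuous_on A f" "continuous_on A g"
  shows "continuous_on A (\<lambda>x. gmul (f x) (g x))"
  unfolding gmul_def by (intro continuous_intros continuous_matrix_intros assms)

lemma continuous_on_ginv:
  assumes "continuous_on A f"
  shows "continuous_on A (\<lambda>x. ginv (f x))"
  unfolding ginv_def
  by (intro continuous_intros continuous_matrix_intros assms bounded_linear.continuous_on[OF bounded_linear_transpose])

lemma continuous_on_act_apply:
  assumes "continuous_on A f" "continuous_on A g"
  shows "continuous_on A (\<lambda>x. act (f x) (g x))"
  unfolding act_def by (intro continuous_intros continuous_matrix_intros assms)

section \<open>Smooth maps\<close>

text \<open>On an open set, equality of functions passes to their derivatives, because a derivative
  depends only on the germ.\<close>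

lemma Ck_on_cong:
  assumes "open S" "\<And>x. x \<in> S \<Longrightarrow> f x = g x"
  shows "Ck_on k S f \<longleftrightarrow> Ck_on k S g"
  using assms(2)
proof (induction k arbitrary: f g)
  case 0
  then show ?case by (simp cong: continuous_on_cong)
next
  case (Suc k)
  have ev: "eventually (\<lambda>y. f y = g y) (at x)" if "x \<in> S" for x
    using assms(1) that Suc.prems eventually_at_topological by blast
  have 1: "f differentiable at x \<longleftrightarrow> g differentiable at x" if "x \<in> S" for x
    using has_derivative_transform_eventually[of f _ x UNIV g] has_derivative_transform_eventually[of g _ x UNIV f]
      ev[OF that] Suc.prems[OF that] unfolding differentiable_def by (metis (mono_tags, lifting) UNIV_I eventually_mono)
  have 2: "frechet_derivative f (at x) = frechet_derivative g (at x)" if "x \<in> S" for x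
  proof -
    have "(f has_derivative D) (at x) \<longleftrightarrow> (g has_derivative D) (at x)" for D
      using has_derivative_transform_within_open[OF _ assms(1) that, of f D UNIV g]
        has_derivative_transform_within_open[OF _ assms(1) that, of g D UNIV f] Suc.prems by auto
    then show ?thesis by (simp add: frechet_derivative_def)
  qed
  have "Ck_on k S (\<lambda>x. frechet_derivative f (at x) v) \<longleftrightarrow> Ck_on k S (\<lambda>x. frechet_derivative g (at x) v)" for v
    by (rule Suc.IH) (simp add: 2)
  then show ?case using 1 by simp
qed

text \<open>Replaces the choice operator hidden in \<open>frechet_derivative\<close> by an explicit
  derivative, so that the inductions below can work with the usual rules of differentiation.\<close>

lemma Ck_on_SucI:
  assumes "open S" "\<And>x. x \<in> S \<Longrightarrow> (f has_derivative f' x) (at x)" "\<And>v. Ck_on k S (\<lambda>x. f' x v)"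
  shows "Ck_on (Suc k) S f"
proof -
  have "frechet_derivative f (at x) = f' x" if "x \<in> S" for x
    using assms(2)[OF that] frechet_derivative_at by metis
  then have "Ck_on k S (\<lambda>x. frechet_derivative f (at x) v) \<longleftrightarrow> Ck_on k S (\<lambda>x. f' x v)" for v
    by (intro Ck_on_cong assms(1)) simp
  then show ?thesis
    using assms(2,3) by (auto simp: differentiable_def)
qed

lemma Ck_on_has_derivative:
  assumes "Ck_on (Suc k) S f" "x \<in> S"
  shows "(f has_derivative frechet_derivative f (at x)) (at x)"
  using assms by (simp add: frechet_derivative_works)

lemma Ck_on_continuous: "Ck_on k S f \<Longrightarrow> continuous_on S f"
  by (cases k) (auto intro!: continuous_at_imp_continuous_on differentiable_imp_continuous_within)

lemma Ck_on_Suc_imp: "Ck_on (Suc k) S f \<Longrightarrow> Ck_on k S f"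
proof (induction k arbitrary: f)
  case 0
  then show ?case using Ck_on_continuous Ck_on.simps(1) by blast
next
  case (Suc k)
  then show ?case by (metis Ck_on.simps(2))
qed

lemma Ck_on_const: "Ck_on k S (\<lambda>x. c)"
  by (induction k arbitrary: c) auto

lemma Ck_on_subset: "Ck_on k S f \<Longrightarrow> T \<subseteq> S \<Longrightarrow> Ck_on k T f"
  by (induction k arbitrary: f) (auto intro: continuous_on_subset)

lemma Ck_on_bounded_linear:
  assumes "open S" "bounded_linear L" "Ck_on k S f"
  shows "Ck_on k S (\<lambda>x. L (f x))"
  using assms(3)
proof (induction k arbitrary: f)
  case 0
  then show ?case using bounded_linear.continuous_on[OF assms(2)] by simp
next
  case (Suc k)
  show ?case
  proof (rule Ck_on_SucI[OF assms(1)])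
    fix x assume "x \<in> S"
    then show "((\<lambda>x. L (f x)) has_derivative (\<lambda>v. L (frechet_derivative f (at x) v))) (at x)"
      using Ck_on_has_derivative[OF Suc.prems] bounded_linear.has_derivative[OF assms(2)] by blast
  next
    show "Ck_on k S (\<lambda>x. L (frechet_derivative f (at x) v))" for v
      using Suc by simp
  qed
qed

lemma Ck_on_linear: "bounded_linear L \<Longrightarrow> Ck_on k UNIV L"
proof (cases k)
  case (Suc j)
  assume L: "bounded_linear L"
  show ?thesis unfolding Suc
  proof (rule Ck_on_SucI)
    show "(L has_derivative L) (at x)" for x
      using L by (rule bounded_linear_imp_has_derivative)
  qed (simp_all add: Ck_on_const)
qed (simp add: linear_continuous_on)

lemma Ck_on_add:
  assumes "open S" "Ck_on k S f" "Ck_on k S g"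
  shows "Ck_on k S (\<lambda>x. f x + g x)"
  using assms(2,3)
proof (induction k arbitrary: f g)
  case 0
  then show ?case by (simp add: continuous_on_add)
next
  case (Suc k)
  show ?case
  proof (rule Ck_on_SucI[OF assms(1)])
    fix x assume "x \<in> S"
    then show "((\<lambda>x. f x + g x) has_derivative (\<lambda>v. frechet_derivative f (at x) v + frechet_derivative g (at x) v)) (at x)"
      using Ck_on_has_derivative Suc.prems by (intro has_derivative_add) blast+
  next
    show "Ck_on k S (\<lambda>x. frechet_derivative f (at x) v + frechet_derivative g (at x) v)" for v
      using Suc by simp
  qed
qed

lemma Ck_on_minus: "open S \<Longrightarrow> Ck_on k S f \<Longrightarrow> Ck_on k S (\<lambda>x. - f x)"
  by (rule Ck_on_bounded_linear[OF _ bounded_linear_minus[OF bounded_linear_ident]])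

lemma Ck_on_bilinear:
  assumes "open S" "bounded_bilinear B" "Ck_on k S f" "Ck_on k S g"
  shows "Ck_on k S (\<lambda>x. B (f x) (g x))"
  using assms(3,4)
proof (induction k arbitrary: f g)
  case 0
  then show ?case using bounded_bilinear.continuous_on[OF assms(2)] by simp
next
  case (Suc k)
  show ?case
  proof (rule Ck_on_SucI[OF assms(1)])
    fix x assume "x \<in> S"
    then show "((\<lambda>x. B (f x) (g x)) has_derivative
        (\<lambda>v. B (f x) (frechet_derivative g (at x) v) + B (frechet_derivative f (at x) v) (g x))) (at x)"
      using Ck_on_has_derivative[OF Suc.prems(1)] Ck_on_has_derivative[OF Suc.prems(2)]
      by (intro bounded_bilinear.FDERIV[OF assms(2)]) blast+
  next
    \<comment> \<open>In the product rule each factor also occurs undifferentiated; it is needed at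
      order \<open>k\<close>, one below its given order.\<close>
    show "Ck_on k S (\<lambda>x. B (f x) (frechet_derivative g (at x) v) + B (frechet_derivative f (at x) v) (g x))" for v
      using Suc.prems Suc.IH Ck_on_Suc_imp[OF Suc.prems(1)] Ck_on_Suc_imp[OF Suc.prems(2)]
      by (intro Ck_on_add assms(1)) auto
  qed
qed

lemma Ck_on_Pair:
  assumes "open S" "Ck_on k S f" "Ck_on k S g"
  shows "Ck_on k S (\<lambda>x. (f x, g x))"
proof -
  \<comment> \<open>Linear embeddings of the two factors reduce pairing to addition.\<close>
  have "Ck_on k S (\<lambda>x. (f x, 0) + (0, g x))"
    by (intro Ck_on_add Ck_on_bounded_linear[OF assms(1), of "\<lambda>y. (y, 0)"]
        Ck_on_bounded_linear[OF assms(1), of "\<lambda>y. (0, y)"] assms bounded_linear_intros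
        bounded_linear_Pair bounded_linear_zero bounded_linear_ident)
  then show ?thesis by simp
qed

section \<open>Matrix inversion is smooth\<close>

lemma matrix_inv_mul:
  "invertible (A::real^'n^'n) \<Longrightarrow> A ** matrix_inv A = mat 1"
  "invertible (A::real^'n^'n) \<Longrightarrow> matrix_inv A ** A = mat 1"
  using someI_ex[of "\<lambda>A'. A ** A' = mat 1 \<and> A' ** A = mat 1"]
  unfolding invertible_def matrix_inv_def by auto

lemma matrix_inv_unique:
  "A ** B = mat 1 \<Longrightarrow> matrix_inv (A::real^'n^'n) = B"
  by (metis invertible_def matrix_inv_mul(2) matrix_left_right_inverse matrix_mul_assoc matrix_mul_lid matrix_mul_rid)

lemma continuous_on_det:
  fixes F :: "'a::topological_space \<Rightarrow> real^'n^'n"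
  assumes "continuous_on S F"
  shows "continuous_on S (\<lambda>x. det (F x))"
  unfolding det_def by (intro continuous_intros assms)

text \<open>Cramer's rule, in the form that exhibits the entries of the inverse as quotients of
  determinants; it gives the continuity of inversion that its differentiability presupposes.\<close>

lemma matrix_inv_entry:
  fixes A :: "real^'n^'n"
  assumes "invertible A"
  shows "matrix_inv A $ k $ j = det (\<chi> i l. if l = k then axis j 1 $ i else A $ i $ l) / det A"
proof -
  have d: "det A \<noteq> 0"
    using assms invertible_det_nz by blast
  have "A *v (matrix_inv A *v axis j 1) = axis j 1"
    by (simp add: matrix_vector_mul_assoc matrix_inv_mul assms)
  then have "matrix_inv A *v axis j 1 = (\<chi> k. det (\<chi> i l. if l = k then axis j 1 $ i else A $ i $ l) / det A)"
    using cramer[OF d] by blast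
  moreover have "(matrix_inv A *v axis j 1) $ k = matrix_inv A $ k $ j"
    by (simp add: matrix_vector_mul_component inner_axis)
  ultimately show ?thesis by simp
qed

lemma continuous_on_matrix_inv:
  fixes F :: "'a::topological_space \<Rightarrow> real^'n^'n"
  assumes "continuous_on S F" "\<And>x. x \<in> S \<Longrightarrow> invertible (F x)"
  shows "continuous_on S (\<lambda>x. matrix_inv (F x))"
proof -
  have "continuous_on S (\<lambda>x. \<chi> k j. det (\<chi> i l. if l = k then axis j 1 $ i else F x $ i $ l) / det (F x))"
  proof (intro continuous_intros continuous_on_det assms(1))
    show "continuous_on S (\<lambda>x. if l = k then axis j 1 $ i else F x $ i $ l)" for i j k l
      using assms(1) by (cases "l = k") (auto intro!: continuous_intros)
    show "\<forall>x\<in>S. det (F x) \<noteq> 0"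
      using assms(2) invertible_det_nz by blast
  qed
  moreover have "matrix_inv (F x) = (\<chi> k j. det (\<chi> i l. if l = k then axis j 1 $ i else F x $ i $ l) / det (F x))"
    if "x \<in> S" for x
    using matrix_inv_entry[OF assms(2)[OF that]] by (simp add: vec_eq_iff)
  ultimately show ?thesis
    by (simp cong: continuous_on_cong)
qed

lemma open_invertible: "open {A::real^'n^'n. invertible A}"
proof -
  have "open (det -` (- {0}) :: (real^'n^'n) set)"
    by (intro open_vimage continuous_on_det continuous_on_id) auto
  moreover have "det -` (- {0}) = {A::real^'n^'n. invertible A}"
    using invertible_det_nz by auto
  ultimately show ?thesis by simp
qed

text \<open>By the resolvent identity the remainder is, up to sign,
  \<open>(matrix_inv B - matrix_inv A) ** (B - A) ** matrix_inv A\<close>. Divided by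
  \<open>norm (B - A)\<close>, it is bounded by a multiple of
  \<open>norm (matrix_inv B - matrix_inv A)\<close>, which tends to 0.\<close>

lemma has_derivative_matrix_inv:
  fixes A :: "real^'n^'n"
  assumes "invertible A"
  shows "(matrix_inv has_derivative (\<lambda>H. - (matrix_inv A ** H ** matrix_inv A))) (at A)"
proof -
  let ?mul = "(**) :: real^'n^'n \<Rightarrow> real^'n^'n \<Rightarrow> real^'n^'n"
  interpret mm: bounded_bilinear ?mul by (rule bilinear_matrix_mult)
  obtain K where K: "0 < K" "\<And>X Y. norm (?mul X Y) \<le> norm X * norm Y * K"
    using mm.pos_bounded by blast
  have "open {A::real^'n^'n. invertible A}" by (rule open_invertible)
  then obtain e where e: "0 < e" "\<And>B::real^'n^'n. dist B A < e \<Longrightarrow> invertible B"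
    using assms unfolding open_dist by blast
  show ?thesis
  proof (rule has_derivativeI_sandwich[OF e(1), where H = "\<lambda>B. norm (matrix_inv B - matrix_inv A) * norm (matrix_inv A) * K * K"])
    show "bounded_linear (\<lambda>H. - (matrix_inv A ** H ** matrix_inv A))"
      by (intro bounded_linear_minus mm.bounded_linear_left[THEN bounded_linear_compose] mm.bounded_linear_right)
  next
    fix B :: "real^'n^'n" assume B: "B \<noteq> A" "dist B A < e"
    have "invertible B" using B e by blast
    note inv = matrix_inv_mul[OF this] matrix_inv_mul[OF assms]
    have a: "(matrix_inv B ** A - mat 1) ** matrix_inv A = matrix_inv B - matrix_inv A"
      by (simp add: matrix_diff_rdistrib inv flip: matrix_mul_assoc)
    have h: "matrix_inv B - matrix_inv A = - (matrix_inv B ** (B - A) ** matrix_inv A)"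
      unfolding matrix_diff_ldistrib using a by (simp add: inv matrix_diff_rdistrib)
    have s: "(matrix_inv B - matrix_inv A) ** (B - A) ** matrix_inv A
        = matrix_inv B ** (B - A) ** matrix_inv A - matrix_inv A ** (B - A) ** matrix_inv A"
      by (simp only: matrix_diff_rdistrib)
    have "matrix_inv B - matrix_inv A - - (matrix_inv A ** (B - A) ** matrix_inv A)
        = - ((matrix_inv B - matrix_inv A) ** (B - A) ** matrix_inv A)"
      by (subst s, subst h) simp
    then have "norm (matrix_inv B - matrix_inv A - - (matrix_inv A ** (B - A) ** matrix_inv A))
        = norm ((matrix_inv B - matrix_inv A) ** (B - A) ** matrix_inv A)"
      by (metis norm_minus_cancel)
    also have "\<dots> \<le> norm ((matrix_inv B - matrix_inv A) ** (B - A)) * norm (matrix_inv A) * K"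
      by (rule K(2))
    also have "\<dots> \<le> (norm (matrix_inv B - matrix_inv A) * norm (B - A) * K) * norm (matrix_inv A) * K"
      using K by (intro mult_right_mono) auto
    finally show "norm (matrix_inv B - matrix_inv A - - (matrix_inv A ** (B - A) ** matrix_inv A)) / norm (B - A)
        \<le> norm (matrix_inv B - matrix_inv A) * norm (matrix_inv A) * K * K"
      using B(1) by (simp add: divide_simps mult_ac)
  next
    have "continuous_on {A::real^'n^'n. invertible A} matrix_inv"
      by (rule continuous_on_matrix_inv[OF continuous_on_id]) simp
    then have "isCont matrix_inv A"
      using continuous_on_eq_continuous_at[OF open_invertible] assms by blast
    then have "((\<lambda>B. norm (matrix_inv B - matrix_inv A)) \<longlongrightarrow> 0) (at A)"
      by (simp add: isCont_def LIM_zero tendsto_norm_zero)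
    then show "((\<lambda>B. norm (matrix_inv B - matrix_inv A) * norm (matrix_inv A) * K * K) \<longlongrightarrow> 0) (at A)"
      by (intro tendsto_mult_left_zero)
  qed
qed

text \<open>The derivative of the inverse is a product of inverses and the derivative of
  \<open>F\<close>; so order \<open>k\<close> of the inverse itself yields order \<open>k\<close> of
  its derivative, and the induction closes.\<close>

lemma Ck_on_matrix_inv:
  fixes F :: "'a::real_normed_vector \<Rightarrow> real^'n^'n"
  assumes "open S" "\<And>x. x \<in> S \<Longrightarrow> invertible (F x)" "Ck_on k S F"
  shows "Ck_on k S (\<lambda>x. matrix_inv (F x))"
  using assms(3)
proof (induction k)
  case 0
  then show ?case using continuous_on_matrix_inv[OF _ assms(2)] by simp
next
  case (Suc k)
  show ?case
  proof (rule Ck_on_SucI[OF assms(1)])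
    fix x assume x: "x \<in> S"
    show "((\<lambda>x. matrix_inv (F x)) has_derivative
        (\<lambda>v. - (matrix_inv (F x) ** frechet_derivative F (at x) v ** matrix_inv (F x)))) (at x)"
      using has_derivative_compose[OF Ck_on_has_derivative[OF Suc.prems x] has_derivative_matrix_inv[OF assms(2)[OF x]]] .
  next
    fix v
    have i: "Ck_on k S (\<lambda>x. matrix_inv (F x))"
      by (rule Suc.IH[OF Ck_on_Suc_imp[OF Suc.prems]])
    have d: "Ck_on k S (\<lambda>x. frechet_derivative F (at x) v)"
      using Suc.prems by simp
    have "Ck_on k S (\<lambda>x. matrix_inv (F x) ** frechet_derivative F (at x) v ** matrix_inv (F x))"
      by (rule Ck_on_bilinear[OF assms(1) bilinear_matrix_mult Ck_on_bilinear[OF assms(1) bilinear_matrix_mult i d] i])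
    then show "Ck_on k S (\<lambda>x. - (matrix_inv (F x) ** frechet_derivative F (at x) v ** matrix_inv (F x)))"
      by (rule Ck_on_minus[OF assms(1)])
  qed
qed

section \<open>The Cayley transform\<close>

text \<open>Preferred to the exponential because it is a rational involution: smoothness of the map
  and of its inverse both reduce to matrix inversion. It exchanges skew matrices with rotations that
  do not have the eigenvalue -1.\<close>

definition cayley :: "real^'n^'n \<Rightarrow> real^'n^'n" where
  "cayley A = matrix_inv (mat 1 + A) ** (mat 1 - A)"

text \<open>With \<open>B\<close> the inverse of \<open>mat 1 + A\<close>, the sum and the
  difference of \<open>mat 1\<close> and \<open>cayley A\<close> are \<open>2 B\<close> and
  \<open>2 B A\<close>.\<close>

lemma cayley_cayley:
  assumes "invertible (mat 1 + A)"
  shows "invertible (mat 1 + cayley A)" "cayley (cayley A) = A"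
proof -
  let ?B = "matrix_inv (mat 1 + A)"
  note B = matrix_inv_mul[OF assms]
  have one: "mat 1 = ?B ** (mat 1 + A)" using B by simp
  have "mat 1 + cayley A = ?B ** (mat 1 + A) + ?B ** (mat 1 - A)"
    using B by (simp add: cayley_def)
  also have "\<dots> = 2 *\<^sub>R ?B"
    by (simp add: matrix_add_ldistrib matrix_diff_ldistrib scaleR_2)
  finally have p: "mat 1 + cayley A = 2 *\<^sub>R ?B" .
  have "mat 1 - cayley A = ?B ** (mat 1 + A) - ?B ** (mat 1 - A)"
    using B by (simp add: cayley_def)
  also have "\<dots> = 2 *\<^sub>R (?B ** A)"
    by (simp add: matrix_add_ldistrib matrix_diff_ldistrib scaleR_2)
  finally have m: "mat 1 - cayley A = 2 *\<^sub>R (?B ** A)" .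
  interpret mm: bounded_bilinear "(**) :: real^'a^'a \<Rightarrow> real^'a^'a \<Rightarrow> real^'a^'a"
    by (rule bilinear_matrix_mult)
  have r: "(2 *\<^sub>R ?B) ** ((1/2) *\<^sub>R (mat 1 + A)) = mat 1"
    by (simp add: mm.scaleR_left mm.scaleR_right B del: scaleR_add_right)
  then show "invertible (mat 1 + cayley A)"
    unfolding p using invertible_right_inverse by blast
  have "matrix_inv (mat 1 + cayley A) = (1/2) *\<^sub>R (mat 1 + A)"
    unfolding p using r by (rule matrix_inv_unique)
  then have "cayley (cayley A) = ((1/2) *\<^sub>R (mat 1 + A)) ** (2 *\<^sub>R (?B ** A))"
    using m by (simp add: cayley_def[of "cayley A"])
  also have "\<dots> = A"
    by (simp add: mm.scaleR_left mm.scaleR_right B matrix_mul_assoc del: scaleR_add_right)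
  finally show "cayley (cayley A) = A" .
qed

text \<open>For skew \<open>K\<close> the form \<open>inner x (K *v x)\<close> vanishes, so
  \<open>mat 1 + K\<close> has trivial kernel. Since \<open>mat 1 - K\<close> is its transpose, the
  two determinants cancel in the quotient.\<close>

lemma cayley_skew:
  assumes K: "transpose K = - (K::real^'n^'n)"
  shows "invertible (mat 1 + K)" "rotation_matrix (cayley K)"
proof -
  have "x = 0" if "(mat 1 + K) *v x = 0" for x
  proof -
    have "inner x (K *v x) = inner (transpose K *v x) x"
      using dot_lmul_matrix[of x K x] by simp
    also have "\<dots> = - inner x (K *v x)"
      by (simp add: K inner_commute bounded_bilinear.minus_left[OF bilinear_matrix_vector_mult] del: transpose_matrix_vector)
    finally have "inner x (K *v x) = 0" by simp
    moreover have "inner x ((mat 1 + K) *v x) = 0" using that by simp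
    ultimately show ?thesis by (simp add: matrix_vector_mult_add_rdistrib inner_add_right)
  qed
  then show inv: "invertible (mat 1 + K)"
    using matrix_left_invertible_ker invertible_left_inverse by blast
  have t: "transpose (mat 1 + K) = mat 1 - K" "transpose (mat 1 - K) = mat 1 + K"
    by (simp_all add: transpose_add transpose_diff K)
  let ?B = "matrix_inv (mat 1 + K)"
  note B = matrix_inv_mul[OF inv]
  have D: "(mat 1 - K) ** transpose ?B = mat 1" "transpose ?B ** (mat 1 - K) = mat 1"
    by (metis B t(1) matrix_transpose_mul transpose_mat)+
  have comm: "(mat 1 + K) ** (mat 1 - K) = (mat 1 - K) ** (mat 1 + K)"
    by (simp add: matrix_add_ldistrib matrix_add_rdistrib matrix_diff_ldistrib matrix_diff_rdistrib)
  \<comment> \<open>\<open>?B\<close> and its transpose commute because their inverses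
    \<open>mat 1 + K\<close> and \<open>mat 1 - K\<close> do.\<close>
  have "transpose ?B ** ?B = ?B ** transpose ?B"
  proof -
    have "matrix_inv ((mat 1 + K) ** (mat 1 - K)) = transpose ?B ** ?B"
      by (rule matrix_inv_unique) (metis B(1) D(1) matrix_mul_assoc matrix_mul_lid)
    moreover have "matrix_inv ((mat 1 - K) ** (mat 1 + K)) = ?B ** transpose ?B"
      by (rule matrix_inv_unique) (metis B(1) D(1) matrix_mul_assoc matrix_mul_lid)
    ultimately show ?thesis using comm by simp
  qed
  then have "transpose (cayley K) ** cayley K = mat 1"
    unfolding cayley_def matrix_transpose_mul t by (metis B(1) D(2) matrix_mul_assoc matrix_mul_lid)
  moreover have "det (cayley K) = 1"
  proof -
    have "det (mat 1 - K) = det (mat 1 + K)" by (metis det_transpose t(1))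
    then have "det (cayley K) = det (?B ** (mat 1 + K))"
      by (simp add: cayley_def det_mul)
    then show ?thesis using B by simp
  qed
  ultimately show "rotation_matrix (cayley K)"
    by (simp add: rotation_matrix_def orthogonal_matrix)
qed

text \<open>Transposing \<open>(mat 1 + A) ** X = mat 1 - A\<close> and multiplying by
  \<open>A\<close> on the right turns \<open>transpose A\<close> into \<open>mat 1\<close>, so that
  \<open>transpose X ** (mat 1 + A)\<close> becomes \<open>A - mat 1\<close>; the invertible factor
  then cancels.\<close>

lemma cayley_orthogonal:
  assumes A: "orthogonal_matrix A" "invertible (mat 1 + A)"
  shows "transpose (cayley A) = - cayley (A::real^'n^'n)"
proof -
  let ?X = "cayley A"
  note B = matrix_inv_mul[OF A(2)]
  have comm: "(mat 1 - A) ** (mat 1 + A) = (mat 1 + A) ** (mat 1 - A)"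
    by (simp add: matrix_add_ldistrib matrix_add_rdistrib matrix_diff_ldistrib matrix_diff_rdistrib)
  have X: "(mat 1 + A) ** ?X = mat 1 - A"
    by (simp add: cayley_def matrix_mul_assoc B)
  have X': "?X ** (mat 1 + A) = mat 1 - A"
    unfolding cayley_def by (metis B(2) comm matrix_mul_assoc matrix_mul_lid)
  have o: "transpose A ** A = mat 1" using A(1) by (simp add: orthogonal_matrix)
  have "transpose ?X ** (transpose (mat 1 + A)) ** A = transpose (mat 1 - A) ** A"
    using X by (metis matrix_transpose_mul)
  then have "transpose ?X ** (mat 1 + A) = A - mat 1"
    by (simp add: transpose_add transpose_diff matrix_diff_rdistrib matrix_add_rdistrib o add.commute
        flip: matrix_mul_assoc)
  also have "\<dots> = (- ?X) ** (mat 1 + A)"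
    using X' by (simp add: bounded_bilinear.minus_left[OF bilinear_matrix_mult])
  finally have "transpose ?X ** (mat 1 + A) ** matrix_inv (mat 1 + A) = (- ?X) ** (mat 1 + A) ** matrix_inv (mat 1 + A)"
    by simp
  then show ?thesis
    by (simp add: B flip: matrix_mul_assoc)
qed

lemma Ck_on_cayley:
  fixes F :: "'a::real_normed_vector \<Rightarrow> real^'n^'n"
  assumes "open S" "\<And>x. x \<in> S \<Longrightarrow> invertible (mat 1 + F x)" "Ck_on k S F"
  shows "Ck_on k S (\<lambda>x. cayley (F x))"
proof -
  note add = Ck_on_add[OF assms(1) Ck_on_const[of k S "mat 1"]]
  show ?thesis
    unfolding cayley_def
    using Ck_on_bilinear[OF assms(1) bilinear_matrix_mult
        Ck_on_matrix_inv[OF assms(1,2) add[OF assms(3)]] add[OF Ck_on_minus[OF assms(1,3)]]]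
    by simp
qed

section \<open>Linear coordinates on skew matrices and translations\<close>

lemma card_increasing_pairs:
  fixes e :: "'n::finite \<Rightarrow> nat"
  assumes "inj e"
  shows "card {p. e (fst p) < e (snd p)} = CARD('n) * (CARD('n) - 1) div 2"
proof -
  let ?P = "{p. e (fst p) < e (snd p)} :: ('n \<times> 'n) set"
  let ?D = "(\<lambda>i. (i, i)) ` (UNIV :: 'n set)"
  have U: "(UNIV :: ('n \<times> 'n) set) = ?P \<union> (prod.swap ` ?P \<union> ?D)"
    using assms by (auto simp: image_iff inj_def)
  moreover have "?P \<inter> (prod.swap ` ?P \<union> ?D) = {}" "prod.swap ` ?P \<inter> ?D = {}"
    by auto
  ultimately have "CARD('n \<times> 'n) = card ?P + (card (prod.swap ` ?P) + card ?D)"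
    unfolding U by (simp only: card_Un_disjoint finite)
  moreover have "card (prod.swap ` ?P) = card ?P" "card ?D = CARD('n)"
    by (auto intro!: card_image inj_onI)
  ultimately have "CARD('n) * CARD('n) = 2 * card ?P + CARD('n)"
    by (simp add: card_cartesian_product flip: UNIV_Times_UNIV)
  then show ?thesis
    by (simp add: diff_mult_distrib2)
qed

text \<open>These are linear coordinates on the Lie algebra of the group. The index type carries no
  order, so an injection \<open>e\<close> into the naturals decides which entries lie above the
  diagonal. \<open>M\<close> reads off entries of an arbitrary pair and is thus linear on the whole
  space.\<close>

lemma skew_coordinates:
  assumes "CARD('m::finite) = CARD('n::finite) + CARD('n) * (CARD('n) - 1) div 2"
  obtains L :: "real^'m::finite \<Rightarrow> 'n::finite motion" and M where
    "bounded_linear L" "bounded_linear M" "\<And>v. M (L v) = v"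
    "\<And>v. transpose (fst (L v)) = - fst (L v)"
    "\<And>g. transpose (fst g) = - fst g \<Longrightarrow> L (M g) = g"
proof -
  obtain e :: "'n \<Rightarrow> nat" where e: "inj e"
    using finite_imp_inj_to_nat_seg[of "UNIV :: 'n set"] by auto
  let ?P = "{p. e (fst p) < e (snd p)} :: ('n \<times> 'n) set"
  define J where "J = (Inl ` UNIV \<union> Inr ` ?P :: ('n + 'n \<times> 'n) set)"
  have "card J = CARD('n) + card ?P"
    unfolding J_def by (subst card_Un_disjoint) (auto simp: card_image)
  then have "card J = CARD('m)"
    using card_increasing_pairs[OF e] assms by simp
  then obtain b where b: "bij_betw b J (UNIV :: 'm set)"
    using finite_same_card_bij[of J "UNIV :: 'm set"] by (auto simp: J_def)
  define ix where "ix = inv_into J b"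
  have ix: "ix (b j) = j" if "j \<in> J" for j
    using b that by (simp add: ix_def bij_betw_inv_into_left)
  have ix': "b (ix k) = k" "ix k \<in> J" for k
    using b by (auto simp: ix_def bij_betw_inv_into_right bij_betw_def inv_into_into)
  define L :: "real^'m \<Rightarrow> 'n motion" where
    "L = (\<lambda>v. ((\<chi> i j. if e i < e j then v $ b (Inr (i, j)) else if e j < e i then - v $ b (Inr (j, i)) else 0),
               (\<chi> i. v $ b (Inl i))))"
  define M :: "'n motion \<Rightarrow> real^'m" where
    "M = (\<lambda>g. \<chi> k. case ix k of Inl i \<Rightarrow> snd g $ i | Inr p \<Rightarrow> fst g $ fst p $ snd p)"
  show thesis
  proof
    show "bounded_linear L"
      unfolding linear_conv_bounded_linear[symmetric] L_def
      by (intro linearI) (auto simp: vec_eq_iff)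
    show "bounded_linear M"
      unfolding linear_conv_bounded_linear[symmetric] M_def
      by (intro linearI) (auto simp: vec_eq_iff split: sum.splits)
    show "M (L v) = v" for v
    proof -
      have "M (L v) $ k = v $ k" for k
      proof (cases "ix k")
        case (Inl i)
        then show ?thesis using ix'(1)[of k] by (simp add: M_def L_def)
      next
        case (Inr p)
        then have "e (fst p) < e (snd p)" using ix'(2)[of k] by (auto simp: J_def)
        then show ?thesis using ix'(1)[of k] Inr by (simp add: M_def L_def)
      qed
      then show ?thesis by (simp add: vec_eq_iff)
    qed
    show "transpose (fst (L v)) = - fst (L v)" for v
      by (auto simp: L_def transpose_def vec_eq_iff)
    show "L (M g) = g" if g: "transpose (fst g) = - fst g" for g
    proof (rule prod_eqI)
      have sk: "fst g $ j $ i = - fst g $ i $ j" for i j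
      proof -
        have "transpose (fst g) $ i $ j = - fst g $ i $ j" by (simp add: g)
        then show ?thesis by (simp add: transpose_def)
      qed
      have up: "M g $ b (Inr (i, j)) = fst g $ i $ j" if "e i < e j" for i j
        using that ix[of "Inr (i, j)"] by (auto simp: M_def J_def)
      have eq: "i = j" if "\<not> e i < e j" "\<not> e j < e i" for i j
        using that e by (metis injD linorder_neqE_nat)
      have dg: "fst g $ i $ i = 0" for i using sk[of i i] by simp
      have "fst (L (M g)) $ i $ j = fst g $ i $ j" for i j
      proof -
        consider "e i < e j" | "e j < e i" | "\<not> e i < e j" "\<not> e j < e i" by blast
        then show ?thesis
        proof cases
          case 1
          then show ?thesis using up[of i j] by (simp add: L_def)
        next
          case 2
          then show ?thesis using up[of j i] sk[of i j] by (simp add: L_def)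
        next
          case 3
          then show ?thesis using eq[of i j] dg by (simp add: L_def)
        qed
      qed
      then show "fst (L (M g)) = fst g"
        by (simp add: vec_eq_iff)
      show "snd (L (M g)) = snd g"
        using ix by (auto simp: L_def M_def vec_eq_iff J_def)
    qed
  qed
qed

text \<open>\<open>P\<close> is a rescaled Cayley transform, and \<open>D\<close> consists of the pairs whose matrix part does not
  have the eigenvalue \<open>-1\<close>.\<close>

lemma motion_chart:
  assumes "CARD('m::finite) = CARD('n::finite) + CARD('n) * (CARD('n) - 1) div 2" and "0 < d"
  obtains P :: "real^'m::finite \<Rightarrow> 'n::finite motion" and Q D where
    "open D" "continuous_on D Q" "continuous_on UNIV P" "\<And>v. P v \<in> SE \<inter> D" "P 0 = gone"
    "\<And>v. Q (P v) = v" "\<And>g. g \<in> SE \<inter> D \<Longrightarrow> P (Q g) = g"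
    "\<And>v. v \<in> cbox (-2) 2 \<Longrightarrow> near_one d (P v)"
    "\<And>k c. Ck_on k {v. gmul (P v) c \<in> D} (\<lambda>v. Q (gmul (P v) c))"
proof -
  obtain L :: "real^'m \<Rightarrow> 'n::finite motion" and M where L: "bounded_linear L" and M: "bounded_linear M"
    and inv_L: "\<And>v. M (L v) = v" and sk: "\<And>v. transpose (fst (L v)) = - fst (L v)"
    and LM: "\<And>g. transpose (fst g) = - fst g \<Longrightarrow> L (M g) = g"
    using skew_coordinates[OF assms(1)] by blast
  define P1 where "P1 v = (cayley (fst (L v)), snd (L v))" for v
  define D :: "'n motion set" where "D = {g. invertible (mat 1 + fst g)}"
  define Q1 where "Q1 g = M (cayley (fst g), snd g)" for g
  have P1SE: "P1 v \<in> SE" "P1 v \<in> D" for v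
    using cayley_skew[OF sk] cayley_cayley(1) by (auto simp: P1_def SE_def D_def)
  have QP1: "Q1 (P1 v) = v" for v
    using cayley_cayley(2)[OF cayley_skew(1)[OF sk]] inv_L by (simp add: P1_def Q1_def)
  have PQ1: "P1 (Q1 g) = g" if g: "g \<in> SE" "g \<in> D" for g
  proof -
    have "L (Q1 g) = (cayley (fst g), snd g)"
      unfolding Q1_def using g by (intro LM) (simp add: SE_def D_def cayley_orthogonal rotation_orth)
    then show ?thesis using g cayley_cayley(2) by (simp add: P1_def D_def prod_eq_iff)
  qed
  have P10: "P1 0 = gone"
    using linear_0[OF bounded_linear.linear[OF L]] matrix_inv_unique[of "mat 1" "mat 1"]
    by (simp add: P1_def gone_def cayley_def zero_prod_def)
  have Dopen: "open D"
  proof -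
    have "D = (\<lambda>g. det (mat 1 + fst g)) -` (- {0})"
      using invertible_det_nz by (auto simp: D_def)
    moreover have "open \<dots>"
      by (intro open_vimage continuous_on_det continuous_intros)
    ultimately show ?thesis by simp
  qed
  \<comment> \<open>Stated for any linear \<open>F\<close> with skew values, to cover
    \<open>L\<close> and its rescaling by \<open>s\<close> alike.\<close>
  have CP0: "Ck_on k UNIV (\<lambda>v. (cayley (fst (F v)), snd (F v)))"
    if "bounded_linear F" "\<And>v. transpose (fst (F v)) = - fst (F v)" for k and F :: "real^'m \<Rightarrow> 'n motion"
  proof (intro Ck_on_Pair Ck_on_cayley open_UNIV)
    show "Ck_on k UNIV (\<lambda>v. fst (F v))"
      by (rule Ck_on_bounded_linear[OF open_UNIV bounded_linear_fst Ck_on_linear[OF that(1)]])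
    show "Ck_on k UNIV (\<lambda>v. snd (F v))"
      by (rule Ck_on_bounded_linear[OF open_UNIV bounded_linear_snd Ck_on_linear[OF that(1)]])
    show "invertible (mat 1 + fst (F v))" for v
      by (rule cayley_skew(1)[OF that(2)])
  qed
  have CP1: "Ck_on k UNIV P1" for k
    using CP0[OF L sk] by (simp add: P1_def[abs_def])
  have CQ1: "Ck_on k S (\<lambda>v. Q1 (F v))" if "open S" "Ck_on k S F" "\<And>v. v \<in> S \<Longrightarrow> F v \<in> D"
    for k F and S :: "'a::real_normed_vector set"
  proof -
    have "Ck_on k S (\<lambda>v. fst (F v))" "Ck_on k S (\<lambda>v. snd (F v))"
      using Ck_on_bounded_linear[OF that(1) bounded_linear_fst that(2)]
        Ck_on_bounded_linear[OF that(1) bounded_linear_snd that(2)] by auto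
    then have "Ck_on k S (\<lambda>v. (cayley (fst (F v)), snd (F v)))"
      using that(3) by (intro Ck_on_Pair that(1) Ck_on_cayley) (auto simp: D_def)
    then show ?thesis
      unfolding Q1_def by (rule Ck_on_bounded_linear[OF that(1) M])
  qed
  have "isCont P1 0"
    using Ck_on_continuous[OF CP1] continuous_on_eq_continuous_at by blast
  then obtain h where h: "0 < h" "\<And>v. dist v 0 < h \<Longrightarrow> dist (P1 v) (P1 0) < d"
    using assms(2) unfolding continuous_at_eps_delta by metis
  \<comment> \<open>On [-2,2]^m the norm is at most 2m, by comparison with the sum of the absolute
    coordinates; the scale \<open>s\<close> brings the cube into the ball of radius
    \<open>h\<close>, strictly because of the \<open>+ 1\<close>.\<close>
  define s where "s = h / (2 * CARD('m) + 1)"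
  have s: "s > 0" using h(1) by (simp add: s_def add_pos_pos)
  define P where "P v = P1 (s *\<^sub>R v)" for v
  define Q where "Q g = (1/s) *\<^sub>R Q1 g" for g
  have CP: "Ck_on k UNIV P" for k
    using CP0[OF bounded_linear_compose[OF L bounded_linear_scaleR_right] sk, of k s]
    by (simp add: P_def[abs_def] P1_def)
  have contP: "continuous_on UNIV P"
    by (rule Ck_on_continuous[OF CP[of 0]])
  show thesis
  proof
    show "open D" by (rule Dopen)
    show "continuous_on D Q"
      unfolding Q_def
      by (intro continuous_intros Ck_on_continuous[of 0] CQ1 Dopen Ck_on_linear[THEN Ck_on_subset] bounded_linear_ident) auto
    show "continuous_on UNIV P" by (rule contP)
    show "P v \<in> SE \<inter> D" for v using P1SE by (simp add: P_def)
    show "P 0 = gone" by (simp add: P_def P10)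
    show "Q (P v) = v" for v using s by (simp add: P_def Q_def QP1)
    show "P (Q g) = g" if "g \<in> SE \<inter> D" for g using that s by (simp add: P_def Q_def PQ1)
    show "near_one d (P v)" if "v \<in> cbox (-2) 2" for v
    proof -
      have "norm v \<le> (\<Sum>i\<in>UNIV. \<bar>v $ i\<bar>)" by (rule norm_le_l1_cart)
      also have "\<dots> \<le> of_nat CARD('m) * 2"
        using that by (intro sum_bounded_above) (auto simp: mem_box_cart abs_le_iff minus_le_iff)
      finally have "norm (s *\<^sub>R v) \<le> s * (2 * CARD('m))" using s by simp
      also have "\<dots> < s * (2 * CARD('m) + 1)" using s by simp
      also have "\<dots> = h" by (simp add: s_def add_nonneg_pos)
      finally have "dist (P v) gone < d" using h(2) by (simp add: P_def P10)
      then show ?thesis by (rule near_one_if_dist)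
    qed
    show "Ck_on k {v. gmul (P v) c \<in> D} (\<lambda>v. Q (gmul (P v) c))" for k c
    proof -
      let ?S = "{v. gmul (P v) c \<in> D}"
      have "?S = (\<lambda>v. gmul (P v) c) -` D" by auto
      then have S: "open ?S"
        using open_vimage[OF Dopen] continuous_on_gmul[OF contP continuous_on_const] by metis
      have CPS: "Ck_on k ?S P" using CP Ck_on_subset by blast
      have f: "Ck_on k ?S (\<lambda>v. fst (P v))" and g: "Ck_on k ?S (\<lambda>v. snd (P v))"
        using Ck_on_bounded_linear[OF S bounded_linear_fst CPS] Ck_on_bounded_linear[OF S bounded_linear_snd CPS] by auto
      have "Ck_on k ?S (\<lambda>v. gmul (P v) c)"
        by (subst gmul_def, rule Ck_on_Pair[OF S Ck_on_bilinear[OF S bilinear_matrix_mult f Ck_on_const]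
           Ck_on_add[OF S Ck_on_bilinear[OF S bilinear_matrix_vector_mult f Ck_on_const] g]])
      then have "Ck_on k ?S (\<lambda>v. Q1 (gmul (P v) c))"
        by (intro CQ1 S) auto
      then show ?thesis
        unfolding Q_def by (rule Ck_on_bounded_linear[OF S bounded_linear_scaleR_right])
    qed
  qed
qed

section \<open>Connectedness of the group of rigid motions\<close>

text \<open>The Householder matrix: for a unit vector \<open>u\<close>, the reflection in the
  hyperplane orthogonal to \<open>u\<close>.\<close>

definition reflection_matrix :: "real^'n \<Rightarrow> real^'n^'n" where
  "reflection_matrix u = mat 1 - 2 *\<^sub>R (\<chi> i j. u $ i * u $ j)"

lemma reflection_matrix_apply: "reflection_matrix u *v x = x - (2 * inner u x) *\<^sub>R u"
proof -
  have "(\<Sum>j\<in>UNIV. u $ i * u $ j * x $ j) = inner u x * u $ i" for i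
    by (simp add: inner_vec_def sum_distrib_left sum_distrib_right mult_ac)
  then have "(\<chi> i j. u $ i * u $ j) *v x = inner u x *\<^sub>R u"
    by (simp add: vec_eq_iff matrix_vector_mult_def)
  then show ?thesis
    by (simp add: reflection_matrix_def matrix_vector_mult_diff_rdistrib scaleR_matrix_vector_assoc[symmetric])
qed

lemma reflection_matrix_involution:
  assumes "norm u = 1"
  shows "reflection_matrix u ** reflection_matrix u = mat 1"
proof -
  have "inner u u = 1" using assms by (simp add: norm_eq_1)
  then show ?thesis
    by (simp add: matrix_eq matrix_vector_mul_assoc[symmetric] reflection_matrix_apply inner_diff_right)
qed

lemma orthogonal_reflection_matrix:
  assumes "norm u = 1"
  shows "orthogonal_matrix (reflection_matrix u)"
proof -
  have "transpose (reflection_matrix u) = reflection_matrix u"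
    by (simp add: reflection_matrix_def transpose_def vec_eq_iff mat_def mult.commute)
  then show ?thesis
    using reflection_matrix_involution[OF assms] by (simp add: orthogonal_matrix)
qed

lemma det_reflection_axis: "det (reflection_matrix (axis k 1) :: real^'n^'n) = -1"
proof -
  let ?R = "reflection_matrix (axis k 1) :: real^'n^'n"
  have e: "?R $ i $ j = (if i = j then if i = k then -1 else 1 else 0)" for i j
    by (auto simp: reflection_matrix_def mat_def axis_def)
  have "det ?R = (\<Prod>i\<in>UNIV. ?R $ i $ i)"
    by (rule det_diagonal) (simp add: e)
  also have "\<dots> = -1"
    by (simp add: e prod.delta cong: if_cong)
  finally show ?thesis .
qed

lemma continuous_on_reflection_matrix: "continuous_on S reflection_matrix"
  unfolding reflection_matrix_def by (intro continuous_intros)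

text \<open>A reflection that sends \<open>A *v axis i 1\<close> to \<open>axis i 1\<close> leaves
  the axes fixed by \<open>A\<close> in place, so fewer axes are moved. The reflection factor is
  then dragged along the unit sphere, connected in dimension at least 2, to the reflection at
  \<open>axis k 1\<close>; modulo its square, only the identity and this reflection remain.\<close>

lemma orthogonal_connected_component:
  fixes A :: "real^'n^'n" and k :: 'n
  assumes "2 \<le> CARD('n)" "orthogonal_matrix A"
  shows "connected_component {M. orthogonal_matrix M} A (mat 1) \<or>
    connected_component {M. orthogonal_matrix M} A (reflection_matrix (axis k 1))"
  using assms(2)
proof (induction "card {i. A *v axis i 1 \<noteq> axis i 1}" arbitrary: A rule: less_induct)
  case less
  let ?O = "{M :: real^'n^'n. orthogonal_matrix M}"
  let ?R = "reflection_matrix (axis k 1) :: real^'n^'n"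
  show ?case
  proof (cases "\<exists>i. A *v axis i 1 \<noteq> axis i 1")
    case False
    have "A = mat 1"
    proof -
      have "column i A = column i (mat 1)" for i
        using False by (metis matrix_vector_mul_lid matrix_vector_mult_basis)
      then show ?thesis by (simp add: column_def vec_eq_iff)
    qed
    then show ?thesis
      using less.prems by (auto simp: connected_component_refl_eq)
  next
    case True
    then obtain i where i: "A *v axis i 1 \<noteq> axis i 1" by blast
    define w where "w = A *v axis i 1 - axis i 1"
    define u where "u = w /\<^sub>R norm w"
    have w: "w \<noteq> 0" using i by (simp add: w_def)
    then have u: "norm u = 1" by (simp add: u_def)
    let ?A = "reflection_matrix u ** A"
    have nA: "norm (A *v x) = norm x" for x
      using orthogonal_matrix_norm[OF less.prems] .
    have iA: "inner (A *v x) (A *v y) = inner x y" for x y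
      using less.prems orthogonal_transformation_matrix[of "(*v) A"]
      by (simp add: orthogonal_transformation_def)
    have oA: "orthogonal_matrix ?A"
      by (intro orthogonal_matrix_mul orthogonal_reflection_matrix u less.prems)
    \<comment> \<open>Both vectors have length 1, so the projection of \<open>A *v axis i 1\<close>
      onto the line of \<open>w\<close> is half of \<open>w\<close>, and the reflection subtracts
      all of \<open>w\<close>.\<close>
    have ww: "inner w (A *v axis i 1) = inner w w / 2"
      using iA[of "axis i 1" "axis i 1"] by (simp add: w_def inner_diff inner_commute field_simps)
    have "?A *v axis i 1 = axis i 1"
    proof -
      have "(2 * inner u (A *v axis i 1)) *\<^sub>R u = (2 * inner w (A *v axis i 1) / (norm w)^2) *\<^sub>R w"
        by (simp add: u_def power2_eq_square field_simps)
      also have "\<dots> = w"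
        using w unfolding ww by (simp add: power2_norm_eq_inner)
      finally have "(2 * inner u (A *v axis i 1)) *\<^sub>R u = w" .
      then have "?A *v axis i 1 = A *v axis i 1 - w"
        by (simp add: reflection_matrix_apply flip: matrix_vector_mul_assoc)
      then show ?thesis by (simp add: w_def)
    qed
    moreover have "?A *v axis j 1 = axis j 1" if "A *v axis j 1 = axis j 1" for j
    proof -
      have "j \<noteq> i" using that i by auto
      have "inner w (axis j 1) = inner (A *v axis i 1) (A *v axis j 1) - inner (axis i 1) (axis j 1 :: real^'n)"
        by (simp add: w_def inner_diff that)
      then have "inner u (axis j 1) = 0" by (simp add: iA u_def)
      then show ?thesis
        by (simp add: reflection_matrix_apply that flip: matrix_vector_mul_assoc)
    qed
    ultimately have "{i. ?A *v axis i 1 \<noteq> axis i 1} \<subset> {i. A *v axis i 1 \<noteq> axis i 1}"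
      using i by blast
    then have "card {i. ?A *v axis i 1 \<noteq> axis i 1} < card {i. A *v axis i 1 \<noteq> axis i 1}"
      by (simp add: psubset_card_mono)
    from less.hyps[OF this oA] obtain X where X: "X = mat 1 \<or> X = ?R" "connected_component ?O ?A X"
      by blast
    obtain C where C: "connected C" "C \<subseteq> ?O" "?A \<in> C" "X \<in> C"
      using X(2) by (auto simp: connected_component_def)
    have "connected ((**) (reflection_matrix u) ` C)"
      by (intro connected_continuous_image continuous_matrix_intros continuous_intros C)
    moreover have "(**) (reflection_matrix u) ` C \<subseteq> ?O"
      using C(2) u by (auto intro: orthogonal_matrix_mul orthogonal_reflection_matrix)
    moreover have "reflection_matrix u ** ?A = A"
      using reflection_matrix_involution[OF u] by (simp add: matrix_mul_assoc)
    then have "A \<in> (**) (reflection_matrix u) ` C"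
      using C(3) by (metis imageI)
    ultimately have 1: "connected_component ?O A (reflection_matrix u ** X)"
      using C(4) unfolding connected_component_def by blast
    \<comment> \<open>Moves the normal of the mirror from \<open>u\<close> to
      \<open>axis k 1\<close> while \<open>X\<close> stays fixed.\<close>
    let ?S = "(\<lambda>v. reflection_matrix v ** X) ` sphere 0 1"
    have "connected (sphere (0::real^'n) 1)"
      using assms(1) by (intro connected_sphere) simp
    then have "connected ?S"
      by (intro connected_continuous_image continuous_matrix_intros continuous_intros continuous_on_reflection_matrix)
    moreover have oX: "orthogonal_matrix X" using C by blast
    then have "?S \<subseteq> ?O"
      using orthogonal_matrix_mul[OF orthogonal_reflection_matrix oX] by auto
    moreover have "u \<in> sphere 0 1" "axis k 1 \<in> sphere (0::real^'n) 1" using u by auto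
    ultimately have 2: "connected_component ?O (reflection_matrix u ** X) (?R ** X)"
      unfolding connected_component_def by blast
    have "?R ** X = mat 1 \<or> ?R ** X = ?R"
      using X(1) reflection_matrix_involution[of "axis k 1 :: real^'n"] by auto
    then show ?thesis
      using connected_component_trans[OF 1 2] by auto
  qed
qed

text \<open>The determinant is continuous with values 1 and -1 on orthogonal matrices, hence
  constant on connected sets: a rotation cannot be joined to the reflection, and a connected set
  that joins it to the identity consists of rotations.\<close>

lemma connected_SE:
  assumes "2 \<le> CARD('n::finite)"
  shows "connected (SE :: 'n motion set)"
proof -
  let ?S = "{A::real^'n^'n. rotation_matrix A}"
  have "connected_component ?S A (mat 1)" if A: "A \<in> ?S" for A
  proof -
    have dets: "det X = det Y" if XY: "connected_component {M. orthogonal_matrix M} X Y" for X Y :: "real^'n^'n"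
    proof -
      obtain C where C: "connected C" "C \<subseteq> {M. orthogonal_matrix M}" "X \<in> C" "Y \<in> C"
        using XY by (auto simp: connected_component_def)
      have "connected (det ` C)"
        unfolding det_def by (intro connected_continuous_image C continuous_intros)
      moreover have "finite (det ` C)"
      proof (rule finite_subset)
        show "det ` C \<subseteq> {1, -1}" using C(2) det_orthogonal_matrix by blast
      qed simp
      ultimately have "det ` C = {} \<or> (\<exists>d. det ` C = {d})"
        by (simp add: connected_finite_iff_sing)
      then show ?thesis using C(3,4) by (metis empty_iff imageI singletonD)
    qed
    obtain k :: 'n where True by simp
    have "\<not> connected_component {M. orthogonal_matrix M} A (reflection_matrix (axis k 1))"
      using dets[of A "reflection_matrix (axis k 1)"] A
      by (auto simp: det_reflection_axis rotation_matrix_def)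
    then have "connected_component {M. orthogonal_matrix M} A (mat 1)"
      using orthogonal_connected_component[OF assms, of A k] A by (auto simp: rotation_matrix_def)
    then obtain C where C: "connected C" "C \<subseteq> {M. orthogonal_matrix M}" "A \<in> C" "mat 1 \<in> C"
      by (auto simp: connected_component_def)
    have "C \<subseteq> ?S"
    proof
      fix X assume "X \<in> C"
      then have "connected_component {M. orthogonal_matrix M} X (mat 1)"
        using C by (auto simp: connected_component_def)
      then show "X \<in> ?S"
        using dets[of X "mat 1"] C \<open>X \<in> C\<close> by (auto simp: rotation_matrix_def)
    qed
    then show ?thesis using C by (auto simp: connected_component_def)
  qed
  then have "connected ?S"
    unfolding connected_iff_connected_component
    by (meson connected_component_sym connected_component_trans)
  then have "connected (?S \<times> (UNIV :: (real^'n) set))"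
    by (intro connected_Times connected_UNIV)
  moreover have "?S \<times> (UNIV :: (real^'n) set) = SE"
    by (auto simp: SE_def)
  ultimately show ?thesis by simp
qed

section \<open>Rigid motions acting on tilings\<close>

lemma act_image_eq: "act g ` S = (+) (snd g) ` (*v) (fst g) ` S"
  by (auto simp: act_def add.commute image_iff)

lemma inj_rotation: "g \<in> SE \<Longrightarrow> inj ((*v) (fst g))"
proof (rule injI)
  fix x y assume g: "g \<in> SE" and "fst g *v x = fst g *v y"
  then have "act g x = act g y" by (simp add: act_def)
  then show "x = y" using g dist_act[of g x y] by simp
qed

lemma act_image_topology:
  assumes "g \<in> SE"
  shows "interior (act g ` S) = act g ` interior S" "closure (act g ` S) = act g ` closure S"
    "frontier (act g ` S) = act g ` frontier S"
proof -
  note l = matrix_vector_mul_linear[of "fst g"] inj_rotation[OF assms]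
  show 1: "interior (act g ` S) = act g ` interior S"
    unfolding act_image_eq interior_translation interior_injective_linear_image[OF l] ..
  show 2: "closure (act g ` S) = act g ` closure S"
    unfolding act_image_eq closure_translation closure_injective_linear_image[OF l, symmetric] ..
  show "frontier (act g ` S) = act g ` frontier S"
    unfolding frontier_def 1 2 using bij_act[OF assms] by (simp add: bij_is_inj image_set_diff)
qed

lemma polytope_act: "polytope P \<Longrightarrow> polytope (act g ` P)"
  unfolding act_image_eq polytope_translation_eq
  by (intro polytope_linear_image matrix_vector_mul_linear)

lemma polyhedral_tile_act:
  assumes "g \<in> SE" "polyhedral_tile P"
  shows "polyhedral_tile (act g ` P)"
proof -
  obtain C where C: "finite C" "C \<noteq> {}" "\<And>X. X \<in> C \<Longrightarrow> polytope X \<and> interior X \<noteq> {}" "P = \<Union>C"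
    using assms(2) unfolding polyhedral_tile_def by blast
  then show ?thesis
    unfolding polyhedral_tile_def
    by (intro exI[of _ "(`) (act g) ` C"]) (auto simp: polytope_act act_image_topology[OF assms(1)])
qed

text \<open>The displacement \<open>v\<close> corresponds to \<open>transpose (fst g) *v v\<close>,
  which has the same norm, so the same radius \<open>e\<close> serves. The converse is the same
  implication for \<open>ginv g\<close>.\<close>

lemma same_germ_act:
  assumes "g \<in> SE"
  shows "same_germ (act g ` P) (act g x) (act g y) \<longleftrightarrow> same_germ P x y"
proof -
  have *: "same_germ (act g ` P) (act g x) (act g y)" if g: "g \<in> SE" and sg: "same_germ P x y" for g P and x y :: "real^'a"
  proof -
    obtain e where e: "e > 0" "\<forall>v. norm v < e \<longrightarrow> (x + v \<in> P \<longleftrightarrow> y + v \<in> P)"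
      using sg unfolding same_germ_def by (elim exE conjE)
    have "act g z + v \<in> act g ` P \<longleftrightarrow> z + transpose (fst g) *v v \<in> P" for z v
    proof -
      have "act g (z + transpose (fst g) *v v) = act g z + v"
        using g by (simp add: act_def matrix_vector_right_distrib matrix_vector_mul_assoc
            transpose_mul_self del: transpose_matrix_vector)
      then show ?thesis
        using bij_act[OF g] by (metis bij_is_inj inj_image_mem_iff)
    qed
    moreover have "norm (transpose (fst g) *v v) = norm v" for v
      using g by (intro orthogonal_matrix_norm) (simp add: SE_def rotation_matrix_def)
    ultimately show ?thesis
      unfolding same_germ_def using e by (intro exI[of _ e]) (simp del: transpose_matrix_vector)
  qed
  have "same_germ (act (ginv g) ` act g ` P) (act (ginv g) (act g x)) (act (ginv g) (act g y))"
    if "same_germ (act g ` P) (act g x) (act g y)"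
    using *[OF SE_ginv[OF assms] that] .
  moreover have "act (ginv g) ` act g ` P = P"
    by (simp add: image_image act_ginv assms)
  ultimately show ?thesis
    using *[OF assms, of P x y] by (auto simp: act_ginv assms)
qed

text \<open>\<open>act g\<close> is a homeomorphism from germ class to germ class, so it matches
  their connected components and the closures of these.\<close>

lemma polyhedral_faces_act:
  assumes "g \<in> SE"
  shows "polyhedral_faces (act g ` P) = (`) (act g) ` polyhedral_faces P"
proof -
  have g: "closure (connected_component_set {y. same_germ (act g ` P) (act g x) y} (act g x)) =
      act g ` closure (connected_component_set {y. same_germ P x y} x)" for x
  proof -
    let ?S = "{y. same_germ P x y}"
    have "y \<in> act g ` ?S" if "same_germ (act g ` P) (act g x) y" for y
    proof -
      have "same_germ P x (act (ginv g) y)"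
        using that same_germ_act[OF assms, of P x "act (ginv g) y"] by (simp add: act_ginv assms)
      then show ?thesis
        by (intro image_eqI[of _ _ "act (ginv g) y"]) (simp_all add: act_ginv assms)
    qed
    then have S: "{y. same_germ (act g ` P) (act g x) y} = act g ` ?S"
      using same_germ_act[OF assms] by blast
    have "same_germ P x x" by (auto simp: same_germ_def intro: exI[of _ 1])
    then have "x \<in> ?S" by simp
    moreover have "homeomorphism ?S (act g ` ?S) (act g) (act (ginv g))"
      unfolding homeomorphism_def using assms
      by (auto simp: act_ginv continuous_on_act image_iff)
    ultimately have "connected_component_set (act g ` ?S) (act g x) = act g ` connected_component_set ?S x"
      by (metis connected_component_set_homeomorphism)
    then show ?thesis unfolding S by (simp add: act_image_topology[OF assms])
  qed
  have "polyhedral_faces Q = (\<lambda>x. closure (connected_component_set {y. same_germ Q x y} x)) ` Q"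
    for Q :: "(real^'a) set"
    by (auto simp: polyhedral_faces_def)
  then show ?thesis
    using g by (simp add: image_image)
qed

lemma meet_face_to_face_act:
  assumes "g \<in> SE" "meet_face_to_face P Q"
  shows "meet_face_to_face (act g ` P) (act g ` Q)"
proof -
  have inj: "inj (act g)" using bij_act[OF assms(1)] by (simp add: bij_is_inj)
  obtain F where F: "F \<subseteq> polyhedral_faces P \<inter> polyhedral_faces Q" "P \<inter> Q = \<Union>F"
    "P \<inter> Q \<subseteq> frontier P \<inter> frontier Q"
    using assms(2) unfolding meet_face_to_face_def by blast
  have i: "act g ` P \<inter> act g ` Q = act g ` (P \<inter> Q)"
    using inj by (simp add: image_Int)
  have "act g ` P \<inter> act g ` Q \<subseteq> frontier (act g ` P) \<inter> frontier (act g ` Q)"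
    unfolding i act_image_topology[OF assms(1)] using F(3) by blast
  moreover have "(`) (act g) ` F \<subseteq> polyhedral_faces (act g ` P) \<inter> polyhedral_faces (act g ` Q)"
    unfolding polyhedral_faces_act[OF assms(1)] using F(1) by blast
  moreover have "act g ` P \<inter> act g ` Q = \<Union>((`) (act g) ` F)"
    unfolding i F(2) by (simp add: image_Union)
  ultimately show ?thesis
    unfolding meet_face_to_face_def by blast
qed

definition move_tile :: "'n::finite motion \<Rightarrow> ('n, 'l) tile \<Rightarrow> ('n, 'l) tile" where
  "move_tile g t = (act g ` fst t, snd t)"

lemma fst_move_tile [simp]: "fst (move_tile g t) = act g ` fst t"
  by (simp add: move_tile_def)

lemma move_act: "move (act g) S = move_tile g ` S"
  unfolding move_def move_tile_def by (intro image_cong) auto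

lemma move_tile_gmul: "move_tile (gmul g h) t = move_tile g (move_tile h t)"
  by (simp add: move_tile_def act_image_image)

lemma act_gone_fun [simp]: "act gone = (\<lambda>x. x)"
  by (simp add: fun_eq_iff)

lemma move_tile_gone [simp]: "move_tile gone t = t"
  by (simp add: move_tile_def)

lemma move_gmul: "move (act (gmul g h)) S = move (act g) (move (act h) S)"
  by (auto simp: move_act move_tile_gmul image_image)

lemma move_gone [simp]: "move (act gone) S = S"
  by (simp add: move_act del: act_gone_fun)

lemma move_tile_ginv:
  "g \<in> SE \<Longrightarrow> move_tile (ginv g) (move_tile g t) = t"
  "g \<in> SE \<Longrightarrow> move_tile g (move_tile (ginv g) t) = t"
  by (simp_all add: move_tile_gmul[symmetric] gmul_ginv_left gmul_ginv_right)

lemma move_ginv: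
  "g \<in> SE \<Longrightarrow> move (act (ginv g)) (move (act g) S) = S"
  "g \<in> SE \<Longrightarrow> move (act g) (move (act (ginv g)) S) = S"
  by (simp_all add: move_gmul[symmetric] gmul_ginv_left gmul_ginv_right del: act_gone_fun)

lemma move_tile_mem_iff: "g \<in> SE \<Longrightarrow> move_tile g t \<in> move (act g) S \<longleftrightarrow> t \<in> S"
  unfolding move_act using move_tile_ginv(1)[of g] by (metis image_iff)

lemma mem_move_iff: "g \<in> SE \<Longrightarrow> t \<in> move (act g) S \<longleftrightarrow> move_tile (ginv g) t \<in> S"
  using move_tile_mem_iff[of g "move_tile (ginv g) t"] by (simp add: move_tile_ginv)

lemma act_cball: "g \<in> SE \<Longrightarrow> act g ` cball x r = cball (act g x) r"
proof
  show "act g ` cball x r \<subseteq> cball (act g x) r" if "g \<in> SE"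
    using dist_act[OF that] by auto
  show "cball (act g x) r \<subseteq> act g ` cball x r" if g: "g \<in> SE"
  proof
    fix y assume "y \<in> cball (act g x) r"
    then have "act (ginv g) y \<in> cball x r"
      using dist_act[OF g, of x "act (ginv g) y"] by (simp add: act_ginv g)
    then show "y \<in> act g ` cball x r"
      by (intro image_eqI[of _ _ "act (ginv g) y"]) (simp_all add: act_ginv g)
  qed
qed

lemma r_patch_move:
  assumes "g \<in> SE"
  shows "r_patch (move (act g) S) r (act g x) = move (act g) (r_patch S r x)"
proof -
  have "act g ` P \<inter> cball (act g x) r \<noteq> {} \<longleftrightarrow> P \<inter> cball x r \<noteq> {}" for P
    using bij_act[OF assms] by (simp add: act_cball[OF assms, symmetric] image_Int[symmetric] bij_is_inj)
  then have "t \<in> r_patch (move (act g) S) r (act g x) \<longleftrightarrow> t \<in> move (act g) (r_patch S r x)" for t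
    using move_tile_ginv(2)[OF assms, of t]
    by (simp add: r_patch_def mem_move_iff[OF assms]) (metis fst_move_tile)
  then show ?thesis by blast
qed

lemma is_tiling_move:
  assumes g: "g \<in> SE" and S: "is_tiling S"
  shows "is_tiling (move (act g) S)"
  unfolding is_tiling_def
proof (intro conjI ballI allI impI)
  fix t assume "t \<in> move (act g) S"
  then show "polyhedral_tile (fst t)"
    using S g by (auto simp: move_act is_tiling_def polyhedral_tile_act)
next
  have "\<Union>(fst ` move (act g) S) = act g ` \<Union>(fst ` S)"
    by (auto simp: move_act)
  then show "\<Union>(fst ` move (act g) S) = UNIV"
    using S bij_act[OF g] by (simp add: is_tiling_def bij_is_surj)
next
  fix s t assume "s \<in> move (act g) S" "t \<in> move (act g) S" "s \<noteq> t"
  then obtain s' t' where st: "s = move_tile g s'" "t = move_tile g t'" "s' \<in> S" "t' \<in> S" "s' \<noteq> t'"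
    by (auto simp: move_act)
  then have "meet_face_to_face (fst s') (fst t')"
    using S by (simp add: is_tiling_def)
  then show "meet_face_to_face (fst s) (fst t)"
    using st(1,2) by (simp add: meet_face_to_face_act g)
next
  fix r x
  have "r_patch (move (act g) S) r (act g (act (ginv g) x)) = move (act g) (r_patch S r (act (ginv g) x))"
    by (rule r_patch_move[OF g])
  then show "finite (r_patch (move (act g) S) r x)"
    using S by (simp add: act_ginv g is_tiling_def move_act)
qed

section \<open>Polyhedral tiles\<close>

lemma polyhedral_tile_compact: "polyhedral_tile P \<Longrightarrow> compact P"
  unfolding polyhedral_tile_def using polytope_imp_compact by blast

lemma polyhedral_tile_interior: "polyhedral_tile P \<Longrightarrow> interior P \<noteq> {}"
  unfolding polyhedral_tile_def
  by (metis Sup_upper equals0I interior_mono subset_empty ex_in_conv)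

text \<open>Each polytope of the union is convex with interior, hence the closure of its interior.
  Interior points near every point of a tile are what makes overlaps detectable in
  \<open>r_patch_unique\<close>.\<close>

lemma polyhedral_tile_regular:
  assumes "polyhedral_tile P"
  shows "P \<subseteq> closure (interior P)"
proof -
  obtain C where C: "\<And>X. X \<in> C \<Longrightarrow> polytope X \<and> interior X \<noteq> {}" "P = \<Union>C"
    using assms unfolding polyhedral_tile_def by blast
  show ?thesis
  proof
    fix x assume "x \<in> P"
    then obtain X where X: "X \<in> C" "x \<in> X" using C by blast
    then have "x \<in> closure (interior X)"
      using convex_closure_interior[of X] C(1)[OF X(1)] closure_subset by (auto simp: polytope_imp_convex)
    moreover have "interior X \<subseteq> interior P"
      using X C by (intro interior_mono) auto
    ultimately show "x \<in> closure (interior P)"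
      using closure_mono by blast
  qed
qed

lemma act_eq_on_ball:
  assumes "0 < r" "\<And>x. x \<in> ball c r \<Longrightarrow> act g x = act h x"
  shows "g = h"
proof (rule act_inj, rule ext)
  have d: "(fst g - fst h) *v v = 0" for v
  proof (cases "v = 0")
    case False
    define w where "w = (r / (2 * norm v)) *\<^sub>R v"
    have "norm w < r" using False assms(1) by (simp add: w_def)
    then have "act g (c + w) = act h (c + w)" "act g c = act h c"
      using assms by (auto simp: dist_norm)
    moreover have "fst k *v w = act k (c + w) - act k c" for k
      by (simp add: act_def matrix_vector_right_distrib)
    ultimately have "(fst g - fst h) *v w = 0"
      by (simp add: matrix_vector_mult_diff_rdistrib)
    then show ?thesis
      using False assms(1) by (simp add: w_def matrix_vector_mult_scaleR)
  qed simp
  then have "fst g = fst h"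
    by (simp add: matrix_eq matrix_vector_mult_diff_rdistrib)
  moreover have "act g c = act h c" using assms by simp
  ultimately show "act g x = act h x" for x
    by (simp add: act_def)
qed

lemma extreme_point_of_act:
  assumes "g \<in> SE" "x extreme_point_of K"
  shows "act g x extreme_point_of (act g ` K)"
proof -
  have "inj (act g)" using bij_act[OF assms(1)] by (simp add: bij_is_inj)
  have seg: "open_segment (act g a) (act g b) = act g ` open_segment a b" for a b
  proof -
    have lin: "(1 - u) *\<^sub>R act g a + u *\<^sub>R act g b = act g ((1 - u) *\<^sub>R a + u *\<^sub>R b)" for u
      by (simp add: act_def matrix_vector_right_distrib matrix_vector_mult_scaleR algebra_simps)
    have "x \<in> open_segment (act g a) (act g b) \<longleftrightarrow>
        a \<noteq> b \<and> (\<exists>u>0. u < 1 \<and> x = act g ((1 - u) *\<^sub>R a + u *\<^sub>R b))" for x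
      by (simp add: in_segment lin inj_eq[OF \<open>inj (act g)\<close>])
    moreover have "x \<in> act g ` open_segment a b \<longleftrightarrow>
        a \<noteq> b \<and> (\<exists>u>0. u < 1 \<and> x = act g ((1 - u) *\<^sub>R a + u *\<^sub>R b))" for x
      by (simp only: image_iff Bex_def in_segment) blast
    ultimately show ?thesis by blast
  qed
  show ?thesis
    using assms(2) \<open>inj (act g)\<close> unfolding extreme_point_of_def
    by (auto simp: seg inj_image_mem_iff)
qed

text \<open>A rigid motion between two tiles is determined by the vertices of their convex hulls.\<close>

lemma finite_tile_motions:
  fixes P Q :: "(real^'n) set"
  assumes "polyhedral_tile P" "polyhedral_tile Q"
  shows "finite {g \<in> SE. act g ` P = Q}"
proof -
  \<comment> \<open>A tile is a finite union of polytopes, so its convex hull is the hull of all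
    their vertices together and has finitely many extreme points.\<close>
  have fin: "finite {x. x extreme_point_of (convex hull P)} \<and> compact (convex hull P)"
    if P: "polyhedral_tile P" for P :: "(real^'n) set"
  proof -
    obtain C where C: "finite C" "\<And>X. X \<in> C \<Longrightarrow> polytope X" "P = \<Union>C"
      using P unfolding polyhedral_tile_def by blast
    then obtain v where v: "\<And>X. X \<in> C \<Longrightarrow> finite (v X) \<and> X = convex hull (v X)"
      unfolding polytope_def by metis
    let ?V = "\<Union>(v ` C)"
    have "convex hull P = convex hull ?V"
    proof (rule subset_antisym)
      have "X \<subseteq> convex hull ?V" if "X \<in> C" for X
        using v[OF that] that by (metis UN_upper hull_mono)
      then show "convex hull P \<subseteq> convex hull ?V"
        unfolding C(3) by (intro hull_minimal convex_convex_hull) blast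
      have "?V \<subseteq> P"
        using v C(3) by (auto intro: hull_inc)
      then show "convex hull ?V \<subseteq> convex hull P"
        by (rule hull_mono)
    qed
    moreover have "finite ?V" using C(1) v by blast
    ultimately show ?thesis
      using finite_subset[OF extreme_points_of_convex_hull, of ?V]
      by (auto simp: finite_imp_compact_convex_hull)
  qed
  let ?E = "\<lambda>P. {x. x extreme_point_of (convex hull P)}"
  have hull: "convex hull (act g ` P) = act g ` (convex hull P)" for g and P :: "(real^'n) set"
    unfolding act_image_eq convex_hull_translation
    by (simp add: convex_hull_linear_image matrix_vector_mul_linear)
  \<comment> \<open>A motion is recorded by its restriction to the extreme points, which it carries
    to extreme points; this leaves finitely many possible records.\<close>
  let ?r = "\<lambda>g. restrict (act g) (?E P)"
  have "?r ` {g \<in> SE. act g ` P = Q} \<subseteq> ?E P \<rightarrow>\<^sub>E ?E Q"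
  proof (intro image_subsetI PiE_I)
    fix g x assume g: "g \<in> {g \<in> SE. act g ` P = Q}" and x: "x \<in> ?E P"
    then have "act g x extreme_point_of (act g ` (convex hull P))"
      by (intro extreme_point_of_act) auto
    then show "?r g x \<in> ?E Q" using g x hull[of g P] by simp
  qed simp
  moreover have "finite (?E P \<rightarrow>\<^sub>E ?E Q)"
    using fin[OF assms(1)] fin[OF assms(2)] by (intro finite_PiE) auto
  ultimately have "finite (?r ` {g \<in> SE. act g ` P = Q})"
    by (rule finite_subset)
  moreover have "inj_on ?r {g \<in> SE. act g ` P = Q}"
  proof (rule inj_onI)
    fix g h assume eq: "?r g = ?r h"
    have "act g x = act h x" if x: "x \<in> ?E P" for x
    proof -
      have "?r g x = ?r h x" by (rule fun_cong[OF eq])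
      then show ?thesis using x by simp
    qed
    then have "?E P \<subseteq> {x. act g x = act h x}" by blast
    \<comment> \<open>The set where two affine maps agree is convex, so it contains the hull of the
      extreme points, which contains \<open>P\<close> by Krein-Milman; and \<open>P\<close> contains
      a ball.\<close>
    moreover have "convex {x. act g x = act h x}"
    proof (rule convexI)
      fix x y and u v :: real
      assume "x \<in> {x. act g x = act h x}" "y \<in> {x. act g x = act h x}" "u + v = 1"
      moreover have "act k (u *\<^sub>R x + v *\<^sub>R y) = u *\<^sub>R act k x + v *\<^sub>R act k y" for k
      proof -
        have "snd k = (u + v) *\<^sub>R snd k" using \<open>u + v = 1\<close> by simp
        then show ?thesis
          by (simp add: act_def matrix_vector_right_distrib matrix_vector_mult_scaleR scaleR_add_right scaleR_add_left)
      qed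
      ultimately show "u *\<^sub>R x + v *\<^sub>R y \<in> {x. act g x = act h x}" by simp
    qed
    ultimately have "convex hull (?E P) \<subseteq> {x. act g x = act h x}"
      by (rule hull_minimal)
    moreover have "P \<subseteq> convex hull (?E P)"
      using Krein_Milman_Minkowski[of "convex hull P"] fin[OF assms(1)] hull_subset[of P convex] by simp
    moreover obtain c r where "0 < r" "ball c r \<subseteq> P"
      using polyhedral_tile_interior[OF assms(1)] unfolding ex_in_conv[symmetric] mem_interior by blast
    ultimately show "g = h"
      by (intro act_eq_on_ball[of r c]) blast+
  qed
  ultimately show ?thesis
    by (rule finite_imageD)
qed

text \<open>The symmetries of a tile are finite in number, so one distance separates the identity
  from the others; it is halved because \<open>near_one e\<close> bounds the distance only by
  \<open>2 * e\<close>.\<close>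

lemma tile_rigid:
  fixes P :: "(real^'n) set"
  assumes "polyhedral_tile P"
  obtains e where "0 < e" "\<And>g. g \<in> SE \<Longrightarrow> near_one e g \<Longrightarrow> act g ` P = P \<Longrightarrow> g = gone"
proof -
  let ?F = "{g \<in> SE. act g ` P = P} - {gone}"
  have "finite ?F" using finite_tile_motions[OF assms assms] by simp
  then obtain e where e: "0 < e" "\<forall>g\<in>?F. g \<noteq> gone \<longrightarrow> e \<le> dist gone g"
    using finite_set_avoid[of ?F gone] by blast
  show thesis
  proof
    show "0 < e / 2" using e by simp
    show "g = gone" if "g \<in> SE" "near_one (e / 2) g" "act g ` P = P" for g
      using that e(2) dist_if_near_one[OF that(2)] by (force simp: dist_commute)
  qed
qed

lemma tile_overlap:
  assumes "is_tiling S" "s \<in> S" "t \<in> S" "interior (fst s) \<inter> fst t \<noteq> {}"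
  shows "s = t"
proof (rule ccontr)
  assume "s \<noteq> t"
  then have "fst s \<inter> fst t \<subseteq> frontier (fst s)"
    using assms unfolding is_tiling_def meet_face_to_face_def by blast
  then show False
    using assms(4) interior_subset[of "fst s"] by (auto simp: frontier_def)
qed

text \<open>Together with the symmetries of a tile being isolated, overlapping makes small motions visible.\<close>

lemma tile_rigid_in_tiling:
  assumes "polyhedral_tile P"
  obtains e where "0 < e"
    "\<And>g S l. \<lbrakk>g \<in> SE; near_one e g; is_tiling S; (P, l) \<in> S; move_tile g (P, l) \<in> S\<rbrakk> \<Longrightarrow> g = gone"
proof -
  obtain a where a: "0 < a" "\<And>g. g \<in> SE \<Longrightarrow> near_one a g \<Longrightarrow> act g ` P = P \<Longrightarrow> g = gone"
    using tile_rigid[OF assms] by blast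
  obtain c r where c: "0 < r" "ball c r \<subseteq> P"
    using polyhedral_tile_interior[OF assms] unfolding ex_in_conv[symmetric] mem_interior by blast
  \<comment> \<open>The second bound makes \<open>g\<close> move the centre \<open>c\<close> by less
    than \<open>r\<close>, so that \<open>act g c\<close> lies both in the interior of
    \<open>P\<close> and in the moved tile.\<close>
  define e where "e = min a (r / (2 * (1 + norm c)))"
  have n: "0 < 1 + norm c" by (simp add: add_pos_nonneg)
  have e: "0 < e" "e \<le> a" "e * (1 + norm c) < r"
  proof -
    show "0 < e" using a(1) c(1) n by (simp add: e_def)
    show "e \<le> a" by (simp add: e_def)
    have "e * (1 + norm c) \<le> r / (2 * (1 + norm c)) * (1 + norm c)"
      using n by (intro mult_right_mono) (auto simp: e_def)
    also have "\<dots> = r / 2" using n by (simp only: times_divide_eq_left) (simp add: field_simps)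
    also have "\<dots> < r" using c(1) by simp
    finally show "e * (1 + norm c) < r" .
  qed
  show thesis
  proof
    show "0 < e" by (rule e)
    fix g S and l :: 'b
    assume g: "g \<in> SE" "near_one e g" and S: "is_tiling S" "(P, l) \<in> S" "move_tile g (P, l) \<in> S"
    have "dist c (act g c) < r"
      using near_one_displacement[OF g(2), of c] e(3) by (simp add: dist_norm norm_minus_commute)
    then have "act g c \<in> interior P"
      using c(2) interior_maximal[OF c(2) open_ball] by auto
    moreover have "act g c \<in> act g ` P"
      by (meson c centre_in_ball imageI subsetD)
    ultimately have "(P, l) = move_tile g (P, l)"
      using S by (intro tile_overlap[OF S(1)]) auto
    then have "act g ` P = P" by (simp add: move_tile_def)
    then show "g = gone"
      using a(2) g e(2) near_one_mono by blast
  qed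
qed

section \<open>Patches\<close>

lemma agree_on_ball_iff:
  "agree_on_ball r S S' \<longleftrightarrow> (\<forall>t. fst t \<inter> cball 0 r \<noteq> {} \<longrightarrow> (t \<in> S \<longleftrightarrow> t \<in> S'))"
  by (auto simp: agree_on_ball_def r_patch_def set_eq_iff)

text \<open>Undoing \<open>g\<close> increases the norm of a point by at most
  \<open>norm (snd g)\<close>; that is the margin between \<open>s\<close> and
  \<open>r\<close>.\<close>

lemma agree_on_ball_move:
  assumes g: "g \<in> SE" and "agree_on_ball r S S'" "s + norm (snd g) \<le> r"
  shows "agree_on_ball s (move (act g) S) (move (act g) S')"
  unfolding agree_on_ball_iff
proof (intro allI impI)
  fix t :: "('a, 'b) tile"
  assume "fst t \<inter> cball 0 s \<noteq> {}"
  then obtain x where x: "x \<in> fst t" "norm x \<le> s" by auto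
  have "norm (act (ginv g) x) \<le> norm x + norm (snd (ginv g))"
    by (intro norm_act_le SE_ginv g)
  also have "norm (snd (ginv g)) = norm (snd g)"
    using g orthogonal_matrix_norm[of "transpose (fst g)"]
    by (simp add: ginv_def SE_def rotation_matrix_def del: transpose_matrix_vector)
  finally have "act (ginv g) x \<in> fst (move_tile (ginv g) t) \<inter> cball 0 r"
    using x assms(3) by auto
  then have "fst (move_tile (ginv g) t) \<inter> cball 0 r \<noteq> {}" by blast
  then show "t \<in> move (act g) S \<longleftrightarrow> t \<in> move (act g) S'"
    unfolding mem_move_iff[OF g] by (rule assms(2)[unfolded agree_on_ball_iff, rule_format])
qed

lemma agree_on_ball_sym: "agree_on_ball r S S' \<Longrightarrow> agree_on_ball r S' S"
  by (simp add: agree_on_ball_def)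

lemma agree_on_ball_refl [simp]: "agree_on_ball r S S"
  by (simp add: agree_on_ball_def)

lemma agree_on_ball_trans: "agree_on_ball r S S' \<Longrightarrow> agree_on_ball r S' S'' \<Longrightarrow> agree_on_ball r S S''"
  by (simp add: agree_on_ball_def)

text \<open>The tiles of an \<open>r\<close>-patch cover a neighbourhood of the ball, so a further tile would overlap one of them.\<close>

lemma r_patch_unique:
  assumes S1: "is_tiling S1" and S2: "is_tiling S2" and sub: "r_patch S1 r x \<subseteq> S2"
  shows "r_patch S2 r x = r_patch S1 r x"
proof
  show "r_patch S1 r x \<subseteq> r_patch S2 r x"
    using sub by (auto simp: r_patch_def)
  show "r_patch S2 r x \<subseteq> r_patch S1 r x"
  proof
    fix t assume t: "t \<in> r_patch S2 r x"
    then obtain y where y: "y \<in> fst t" "y \<in> cball x r" and tS: "t \<in> S2"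
      by (auto simp: r_patch_def)
    \<comment> \<open>Tiles just outside the ball: their union is closed and misses
      \<open>y\<close>, so points close to \<open>y\<close> are covered by tiles that do meet the
      ball.\<close>
    let ?F = "{s \<in> r_patch S1 (r + 1) x. fst s \<inter> cball x r = {}}"
    have "finite ?F" using S1 by (simp add: is_tiling_def)
    moreover have "closed (fst s)" if "s \<in> ?F" for s
      using that S1 by (auto simp: r_patch_def is_tiling_def intro!: compact_imp_closed polyhedral_tile_compact)
    ultimately have "closed (\<Union>(fst ` ?F))" by (intro closed_UN) auto
    moreover have "y \<notin> \<Union>(fst ` ?F)" using y by auto
    ultimately have "open (- \<Union>(fst ` ?F))" "y \<in> - \<Union>(fst ` ?F)" by (simp_all only: open_Compl Compl_iff) simp
    then obtain e where e: "0 < e" "ball y e \<subseteq> - \<Union>(fst ` ?F)"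
      by (meson open_contains_ball)
    have "y \<in> closure (interior (fst t))"
      using polyhedral_tile_regular[of "fst t"] S2 tS y(1) by (auto simp: is_tiling_def)
    \<comment> \<open>The bound 1 keeps \<open>z\<close> in the ball of radius \<open>r + 1\<close>,
      where \<open>?F\<close> accounts for all tiles that miss the smaller ball.\<close>
    then obtain z where z: "z \<in> interior (fst t)" "dist z y < min e 1"
      using e(1) by (metis closure_approachable min_less_iff_conj zero_less_one)
    have "z \<in> \<Union>(fst ` S1)" using S1 by (simp add: is_tiling_def)
    then obtain q where q: "q \<in> S1" "z \<in> fst q" by auto
    have "dist x z \<le> r + 1"
      using z(2) y(2) dist_triangle[of x z y] by (simp add: dist_commute)
    then have "q \<in> r_patch S1 (r + 1) x" using q by (auto simp: r_patch_def)
    moreover have "q \<notin> ?F" using e(2) z(2) q(2) by (auto simp: dist_commute)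
    ultimately have qp: "q \<in> r_patch S1 r x" by (auto simp: r_patch_def)
    then have "t = q"
      using tile_overlap[OF S2 tS, of q] sub z(1) q(2) by blast
    then show "t \<in> r_patch S1 r x" using qp by simp
  qed
qed

section \<open>The hull\<close>

locale flc_tiling =
  fixes T :: "('n::finite, 'l) tiling"
  assumes tiling_T: "is_tiling T" and flc_T: "euclidean_FLC T"
begin

abbreviation Hull :: "('n, 'l) tiling set" where "Hull \<equiv> hull_tilings T"

lemma hull_is_tiling: "S \<in> Hull \<Longrightarrow> is_tiling S"
  by (simp add: hull_tilings_def)

lemma hull_iff:
  "S \<in> Hull \<longleftrightarrow> is_tiling S \<and> (\<forall>p. finite p \<and> p \<subseteq> S \<longrightarrow> (\<exists>g\<in>SE. move (act g) p \<subseteq> T))"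
  unfolding hull_tilings_def rigid_motion_iff by blast

lemma hull_move:
  assumes "g \<in> SE" "S \<in> Hull"
  shows "move (act g) S \<in> Hull"
  unfolding hull_iff
proof (intro conjI allI impI)
  show "is_tiling (move (act g) S)"
    using assms hull_is_tiling is_tiling_move by blast
next
  fix p assume p: "finite p \<and> p \<subseteq> move (act g) S"
  then have "move (act (ginv g)) p \<subseteq> move (act (ginv g)) (move (act g) S)"
    unfolding move_act by (intro image_mono) simp
  with p have "finite (move (act (ginv g)) p)" "move (act (ginv g)) p \<subseteq> S"
    unfolding move_ginv(1)[OF assms(1)] by (simp_all add: move_act)
  then obtain h where "h \<in> SE" "move (act h) (move (act (ginv g)) p) \<subseteq> T"
    using assms(2) unfolding hull_iff by blast
  then show "\<exists>g\<in>SE. move (act g) p \<subseteq> T"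
    using assms(1) by (intro bexI[of _ "gmul h (ginv g)"]) (simp_all add: move_gmul SE_gmul SE_ginv)
qed

lemma T_in_hull: "T \<in> Hull"
  unfolding hull_iff using tiling_T SE_gone
  by (auto intro!: bexI[of _ gone] simp del: act_gone_fun)

text \<open>The hull condition only places the moved patch inside \<open>T\<close>; since a patch
  leaves no room for further tiles that meet its ball, it is a complete patch of
  \<open>T\<close>.\<close>

lemma hull_patch_in_T:
  assumes "S \<in> Hull"
  obtains g where "g \<in> SE" "r_patch T r (act g x) = move (act g) (r_patch S r x)"
proof -
  have "finite (r_patch S r x)" "r_patch S r x \<subseteq> S"
    using hull_is_tiling[OF assms] by (auto simp: is_tiling_def r_patch_def)
  then obtain g where g: "g \<in> SE" "move (act g) (r_patch S r x) \<subseteq> T"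
    using assms unfolding hull_iff by blast
  have "r_patch (move (act g) S) r (act g x) \<subseteq> T"
    using g by (simp add: r_patch_move)
  then have "r_patch T r (act g x) = r_patch (move (act g) S) r (act g x)"
    using hull_is_tiling[OF assms] tiling_T g(1) by (intro r_patch_unique is_tiling_move)
  then show thesis
    using that g by (simp add: r_patch_move)
qed

text \<open>Brings the two alternatives of \<open>tilings_close\<close> into a single form: change
  \<open>S\<close> far away from the origin, then apply a small motion. In this form neighbourhoods
  fit the map \<open>(g, S) \<mapsto> g S\<close>.\<close>

lemma openin_hull_iff:
  "openin (rotational_hull T) V \<longleftrightarrow> V \<subseteq> Hull \<and>
     (\<forall>S\<in>V. \<exists>e>0. \<forall>S'\<in>Hull. \<forall>g\<in>SE. near_one e g \<and> agree_on_ball (1/e) S S' \<longrightarrow> move (act g) S' \<in> V)"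
  unfolding openin_rotational_hull
proof (intro conj_cong refl ball_cong)
  fix S assume V: "V \<subseteq> Hull" and "S \<in> V"
  show "(\<exists>e>0. \<forall>S'\<in>Hull. tilings_close e S S' \<longrightarrow> S' \<in> V) \<longleftrightarrow>
    (\<exists>e>0. \<forall>S'\<in>Hull. \<forall>g\<in>SE. near_one e g \<and> agree_on_ball (1/e) S S' \<longrightarrow> move (act g) S' \<in> V)"
  proof (intro iffI; elim exE conjE)
    fix e :: real assume e: "0 < e" "\<forall>S'\<in>Hull. tilings_close e S S' \<longrightarrow> S' \<in> V"
    have "move (act g) S' \<in> V" if S': "S' \<in> Hull" "g \<in> SE" "near_one e g" "agree_on_ball (1/e) S S'" for S' g
    proof -
      have "small_motion e (act (ginv g))"
        unfolding small_motion_iff using that SE_ginv near_one_ginv by blast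
      then have "tilings_close e S (move (act g) S')"
        unfolding tilings_close_def using S'(2,4) by (intro exI[of _ "act (ginv g)"]) (simp add: move_ginv)
      then show ?thesis using e(2) hull_move S' by blast
    qed
    then show "\<exists>e>0. \<forall>S'\<in>Hull. \<forall>g\<in>SE. near_one e g \<and> agree_on_ball (1/e) S S' \<longrightarrow> move (act g) S' \<in> V"
      using e(1) by blast
  next
    fix e :: real
    assume e: "0 < e" "\<forall>S'\<in>Hull. \<forall>g\<in>SE. near_one e g \<and> agree_on_ball (1/e) S S' \<longrightarrow> move (act g) S' \<in> V"
    \<comment> \<open>With \<open>d \<le> e / 2\<close> and \<open>d \<le> 1 / 2\<close>, both
      \<open>1 / e\<close> and \<open>d\<close> are at most half of \<open>1 / d\<close>; so
      agreement on radius \<open>1 / d\<close> survives a motion of size \<open>d\<close> with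
      radius \<open>1 / e\<close> left.\<close>
    define d where "d = min (e / 2) (1 / 2)"
    have d: "0 < d" "d \<le> e" using e(1) by (auto simp: d_def)
    have de: "1/e + d \<le> 1/d"
    proof -
      have "1/e \<le> 1 / (2 * d)"
        using d(1) e(1) by (intro divide_left_mono) (auto simp: d_def)
      moreover have "d \<le> 1 / (2 * d)"
      proof -
        have "d * (2 * d) \<le> (1/2) * (2 * (1/2))"
          using d(1) by (intro mult_mono) (auto simp: d_def)
        then show ?thesis using d(1) by (simp add: field_simps)
      qed
      moreover have "1 / (2 * d) + 1 / (2 * d) = 1 / d" using d(1) by (simp add: field_simps)
      ultimately show ?thesis by linarith
    qed
    have "S' \<in> V" if S': "S' \<in> Hull" "tilings_close d S S'" for S'
    proof -
      obtain g where g: "g \<in> SE" "near_one d g" and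
        agr: "agree_on_ball (1/d) (move (act g) S) S' \<or> agree_on_ball (1/d) S (move (act g) S')"
        using S'(2) unfolding tilings_close_def small_motion_iff by blast
      have gi: "ginv g \<in> SE" "near_one d (ginv g)"
        using g SE_ginv near_one_ginv by blast+
      have norm_gi: "norm (snd h) \<le> d" if "near_one d h" for h :: "'n motion"
        using that by (simp add: near_one_def)
      \<comment> \<open>If the motion acts on \<open>S\<close>, the agreement is carried back by the
        inverse, and \<open>g\<close> is the small motion to apply; if it acts on \<open>S'\<close>,
        the inverse is the one to apply.\<close>
      from agr show ?thesis
      proof
        assume a: "agree_on_ball (1/d) (move (act g) S) S'"
        have "agree_on_ball (1/e) (move (act (ginv g)) (move (act g) S)) (move (act (ginv g)) S')"
          using de norm_gi[OF gi(2)] by (intro agree_on_ball_move[OF gi(1) a]) linarith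
        then have "agree_on_ball (1/e) S (move (act (ginv g)) S')"
          by (simp add: move_ginv g)
        then have "move (act g) (move (act (ginv g)) S') \<in> V"
          using e(2) hull_move gi g S'(1) near_one_mono[OF g(2) d(2)] by blast
        then show ?thesis by (simp add: move_ginv g)
      next
        assume "agree_on_ball (1/d) S (move (act g) S')"
        then have "agree_on_ball (1/e) S (move (act g) S')"
          using d e(1) by (elim agree_on_ball_mono) (simp add: frac_le)
        then have "move (act (ginv g)) (move (act g) S') \<in> V"
          using e(2) hull_move gi g S'(1) near_one_mono[OF gi(2) d(2)] by blast
        then show ?thesis by (simp add: move_ginv g)
      qed
    qed
    then show "\<exists>e>0. \<forall>S'\<in>Hull. tilings_close e S S' \<longrightarrow> S' \<in> V"
      using d(1) by blast
  qed
qed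

section \<open>Consequences of finite local complexity for the hull\<close>

lemma flc_patches:
  assumes "0 < r"
  obtains PP where "finite PP" "\<And>p. p \<in> PP \<Longrightarrow> finite p"
    "\<And>S x. S \<in> Hull \<Longrightarrow> \<exists>p\<in>PP. \<exists>u\<in>SE. r_patch S r x = move (act u) p"
proof -
  obtain P0 where P0: "finite P0" "\<And>x. \<exists>p\<in>P0. \<exists>g. rigid_motion g \<and> r_patch T r x = move g p"
    using flc_T assms unfolding euclidean_FLC_def by blast
  show thesis
  proof
    \<comment> \<open>An infinite entry of \<open>P0\<close> represents no patch, so the list may be
      restricted to its finite entries.\<close>
    show "finite {p \<in> P0. finite p}" using P0(1) by simp
    fix S x assume S: "S \<in> Hull"
    obtain h where h: "h \<in> SE" "r_patch T r (act h x) = move (act h) (r_patch S r x)"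
      using hull_patch_in_T[OF S] by blast
    obtain p g where p: "p \<in> P0" "g \<in> SE" "r_patch T r (act h x) = move (act g) p"
      using P0(2)[of "act h x"] unfolding rigid_motion_iff by blast
    have "p = move (act (ginv g)) (r_patch T r (act h x))"
      by (simp add: p move_ginv)
    then have "finite p"
      using tiling_T by (simp add: is_tiling_def move_act)
    moreover have "r_patch S r x = move (act (gmul (ginv h) g)) p"
      using h p by (metis move_ginv(1) move_gmul)
    ultimately show "\<exists>p\<in>{p \<in> P0. finite p}. \<exists>u\<in>SE. r_patch S r x = move (act u) p"
      using p h by (blast intro: SE_gmul SE_ginv)
  qed simp
qed

text \<open>A patch that contains \<open>s\<close> arises from one of finitely many representatives
  by a motion that takes some tile of the representative to \<open>s\<close>, and there are finitely
  many such motions. Fixing one tile thus turns finiteness up to motion into finiteness.\<close>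

lemma finite_patches_at_tile:
  assumes s: "polyhedral_tile (fst s)"
  shows "finite {r_patch S r 0 | S. S \<in> Hull \<and> s \<in> S}"
proof -
  obtain x where x: "x \<in> fst s" using polyhedral_tile_interior[OF s] interior_subset by blast
  \<comment> \<open>Large enough that the patch sees \<open>s\<close>; the \<open>r\<close>-patch is
    then cut out of the \<open>R\<close>-patch.\<close>
  define R where "R = max r (norm x + 1)"
  have R: "0 < R" "r \<le> R" "x \<in> cball 0 R" by (auto simp: R_def less_max_iff_disj add_nonneg_pos)
  obtain PP where PP: "finite PP" "\<And>p. p \<in> PP \<Longrightarrow> finite p"
    "\<And>S x. S \<in> Hull \<Longrightarrow> \<exists>p\<in>PP. \<exists>u\<in>SE. r_patch S R x = move (act u) p"
    using flc_patches[OF R(1)] by blast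
  define U where "U t = {u \<in> SE. act u ` fst t = fst s}" for t :: "('n, 'l) tile"
  define F where "F = (\<Union>p\<in>PP. \<Union>t\<in>{t\<in>p. polyhedral_tile (fst t)}. (\<lambda>u. move (act u) p) ` U t)"
  have "finite F"
    unfolding F_def U_def using PP(1,2) s by (intro finite_UN_I finite_imageI finite_tile_motions) auto
  have "r_patch S R 0 \<in> F" if S: "S \<in> Hull" "s \<in> S" for S
  proof -
    obtain p u where p: "p \<in> PP" "u \<in> SE" "r_patch S R 0 = move (act u) p"
      using PP(3)[OF S(1)] by blast
    have "s \<in> r_patch S R 0" using S(2) x R(3) by (auto simp: r_patch_def)
    then have "move_tile (ginv u) s \<in> p" unfolding p(3) mem_move_iff[OF p(2)] .
    moreover have "polyhedral_tile (fst (move_tile (ginv u) s))"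
      using polyhedral_tile_act[OF SE_ginv[OF p(2)] s] by simp
    moreover have "u \<in> U (move_tile (ginv u) s)"
      using p(2) by (simp add: U_def act_image_image gmul_ginv_right)
    ultimately show ?thesis using p(1,3) unfolding F_def by blast
  qed
  note in_F = this
  have R_r: "r_patch S r 0 = {t \<in> r_patch S R 0. fst t \<inter> cball 0 r \<noteq> {}}" for S :: "('n, 'l) tiling"
  proof -
    have "fst t \<inter> cball 0 R \<noteq> {}" if "fst t \<inter> cball 0 r \<noteq> {}" for t :: "('n, 'l) tile"
      using subset_cball[OF R(2), of "0 :: real^'n"] that by blast
    then show ?thesis unfolding r_patch_def by blast
  qed
  have "{r_patch S r 0 | S. S \<in> Hull \<and> s \<in> S} \<subseteq> (\<lambda>q. {t \<in> q. fst t \<inter> cball 0 r \<noteq> {}}) ` F"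
  proof
    fix p assume "p \<in> {r_patch S r 0 | S. S \<in> Hull \<and> s \<in> S}"
    then obtain S where S: "p = r_patch S r 0" "S \<in> Hull" "s \<in> S" by blast
    have "p = (\<lambda>q. {t \<in> q. fst t \<inter> cball 0 r \<noteq> {}}) (r_patch S R 0)"
      by (simp only: S(1)) (rule R_r)
    then show "p \<in> (\<lambda>q. {t \<in> q. fst t \<inter> cball 0 r \<noteq> {}}) ` F"
      using in_F[OF S(2,3)] by (rule image_eqI)
  qed
  then show ?thesis by (rule finite_surj[OF \<open>finite F\<close>])
qed

text \<open>A finite part of the union of the \<open>q n\<close> already lies in one of the given
  tilings, so every condition for membership in the hull, being local, passes to the union.\<close>

lemma hull_limit:
  assumes "\<And>n. \<exists>S\<in>Hull. \<forall>m\<le>n. r_patch S (real m) 0 = q m"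
  shows "\<exists>S\<in>Hull. \<forall>n. r_patch S (real n) 0 = q n"
proof -
  obtain f where f: "\<And>n. f n \<in> Hull" "\<And>n m. m \<le> n \<Longrightarrow> r_patch (f n) (real m) 0 = q m"
    using assms by metis
  let ?S = "\<Union>n. q n"
  have sub: "q m \<subseteq> q n" if "m \<le> n" for m n
    using f(2)[OF that] f(2)[of n n] that subset_cball[of "real m" "real n" "0 :: real^'n"]
    by (auto simp: r_patch_def)
  have qf: "q n \<subseteq> f n" for n using f(2)[of n n] by (auto simp: r_patch_def)
  have q: "r_patch ?S (real n) 0 = q n" for n
  proof
    show "q n \<subseteq> r_patch ?S (real n) 0" using f(2)[of n n] by (auto simp: r_patch_def)
    show "r_patch ?S (real n) 0 \<subseteq> q n"
    proof
      fix t assume "t \<in> r_patch ?S (real n) 0"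
      then obtain m where m: "t \<in> q m" "fst t \<inter> cball 0 (real n) \<noteq> {}" by (auto simp: r_patch_def)
      let ?k = "max m n"
      have "t \<in> f ?k" using m(1) sub[of m ?k] qf by auto
      then show "t \<in> q n" using m(2) f(2)[of n ?k] by (auto simp: r_patch_def)
    qed
  qed
  have ex: "\<exists>n. p \<subseteq> q n" if "finite p" "p \<subseteq> ?S" for p
    using that
  proof (induction p)
    case (insert t p)
    then obtain n m where "p \<subseteq> q n" "t \<in> q m" by blast
    then have "insert t p \<subseteq> q (max n m)" using sub[of n "max n m"] sub[of m "max n m"] by auto
    then show ?case by blast
  qed simp
  have "is_tiling ?S"
    unfolding is_tiling_def
  proof (intro conjI ballI allI impI)
    fix t assume "t \<in> ?S"
    then obtain n where "t \<in> f n" using qf by blast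
    then show "polyhedral_tile (fst t)" using hull_is_tiling[OF f(1)] by (auto simp: is_tiling_def)
  next
    have "y \<in> \<Union>(fst ` ?S)" for y
    proof -
      obtain n where n: "norm y \<le> real n" using real_arch_simple by blast
      have "y \<in> \<Union>(fst ` f n)" using hull_is_tiling[OF f(1), of n] by (simp add: is_tiling_def)
      then obtain t where t: "t \<in> f n" "y \<in> fst t" by auto
      then have "t \<in> r_patch (f n) (real n) 0" using n by (auto simp: r_patch_def)
      then show ?thesis using f(2)[of n n] t(2) by auto
    qed
    then show "\<Union>(fst ` ?S) = UNIV" by blast
  next
    fix s t assume "s \<in> ?S" "t \<in> ?S" "s \<noteq> t"
    moreover then obtain n where "{s, t} \<subseteq> q n" using ex[of "{s, t}"] by auto
    ultimately have "s \<in> f n" "t \<in> f n" "s \<noteq> t" using qf[of n] by auto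
    then show "meet_face_to_face (fst s) (fst t)"
      using hull_is_tiling[OF f(1), of n] by (simp add: is_tiling_def)
  next
    fix r and x :: "real^'n"
    obtain n where n: "norm x + r \<le> real n" using real_arch_simple by blast
    have "cball x r \<subseteq> cball 0 (real n)"
      using n norm_triangle_sub by (auto simp: dist_norm norm_minus_commute) (smt (verit) norm_triangle_sub)
    then have "r_patch ?S r x \<subseteq> r_patch ?S (real n) 0" by (auto simp: r_patch_def)
    also have "\<dots> = r_patch (f n) (real n) 0" using q f(2)[of n n] by simp
    finally have "r_patch ?S r x \<subseteq> r_patch (f n) (real n) 0" .
    moreover have "finite (r_patch (f n) (real n) 0)"
      using hull_is_tiling[OF f(1), of n] by (simp add: is_tiling_def)
    ultimately show "finite (r_patch ?S r x)" by (rule finite_subset)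
  qed
  moreover have "\<exists>g\<in>SE. move (act g) p \<subseteq> T" if p: "finite p \<and> p \<subseteq> ?S" for p
  proof -
    obtain n where "p \<subseteq> f n" using ex[of p] p qf by blast
    then show ?thesis using f(1)[of n] p unfolding hull_iff by blast
  qed
  ultimately have "?S \<in> Hull" unfolding hull_iff by blast
  then show ?thesis using q by blast
qed

text \<open>The representatives contain the origin in their interior, so that no tiling contains two of them.\<close>

lemma prototiles:
  obtains Q where "finite Q" "\<And>t. t \<in> Q \<Longrightarrow> polyhedral_tile (fst t) \<and> 0 \<in> interior (fst t)"
    "\<And>S s. S \<in> Hull \<Longrightarrow> s \<in> S \<Longrightarrow> \<exists>t\<in>Q. \<exists>h\<in>SE. s = move_tile h t"
proof -
  obtain PP where PP: "finite PP" "\<And>p. p \<in> PP \<Longrightarrow> finite p"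
    "\<And>S x. S \<in> Hull \<Longrightarrow> \<exists>p\<in>PP. \<exists>u\<in>SE. r_patch S 1 x = move (act u) p"
    using flc_patches[of 1] by (metis zero_less_one)
  let ?A = "{t \<in> \<Union>PP. polyhedral_tile (fst t)}"
  have "\<forall>t\<in>?A. \<exists>x. x \<in> interior (fst t)"
  proof
    fix t assume "t \<in> ?A"
    then have "interior (fst t) \<noteq> {}" by (simp add: polyhedral_tile_interior)
    then show "\<exists>x. x \<in> interior (fst t)" by (simp only: ex_in_conv not_False_eq_True)
  qed
  then obtain c where c: "\<And>t. t \<in> ?A \<Longrightarrow> c t \<in> interior (fst t)"
    by (rule bchoice[THEN exE]) blast
  define w :: "('n, 'l) tile \<Rightarrow> 'n motion" where "w t = (mat 1, - c t)" for t
  have w: "w t \<in> SE" for t by (simp add: w_def SE_def rotation_matrix_one)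
  define Q where "Q = (\<lambda>t. move_tile (w t) t) ` ?A"
  show thesis
  proof
    show "finite Q" unfolding Q_def using PP by simp
    show "polyhedral_tile (fst t) \<and> 0 \<in> interior (fst t)" if t: "t \<in> Q" for t
    proof -
      obtain t' where t': "t' \<in> ?A" "t = move_tile (w t') t'" using t by (auto simp: Q_def)
      have "act (w t') (c t') = 0" by (simp add: act_def w_def)
      then have "0 \<in> act (w t') ` interior (fst t')" using c[OF t'(1)] by (metis imageI)
      then show ?thesis using t' w by (auto simp: polyhedral_tile_act act_image_topology)
    qed
    show "\<exists>t\<in>Q. \<exists>h\<in>SE. s = move_tile h t" if S: "S \<in> Hull" "s \<in> S" for S s
    proof -
      have ps: "polyhedral_tile (fst s)" using hull_is_tiling[OF S(1)] S(2) by (simp add: is_tiling_def)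
      then obtain x where x: "x \<in> fst s" using polyhedral_tile_interior interior_subset by blast
      obtain p u where p: "p \<in> PP" "u \<in> SE" "r_patch S 1 x = move (act u) p" using PP(3)[OF S(1)] by blast
      have "s \<in> r_patch S 1 x" using S(2) x by (auto simp: r_patch_def)
      then have "move_tile (ginv u) s \<in> p" unfolding p(3) mem_move_iff[OF p(2)] .
      moreover have "polyhedral_tile (fst (move_tile (ginv u) s))"
        using polyhedral_tile_act[OF SE_ginv[OF p(2)] ps] by simp
      ultimately have A: "move_tile (ginv u) s \<in> ?A" using p(1) by blast
      let ?t = "move_tile (ginv u) s"
      have "s = move_tile (gmul u (ginv (w ?t))) (move_tile (w ?t) ?t)"
        using w by (simp add: move_tile_gmul move_tile_ginv p(2))
      then show ?thesis using A p(2) w unfolding Q_def by (blast intro: SE_gmul SE_ginv)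
    qed
  qed
qed

end

section \<open>Inverse limits of finite sets\<close>

text \<open>A function is encoded by its graph, a set of naturals, and sets of naturals inject into
  the reals.\<close>

lemma nat_functions_inject_real: "\<exists>h :: (nat \<Rightarrow> nat) \<Rightarrow> real. inj h"
proof -
  obtain h :: "nat set \<Rightarrow> real" where h: "inj h"
    using nat_sets_eqpoll_reals by (meson bij_betw_imp_inj_on eqpoll_def)
  have "inj (\<lambda>f. range (\<lambda>n. prod_encode (n, f n)))"
  proof (rule injI)
    fix f g :: "nat \<Rightarrow> nat"
    assume eq: "range (\<lambda>n. prod_encode (n, f n)) = range (\<lambda>n. prod_encode (n, g n))"
    show "f = g"
    proof
      fix n
      have "prod_encode (n, f n) \<in> range (\<lambda>n. prod_encode (n, g n))"
        unfolding eq[symmetric] by blast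
      then show "f n = g n" by (auto simp: prod_encode_eq)
    qed
  qed
  then have "inj (\<lambda>f. h (range (\<lambda>n. prod_encode (n, f n))))"
    using inj_compose[OF h] by (simp add: comp_def)
  then show ?thesis by blast
qed

lemma totally_disconnected_space_homeomorphic:
  assumes "homeomorphic_map X Y f" "totally_disconnected_space Y"
  shows "totally_disconnected_space X"
  unfolding totally_disconnected_space_def
proof (intro allI impI)
  fix C assume C: "connectedin X C"
  then have "connectedin Y (f ` C)"
    using assms(1) connectedin_continuous_map_image homeomorphic_imp_continuous_map by blast
  then obtain a where a: "f ` C \<subseteq> {a}"
    using assms(2) by (auto simp: totally_disconnected_space_def)
  have "inj_on f C"
    using C assms(1) homeomorphic_imp_injective_map connectedin_subset_topspace inj_on_subset by metis
  then show "\<exists>b. C \<subseteq> {b}"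
  proof (cases "C = {}")
    case False
    then obtain c where c: "c \<in> C" by blast
    have "x = c" if "x \<in> C" for x
    proof -
      have "f x = a" "f c = a" using a c that by blast+
      then show ?thesis using \<open>inj_on f C\<close> c that by (simp add: inj_on_def)
    qed
    then show ?thesis by blast
  qed auto
qed

text \<open>The hypotheses say that \<open>Y\<close> is the inverse limit of its finite images under
  the maps \<open>p n\<close>. It is realized via \<open>s\<close> as a compact subset of a product
  of finite sets of reals. Since a matchbox manifold is required to have a topology on real numbers
  as transversal space, this is then transported along an injection \<open>\<sigma>\<close> without
  topological meaning.\<close>

lemma profinite_real_space:
  fixes Y :: "'a set" and p :: "nat \<Rightarrow> 'a \<Rightarrow> 'b"
  assumes fin: "\<And>n. finite (p n ` Y)"
    and sep: "\<And>x y. \<lbrakk>x \<in> Y; y \<in> Y; \<And>n. p n x = p n y\<rbrakk> \<Longrightarrow> x = y"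
    and ref: "\<And>x y m n. \<lbrakk>x \<in> Y; y \<in> Y; m \<le> n; p n x = p n y\<rbrakk> \<Longrightarrow> p m x = p m y"
    and lim: "\<And>q. (\<And>n. \<exists>x\<in>Y. \<forall>m\<le>n. p m x = q m) \<Longrightarrow> \<exists>x\<in>Y. \<forall>n. p n x = q n"
  obtains X :: "real topology" and \<sigma> where
    "inj_on \<sigma> Y" "topspace X = \<sigma> ` Y" "compact_space X" "separable_space X"
    "totally_disconnected_space X" "metrizable_space X"
    "\<And>V. openin X V \<longleftrightarrow> V \<subseteq> \<sigma> ` Y \<and> (\<forall>x\<in>Y. \<sigma> x \<in> V \<longrightarrow> (\<exists>n. \<forall>y\<in>Y. p n y = p n x \<longrightarrow> \<sigma> y \<in> V))"
proof -
  have "\<exists>c :: 'b \<Rightarrow> nat. inj_on c (p n ` Y)" for n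
    using finite_imp_inj_to_nat_seg[OF fin] by metis
  then obtain c :: "nat \<Rightarrow> 'b \<Rightarrow> nat" where c: "\<And>n. inj_on (c n) (p n ` Y)" by metis
  have ceq: "c n (p n x) = c n (p n y) \<longleftrightarrow> p n x = p n y" if "x \<in> Y" "y \<in> Y" for n x y
    using c[of n] that by (auto simp: inj_on_def)
  define s :: "'a \<Rightarrow> nat \<Rightarrow> real" where "s x = (\<lambda>n. real (c n (p n x)))" for x
  have seq: "s x n = s y n \<longleftrightarrow> p n x = p n y" if "x \<in> Y" "y \<in> Y" for n x y
    using ceq that by (simp add: s_def)
  have s_inj: "inj_on s Y"
    using sep seq by (metis inj_onI)
  obtain h :: "(nat \<Rightarrow> nat) \<Rightarrow> real" where h: "inj h" using nat_functions_inject_real by blast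
  define \<sigma> where "\<sigma> x = h (\<lambda>n. c n (p n x))" for x
  have \<sigma>_inj: "inj_on \<sigma> Y"
  proof (rule inj_onI)
    fix x y assume xy: "x \<in> Y" "y \<in> Y" "\<sigma> x = \<sigma> y"
    then have "(\<lambda>n. c n (p n x)) = (\<lambda>n. c n (p n y))"
      using h by (simp add: \<sigma>_def inj_eq)
    then show "x = y" using xy sep ceq by (metis)
  qed
  let ?C = "s ` Y"
  have C_closed: "closed ?C"
  proof -
    \<comment> \<open>A sequence belongs to the image iff each of its initial segments is realized
      in \<open>Y\<close>. At level \<open>n\<close> this is a finite union over the values
      \<open>k\<close>, with one chosen representative each, since by \<open>ref\<close> the earlier
      coordinates depend on \<open>k\<close> only.\<close>
    have "?C = (\<Inter>n. \<Union>k\<in>p n ` Y. \<Inter>m\<in>{..n}. {z. z m = s (SOME x. x \<in> Y \<and> p n x = k) m})" (is "_ = ?D")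
    proof
      have rep: "(SOME y. y \<in> Y \<and> p n y = p n x) \<in> Y \<and> p n (SOME y. y \<in> Y \<and> p n y = p n x) = p n x"
        if "x \<in> Y" for x n
        using someI[of "\<lambda>y. y \<in> Y \<and> p n y = p n x" x] that by blast
      have rs: "s (SOME y. y \<in> Y \<and> p n y = p n x) m = s x m" if "x \<in> Y" "m \<le> n" for x n m
        using rep[OF that(1), of n] ref[OF _ that(1) that(2)] seq[OF _ that(1)] by blast
      show "?C \<subseteq> ?D"
        using rs by fastforce
      show "?D \<subseteq> ?C"
      proof
        fix z assume z: "z \<in> ?D"
        have ex: "\<exists>x\<in>Y. \<forall>m\<le>n. z m = s x m" for n
        proof -
          have "\<forall>n. \<exists>x\<in>Y. \<forall>m\<in>{..n}. z m = s (SOME y. y \<in> Y \<and> p n y = p n x) m"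
            using z by simp
          then obtain x where x: "x \<in> Y" "\<And>m. m \<le> n \<Longrightarrow> z m = s (SOME y. y \<in> Y \<and> p n y = p n x) m"
            by (meson atMost_iff)
          then show ?thesis using rs by metis
        qed
        then obtain xx where xx: "\<And>n. xx n \<in> Y" "\<And>n m. m \<le> n \<Longrightarrow> z m = s (xx n) m" by metis
        \<comment> \<open>The realizers \<open>xx n\<close> of growing initial segments are
          compatible, so \<open>lim\<close> supplies one point of \<open>Y\<close> with all the
          coordinates of \<open>z\<close>.\<close>
        have "\<exists>x\<in>Y. \<forall>m\<le>n. p m x = p m (xx m)" for n
        proof (rule bexI[OF _ xx(1)[of n]], intro allI impI)
          fix m assume "m \<le> n"
          then have "s (xx n) m = s (xx m) m" using xx(2)[of m n] xx(2)[of m m] by simp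
          then show "p m (xx n) = p m (xx m)" using seq xx(1) by blast
        qed
        then obtain x where x: "x \<in> Y" "\<And>n. p n x = p n (xx n)" using lim[of "\<lambda>m. p m (xx m)"] by blast
        have "z n = s x n" for n
          using xx(2)[of n n] x seq[OF xx(1) x(1)] by simp
        then show "z \<in> ?C" using x(1) by blast
      qed
    qed
    moreover have "closed {z :: nat \<Rightarrow> real. z m = a}" for m a
      by (intro closed_Collect_eq continuous_on_product_coordinates continuous_on_const)
    ultimately show ?thesis
      using fin by (simp only:) (intro closed_INT closed_UN ballI; simp)
  qed
  have C_compact: "compact ?C"
  proof -
    define F where "F n = (\<lambda>x. s x n) ` Y" for n
    have "finite (F n)" for n
    proof -
      have "F n = (\<lambda>k. real (c n k)) ` (p n ` Y)" by (auto simp: F_def s_def)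
      then show ?thesis using fin by simp
    qed
    then have "compactin (product_topology (\<lambda>n. euclidean) UNIV) (PiE UNIV F)"
      by (simp add: compactin_PiE finite_imp_compact)
    then have "compact (PiE UNIV F)"
      by (simp add: euclidean_product_topology)
    moreover have "?C \<subseteq> PiE UNIV F" by (auto simp: F_def)
    ultimately show ?thesis
      using C_closed by (metis compact_Int_closed inf.absorb_iff2)
  qed
  define f where "f = s \<circ> inv_into Y \<sigma>"
  have f\<sigma>: "f (\<sigma> x) = s x" if "x \<in> Y" for x
    using that \<sigma>_inj by (simp add: f_def)
  define X where "X = pullback_topology (\<sigma> ` Y) f (euclidean :: (nat \<Rightarrow> real) topology)"
  have oX: "openin X V \<longleftrightarrow> (\<exists>U. open U \<and> V = f -` U \<inter> \<sigma> ` Y)" for V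
    by (simp add: X_def openin_pullback_topology)
  have tX: "topspace X = \<sigma> ` Y"
    by (simp add: X_def topspace_pullback_topology)
  have hom: "homeomorphic_map X (top_of_set ?C) f"
  proof (rule bijective_open_imp_homeomorphic_map)
    show "continuous_map X (top_of_set ?C) f"
      unfolding continuous_map_in_subtopology
    proof
      show "continuous_map X euclidean f"
        unfolding continuous_map_def tX using oX by (auto simp: vimage_def Int_def conj_commute)
      show "f \<in> topspace X \<rightarrow> ?C" using f\<sigma> by (auto simp: tX)
    qed
    show "open_map X (top_of_set ?C) f"
      unfolding open_map_def
    proof (intro allI impI)
      fix V assume "openin X V"
      then obtain U where U: "open U" "V = f -` U \<inter> \<sigma> ` Y" using oX by blast
      have "f ` (f -` U \<inter> A) = f ` A \<inter> U" for A by auto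
      moreover have "f ` \<sigma> ` Y = ?C" using f\<sigma> by (simp add: image_image)
      ultimately have "f ` V = ?C \<inter> U" using U(2) by simp
      then show "openin (top_of_set ?C) (f ` V)" using U(1) by auto
    qed
    show "f ` topspace X = topspace (top_of_set ?C)" using f\<sigma> by (auto simp: tX image_iff)
    show "inj_on f (topspace X)"
      using s_inj f\<sigma> by (auto simp: tX inj_on_def)
  qed
  then have hs: "X homeomorphic_space top_of_set ?C" by (rule homeomorphic_map_imp_homeomorphic_space)
  show thesis
  proof
    show "inj_on \<sigma> Y" by (rule \<sigma>_inj)
    show "topspace X = \<sigma> ` Y" by (rule tX)
    show "compact_space X"
      using C_compact homeomorphic_compact_space[OF hs] by (simp add: compact_space_subtopology)
    obtain \<B> :: "(nat \<Rightarrow> real) set set" where \<B>: "countable \<B>" "topological_basis \<B>"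
      using ex_countable_basis by blast
    have "second_countable (euclidean :: (nat \<Rightarrow> real) topology)"
      unfolding second_countable_def
    proof (intro exI[of _ \<B>] conjI allI impI ballI)
      show "countable \<B>" by (rule \<B>(1))
      show "openin euclidean V" if "V \<in> \<B>" for V
        using topological_basis_open[OF \<B>(2) that] by simp
      show "\<exists>V\<in>\<B>. x \<in> V \<and> V \<subseteq> U" if "openin euclidean U \<and> x \<in> U" for U x
        using that topological_basisE[OF \<B>(2)] by (metis open_openin)
    qed
    then have "second_countable (top_of_set ?C)"
      by (rule second_countable_subtopology)
    then show "separable_space X"
      using homeomorphic_separable_space[OF hs] second_countable_imp_separable_space by blast
    show "metrizable_space X"
      using homeomorphic_metrizable_space[OF hs] metrizable_space_euclidean metrizable_space_subtopology by blast
    have "totally_disconnected_space (top_of_set ?C)"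
      unfolding totally_disconnected_space_def
    proof (intro allI impI)
      fix D assume D: "connectedin (top_of_set ?C) D"
      then have cD: "connected D" "D \<subseteq> ?C"
        by (auto simp: connectedin_subtopology)
      have "x = y" if "x \<in> D" "y \<in> D" for x y
      proof
        fix n
        have "connected ((\<lambda>z. z n) ` D)"
          by (intro connected_continuous_image cD continuous_on_subset[OF continuous_on_product_coordinates]) simp
        moreover have "finite ((\<lambda>z. z n) ` D)"
        proof (rule finite_subset)
          show "(\<lambda>z. z n) ` D \<subseteq> (\<lambda>k. real (c n k)) ` (p n ` Y)" using cD(2) by (auto simp: s_def)
        qed (use fin in simp)
        ultimately have "(\<lambda>z. z n) ` D = {} \<or> (\<exists>a. (\<lambda>z. z n) ` D = {a})"
          by (simp add: connected_finite_iff_sing)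
        then show "x n = y n" using that by (metis empty_iff imageI singletonD)
      qed
      then show "\<exists>a. D \<subseteq> {a}" by (metis empty_subsetI insertI1 subsetI subset_singletonD)
    qed
    then show "totally_disconnected_space X"
      using totally_disconnected_space_homeomorphic[OF hom] by blast
    show "openin X V \<longleftrightarrow> V \<subseteq> \<sigma> ` Y \<and> (\<forall>x\<in>Y. \<sigma> x \<in> V \<longrightarrow> (\<exists>n. \<forall>y\<in>Y. p n y = p n x \<longrightarrow> \<sigma> y \<in> V))"
      (is "_ \<longleftrightarrow> ?R") for V
    proof
      assume "openin X V"
      then obtain U where U: "open U" "V = f -` U \<inter> \<sigma> ` Y" using oX by blast
      have "\<exists>n. \<forall>y\<in>Y. p n y = p n x \<longrightarrow> \<sigma> y \<in> V" if x: "x \<in> Y" "\<sigma> x \<in> V" for x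
      proof -
        have sxU: "s x \<in> U" using x U f\<sigma> by auto
        have "openin (product_topology (\<lambda>i. euclidean) UNIV) U"
          using U(1) by (simp add: open_fun_def)
        from product_topology_open_contains_basis[OF this sxU]
        obtain B where B: "s x \<in> PiE UNIV B" "finite {i. B i \<noteq> topspace (euclidean :: real topology)}" "PiE UNIV B \<subseteq> U"
          by (elim exE conjE)
        \<comment> \<open>Only finitely many coordinates are constrained; by \<open>ref\<close>,
          agreement at one level beyond all of them suffices.\<close>
        obtain n where n: "\<And>i. B i \<noteq> UNIV \<Longrightarrow> i \<le> n"
          using B(2) finite_nat_set_iff_bounded_le by auto
        have "\<sigma> y \<in> V" if y: "y \<in> Y" "p n y = p n x" for y
        proof -
          have "s y i \<in> B i" for i
          proof (cases "B i = UNIV")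
            case False
            then have "p i y = p i x" using n ref[OF y(1) x(1)] y(2) by blast
            then show ?thesis using B(1) by (auto simp: s_def PiE_def)
          qed simp
          then have "s y \<in> U" using B(3) by (auto simp: PiE_def)
          then show ?thesis using U(2) f\<sigma> y(1) by simp
        qed
        then show ?thesis by blast
      qed
      then show ?R using U(2) by blast
    next
      assume R: ?R
      then obtain N where N: "\<And>x y. \<lbrakk>x \<in> Y; \<sigma> x \<in> V; y \<in> Y; p (N x) y = p (N x) x\<rbrakk> \<Longrightarrow> \<sigma> y \<in> V"
        by metis
      \<comment> \<open>The values of \<open>s\<close> are natural numbers, so distance below 1
        means equality of the coordinate.\<close>
      let ?U = "\<Union>x\<in>{x\<in>Y. \<sigma> x \<in> V}. (\<lambda>z. z (N x)) -` ball (s x (N x)) 1"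
      have "open ?U"
        by (intro open_UN ballI open_vimage open_ball continuous_on_product_coordinates)
      moreover have "V = f -` ?U \<inter> \<sigma> ` Y"
      proof
        show "V \<subseteq> f -` ?U \<inter> \<sigma> ` Y"
        proof
          fix v assume "v \<in> V"
          then obtain x where "x \<in> Y" "v = \<sigma> x" using R by blast
          then show "v \<in> f -` ?U \<inter> \<sigma> ` Y" using \<open>v \<in> V\<close> f\<sigma> by force
        qed
        show "f -` ?U \<inter> \<sigma> ` Y \<subseteq> V"
        proof
          fix v assume "v \<in> f -` ?U \<inter> \<sigma> ` Y"
          then obtain x y where xy: "x \<in> Y" "\<sigma> x \<in> V" "y \<in> Y" "v = \<sigma> y" "dist (s x (N x)) (s y (N x)) < 1"
            using f\<sigma> by auto
          have "\<bar>real (c (N x) (p (N x) x)) - real (c (N x) (p (N x) y))\<bar> < 1"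
            using xy(5) by (simp add: s_def dist_real_def)
          then have "c (N x) (p (N x) x) = c (N x) (p (N x) y)" by linarith
          then show "v \<in> V" using N xy ceq by metis
        qed
      qed
      ultimately show "openin X V" using oX by blast
    qed
  qed
qed

section \<open>Transversals\<close>

text \<open>\<open>X\<close> is a copy, inside the reals, of the space of the tilings that contain one of the prototiles in
  \<open>Q\<close>, where tilings are close if they agree on a large ball, without any motion.\<close>

locale hull_transversal = flc_tiling T for T :: "('n::finite, 'l) tiling" +
  fixes Q :: "('n, 'l) tile set" and X :: "real topology" and \<sigma> :: "('n, 'l) tiling \<Rightarrow> real"
  assumes finite_Q: "finite Q"
    and Q_tile: "\<And>t. t \<in> Q \<Longrightarrow> polyhedral_tile (fst t)"
    and Q_zero: "\<And>t. t \<in> Q \<Longrightarrow> 0 \<in> interior (fst t)"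
    and Q_cover: "\<And>S s. S \<in> Hull \<Longrightarrow> s \<in> S \<Longrightarrow> \<exists>t\<in>Q. \<exists>h\<in>SE. s = move_tile h t"
    and \<sigma>_inj: "inj_on \<sigma> {S \<in> Hull. \<exists>t\<in>Q. t \<in> S}"
    and topspace_X: "topspace X = \<sigma> ` {S \<in> Hull. \<exists>t\<in>Q. t \<in> S}"
    and compact_X: "compact_space X" and separable_X: "separable_space X"
    and totally_disconnected_X: "totally_disconnected_space X" and metrizable_X: "metrizable_space X"
    and openin_X: "\<And>V. openin X V \<longleftrightarrow> V \<subseteq> \<sigma> ` {S \<in> Hull. \<exists>t\<in>Q. t \<in> S} \<and>
      (\<forall>S\<in>{S \<in> Hull. \<exists>t\<in>Q. t \<in> S}. \<sigma> S \<in> V \<longrightarrow>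
        (\<exists>n. \<forall>S'\<in>{S \<in> Hull. \<exists>t\<in>Q. t \<in> S}. agree_on_ball (real n) S S' \<longrightarrow> \<sigma> S' \<in> V))"

text \<open>The levels of the inverse limit are the patches of radius \<open>n\<close> around the
  origin. Their number is finite because each tiling in question contains one of finitely many
  prototiles in a fixed position.\<close>

lemma (in flc_tiling) hull_transversal_exists: "\<exists>Q X \<sigma>. hull_transversal T Q X \<sigma>"
proof -
  obtain Q where Q: "finite Q" "\<And>t. t \<in> Q \<Longrightarrow> polyhedral_tile (fst t) \<and> 0 \<in> interior (fst t)"
    "\<And>S s. S \<in> Hull \<Longrightarrow> s \<in> S \<Longrightarrow> \<exists>t\<in>Q. \<exists>h\<in>SE. s = move_tile h t"
    using prototiles by blast
  define Y where "Y = {S \<in> Hull. \<exists>t\<in>Q. t \<in> S}"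
  define p :: "nat \<Rightarrow> ('n, 'l) tiling \<Rightarrow> ('n, 'l) tiling" where "p n S = r_patch S (real n) 0" for n S
  have p_eq: "p n S = p n S' \<longleftrightarrow> agree_on_ball (real n) S S'" for n S S'
    by (simp add: p_def agree_on_ball_def)
  obtain X :: "real topology" and \<sigma> where X: "inj_on \<sigma> Y" "topspace X = \<sigma> ` Y" "compact_space X"
    "separable_space X" "totally_disconnected_space X" "metrizable_space X"
    "\<And>V. openin X V \<longleftrightarrow> V \<subseteq> \<sigma> ` Y \<and> (\<forall>x\<in>Y. \<sigma> x \<in> V \<longrightarrow> (\<exists>n. \<forall>y\<in>Y. p n y = p n x \<longrightarrow> \<sigma> y \<in> V))"
  proof (rule profinite_real_space[of p Y])
    show "finite (p n ` Y)" for n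
    proof (rule finite_subset)
      show "p n ` Y \<subseteq> (\<Union>t\<in>Q. {r_patch S (real n) 0 | S. S \<in> Hull \<and> t \<in> S})"
      proof
        fix q assume "q \<in> p n ` Y"
        then obtain S t where "S \<in> Hull" "t \<in> Q" "t \<in> S" "q = r_patch S (real n) 0"
          by (auto simp: Y_def p_def)
        then show "q \<in> (\<Union>t\<in>Q. {r_patch S (real n) 0 | S. S \<in> Hull \<and> t \<in> S})"
          by (intro UN_I[of t]) auto
      qed
      show "finite (\<Union>t\<in>Q. {r_patch S (real n) 0 | S. S \<in> Hull \<and> t \<in> S})"
        using Q(1,2) finite_patches_at_tile by (intro finite_UN_I) simp_all
    qed
  next
    fix S S' assume S: "S \<in> Y" "S' \<in> Y" "\<And>n. p n S = p n S'"
    have "t \<in> S \<longleftrightarrow> t \<in> S'" if t: "t \<in> S \<or> t \<in> S'" for t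
    proof -
      have "is_tiling S" "is_tiling S'" using S hull_is_tiling by (auto simp: Y_def)
      then have "polyhedral_tile (fst t)" using t by (auto simp: is_tiling_def)
      then obtain x where x: "x \<in> fst t" using polyhedral_tile_interior interior_subset by blast
      obtain n where n: "norm x \<le> real n" using real_arch_simple by blast
      have "agree_on_ball (real n) S S'" using S(3) p_eq by blast
      moreover have "fst t \<inter> cball 0 (real n) \<noteq> {}" using x n by auto
      ultimately show ?thesis unfolding agree_on_ball_iff by (elim allE impE)
    qed
    then show "S = S'" by blast
  next
    fix S S' m n assume "m \<le> n" "p n S = p n S'"
    then show "p m S = p m S'"
      unfolding p_eq using agree_on_ball_mono[of "real n" S S' "real m"] by simp
  next
    fix q assume q: "\<And>n. \<exists>x\<in>Y. \<forall>m\<le>n. p m x = q m"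
    have ex: "\<exists>S\<in>Hull. \<forall>m\<le>n. r_patch S (real m) 0 = q m" for n
      using q[of n] by (auto simp: Y_def p_def)
    obtain S where S: "S \<in> Hull" "\<And>n. r_patch S (real n) 0 = q n"
      using hull_limit[OF ex] by blast
    obtain S' where S': "S' \<in> Y" "p 0 S' = q 0" using q[of 0] by auto
    then obtain t where t: "t \<in> Q" "t \<in> S'" by (auto simp: Y_def)
    \<comment> \<open>A prototile contains the origin, so it shows in the patch of radius 0 and is
      inherited by the limit tiling.\<close>
    have "0 \<in> fst t" using Q(2)[OF t(1)] interior_subset by blast
    then have "t \<in> p 0 S'" using t(2) by (auto simp: p_def r_patch_def)
    then have "t \<in> r_patch S (real 0) 0" using S'(2) S(2)[of 0] by simp
    then have "t \<in> S" by (simp add: r_patch_def)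
    then have "S \<in> Y" using S(1) t(1) by (auto simp: Y_def)
    then show "\<exists>x\<in>Y. \<forall>n. p n x = q n" using S(2) by (intro bexI[of _ S]) (simp_all add: p_def)
  qed (rule that)
  have "hull_transversal T Q X \<sigma>"
    unfolding hull_transversal_def hull_transversal_axioms_def
    using Q X flc_tiling_axioms
    by (simp add: p_eq Y_def[symmetric]) (metis agree_on_ball_sym)
  then show ?thesis by blast
qed

lemma norm_snd_ginv: "g \<in> SE \<Longrightarrow> norm (snd (ginv g)) = norm (snd g)"
  using orthogonal_matrix_norm[of "transpose (fst g)"]
  by (simp add: ginv_def SE_def rotation_matrix_def del: transpose_matrix_vector)

text \<open>On \<open>SE\<close> the condition amounts to \<open>act (ginv g) 0 \<in> P\<close>,
  which is closed. Rotation matrices have constant Frobenius norm, and \<open>snd g\<close> is minus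
  a rotated point of \<open>P\<close>, which bounds it.\<close>

lemma compact_SE_Collect:
  fixes P :: "(real^'n) set"
  assumes "compact P"
  shows "compact {g \<in> SE. 0 \<in> act g ` P}"
proof -
  let ?K = "{g :: 'n motion. g \<in> SE \<and> 0 \<in> act g ` P}"
  have "?K = {g. transpose (fst g) ** fst g = mat 1} \<inter> {g. det (fst g) = 1} \<inter> (\<lambda>g. act (ginv g) 0) -` P"
  proof -
    have "SE = {g :: 'n motion. transpose (fst g) ** fst g = mat 1} \<inter> {g. det (fst g) = 1}"
      by (auto simp: SE_def rotation_matrix_def orthogonal_matrix)
    moreover have "?K = SE \<inter> (\<lambda>g. act (ginv g) 0) -` P"
    proof (rule set_eqI)
      show "g \<in> ?K \<longleftrightarrow> g \<in> SE \<inter> (\<lambda>g. act (ginv g) 0) -` P" for g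
        by (cases "g \<in> SE") (simp_all add: act_image_ginv)
    qed
    ultimately show ?thesis by simp
  qed
  moreover have "closed \<dots>"
    by (intro closed_Int closed_Collect_eq closed_vimage continuous_on_det continuous_matrix_intros
      continuous_on_act_apply continuous_on_ginv continuous_intros compact_imp_closed assms
      bounded_linear.continuous_on[OF bounded_linear_transpose])
  moreover have "bounded ?K"
  proof -
    obtain M where M: "\<And>x. x \<in> P \<Longrightarrow> norm x \<le> M"
      using compact_imp_bounded[OF assms] by (auto simp: bounded_iff)
    have "norm g \<le> norm (mat 1 :: real^'n^'n) + M" if "g \<in> ?K" for g
    proof -
      have "0 \<in> act g ` P" using that by blast
      then obtain x where x: "x \<in> P" "act g x = 0" by (metis imageE)
      have o: "orthogonal_matrix (fst g)" using that by (simp add: SE_def rotation_matrix_def)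
      have "snd g = - (fst g *v x)" using x(2) by (simp add: act_def eq_neg_iff_add_eq_0 add.commute)
      then have "norm (snd g) = norm x" using orthogonal_matrix_norm[OF o] by simp
      moreover have "norm (fst g) = norm (mat 1 :: real^'n^'n)"
        using norm_orthogonal_mul_left[OF o, of "mat 1"] by simp
      ultimately show ?thesis
        using M[OF x(1)] norm_Pair_le[of "fst g" "snd g"] by simp
    qed
    then show ?thesis unfolding bounded_iff by blast
  qed
  ultimately show ?thesis by (simp add: compact_eq_bounded_closed)
qed

context hull_transversal
begin

definition Xi :: "('n, 'l) tile \<Rightarrow> ('n, 'l) tiling set" where
  "Xi t = {S \<in> Hull. t \<in> S}"

abbreviation Omega :: "('n, 'l) tiling topology" where "Omega \<equiv> rotational_hull T"

definition Y :: "('n, 'l) tiling set" where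
  "Y = {S \<in> Hull. \<exists>t\<in>Q. t \<in> S}"

definition \<tau> :: "real \<Rightarrow> ('n, 'l) tiling" where
  "\<tau> = inv_into Y \<sigma>"

definition transversal :: "('n, 'l) tile \<Rightarrow> real set" where
  "transversal t = \<sigma> ` Xi t"

lemma tau_sigma [simp]: "S \<in> Y \<Longrightarrow> \<tau> (\<sigma> S) = S"
  using \<sigma>_inj by (simp add: \<tau>_def Y_def)

lemma Xi_subset_Y: "t \<in> Q \<Longrightarrow> Xi t \<subseteq> Y"
  by (auto simp: Xi_def Y_def)

lemma Xi_Hull: "S \<in> Xi t \<Longrightarrow> S \<in> Hull" "S \<in> Xi t \<Longrightarrow> t \<in> S"
  by (auto simp: Xi_def)

lemma Y_Hull: "S \<in> Y \<Longrightarrow> S \<in> Hull"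
  by (auto simp: Y_def)

lemma topspace_X_Y: "topspace X = \<sigma> ` Y"
  by (simp add: topspace_X Y_def)

lemma openin_X_iff: "openin X V \<longleftrightarrow> V \<subseteq> \<sigma> ` Y \<and>
    (\<forall>S\<in>Y. \<sigma> S \<in> V \<longrightarrow> (\<exists>n. \<forall>S'\<in>Y. agree_on_ball (real n) S S' \<longrightarrow> \<sigma> S' \<in> V))"
  unfolding Y_def by (rule openin_X)

lemma sigma_transversal_iff: "S \<in> Y \<Longrightarrow> t \<in> Q \<Longrightarrow> \<sigma> S \<in> transversal t \<longleftrightarrow> S \<in> Xi t"
  unfolding transversal_def
  by (rule inj_on_image_mem_iff[OF _ _ Xi_subset_Y]) (use \<sigma>_inj in \<open>simp_all add: Y_def\<close>)

lemma Q_origin: "t \<in> Q \<Longrightarrow> 0 \<in> fst t"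
  by (rule subsetD[OF interior_subset Q_zero])

text \<open>A prototile contains the origin and so meets every ball around it, even that of radius
  0.\<close>

lemma agree_tile: "\<lbrakk>agree_on_ball r S S'; t \<in> Q; 0 \<le> r\<rbrakk> \<Longrightarrow> t \<in> S \<longleftrightarrow> t \<in> S'"
proof -
  assume a: "agree_on_ball r S S'" "t \<in> Q" "0 \<le> r"
  have "0 \<in> fst t \<inter> cball 0 r" using Q_origin[OF a(2)] a(3) by simp
  then have "fst t \<inter> cball 0 r \<noteq> {}" by (rule ex_in_conv[THEN iffD1, OF exI])
  then show ?thesis by (rule a(1)[unfolded agree_on_ball_iff, rule_format])
qed

lemma openin_transversal: "t \<in> Q \<Longrightarrow> openin X (transversal t)"
  unfolding openin_X_iff
proof (intro conjI ballI impI)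
  assume t: "t \<in> Q"
  show "transversal t \<subseteq> \<sigma> ` Y" using Xi_subset_Y[OF t] by (auto simp: transversal_def)
  fix S assume S: "S \<in> Y" "\<sigma> S \<in> transversal t"
  then have "S \<in> Xi t"
    using sigma_transversal_iff t by simp
  then have "\<forall>S'\<in>Y. agree_on_ball (real 0) S S' \<longrightarrow> \<sigma> S' \<in> transversal t"
    using agree_tile[of "real 0" S _ t] t by (auto simp: transversal_def Xi_def Y_Hull)
  then show "\<exists>n. \<forall>S'\<in>Y. agree_on_ball (real n) S S' \<longrightarrow> \<sigma> S' \<in> transversal t" by blast
qed

text \<open>Two different prototiles in one tiling would overlap at the origin. As the transversals
  are open and cover the space, this makes each of them closed as well.\<close>

lemma Xi_disjoint:
  assumes "t \<in> Q" "t' \<in> Q" "S \<in> Xi t" "S \<in> Xi t'"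
  shows "t = t'"
proof (rule tile_overlap)
  show "is_tiling S" by (rule hull_is_tiling[OF Xi_Hull(1)[OF assms(3)]])
  show "t \<in> S" "t' \<in> S" by (rule Xi_Hull(2)[OF assms(3)], rule Xi_Hull(2)[OF assms(4)])
  show "interior (fst t) \<inter> fst t' \<noteq> {}" using Q_zero[OF assms(1)] Q_origin[OF assms(2)] by blast
qed

lemma closedin_transversal:
  assumes t: "t \<in> Q"
  shows "closedin X (transversal t)"
proof -
  have "topspace X - transversal t = (\<Union>t'\<in>Q - {t}. transversal t')"
  proof
    show "topspace X - transversal t \<subseteq> (\<Union>t'\<in>Q - {t}. transversal t')"
    proof
      fix r assume "r \<in> topspace X - transversal t"
      then obtain S where S: "S \<in> Y" "r = \<sigma> S" "r \<notin> transversal t" by (auto simp: topspace_X_Y)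
      then obtain t' where t': "t' \<in> Q" "S \<in> Xi t'" by (auto simp: Y_def Xi_def)
      then have "t' \<noteq> t" using S by (auto simp: transversal_def)
      then show "r \<in> (\<Union>t'\<in>Q - {t}. transversal t')" using t' S(2) by (auto simp: transversal_def)
    qed
    show "(\<Union>t'\<in>Q - {t}. transversal t') \<subseteq> topspace X - transversal t"
    proof
      fix r assume "r \<in> (\<Union>t'\<in>Q - {t}. transversal t')"
      then obtain t' S where S: "t' \<in> Q" "t' \<noteq> t" "S \<in> Xi t'" "r = \<sigma> S" by (auto simp: transversal_def)
      then have Y: "S \<in> Y" using Xi_subset_Y by blast
      have "S \<notin> Xi t" using Xi_disjoint[OF t S(1)] S by auto
      then have "r \<notin> transversal t" using sigma_transversal_iff[OF Y t] S(4) by simp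
      then show "r \<in> topspace X - transversal t" using Y S(4) by (simp add: topspace_X_Y)
    qed
  qed
  moreover have "openin X (\<Union>t'\<in>Q - {t}. transversal t')"
    using openin_transversal by (intro openin_Union) auto
  moreover have "transversal t \<subseteq> topspace X" using openin_transversal[OF t] openin_subset by blast
  ultimately show ?thesis by (simp add: closedin_def)
qed

lemma compactin_transversal: "t \<in> Q \<Longrightarrow> compactin X (transversal t)"
  using closedin_compact_space[OF compact_X closedin_transversal] .

lemma tau_transversal: "r \<in> transversal t \<Longrightarrow> t \<in> Q \<Longrightarrow> \<tau> r \<in> Xi t"
  using Xi_subset_Y[of t] by (auto simp: transversal_def)

section \<open>The action on the hull\<close>

lemma near_one_open:
  assumes "g \<in> SE" "0 < e"
  obtains U where "openin (top_of_set SE) U" "g \<in> U" "\<And>g'. g' \<in> U \<Longrightarrow> near_one e (gmul g' (ginv g))"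
proof
  let ?U = "SE \<inter> (\<lambda>g'. dist (gmul g' (ginv g)) gone) -` {..<e}"
  show "openin (top_of_set SE) ?U"
    by (intro continuous_openin_preimage_gen continuous_on_gmul continuous_intros open_lessThan)
  show "g \<in> ?U" using assms by (simp add: gmul_ginv_right)
  show "near_one e (gmul g' (ginv g))" if "g' \<in> ?U" for g'
    using that near_one_if_dist by blast
qed

text \<open>A motion close to \<open>g\<close> is \<open>gmul k g\<close> with \<open>k\<close> near
  1. So agreement has to survive only \<open>g\<close> itself, at the cost of
  \<open>norm (snd g)\<close> in the radius, while \<open>k\<close> is absorbed by the description
  of neighbourhoods.\<close>

lemma continuous_action:
  "continuous_map (prod_topology (top_of_set SE) X) Omega (\<lambda>(g, r). move (act g) (\<tau> r))"
  unfolding continuous_map_def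
proof (intro conjI allI impI)
  show "(\<lambda>(g, r). move (act g) (\<tau> r)) \<in> topspace (prod_topology (top_of_set SE) X) \<rightarrow> topspace Omega"
    by (auto simp: topspace_X_Y topspace_rotational_hull hull_move Y_Hull)
  fix V assume V: "openin Omega V"
  let ?W = "{z \<in> topspace (prod_topology (top_of_set SE) X). (case z of (g, r) \<Rightarrow> move (act g) (\<tau> r)) \<in> V}"
  show "openin (prod_topology (top_of_set SE) X) ?W"
    unfolding openin_prod_topology_alt
  proof (intro allI impI)
    fix g r assume "(g, r) \<in> ?W"
    then obtain S where S: "g \<in> SE" "S \<in> Y" "r = \<sigma> S" "move (act g) S \<in> V"
      by (auto simp: topspace_X_Y)
    obtain e where e: "0 < e" "\<And>S' k. \<lbrakk>S' \<in> Hull; k \<in> SE; near_one e k; agree_on_ball (1/e) (move (act g) S) S'\<rbrakk>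
        \<Longrightarrow> move (act k) S' \<in> V"
      using V S(4) unfolding openin_hull_iff by meson
    obtain U where U: "openin (top_of_set SE) U" "g \<in> U" "\<And>g'. g' \<in> U \<Longrightarrow> near_one e (gmul g' (ginv g))"
      using near_one_open[OF S(1) e(1)] by blast
    obtain n where n: "1/e + norm (snd g) \<le> real n" using real_arch_simple by blast
    let ?C = "\<sigma> ` {S' \<in> Y. agree_on_ball (real n) S S'}"
    have "openin X ?C"
      unfolding openin_X_iff
    proof (intro conjI ballI impI)
      show "?C \<subseteq> \<sigma> ` Y" by blast
      fix S1 assume S1: "S1 \<in> Y" "\<sigma> S1 \<in> ?C"
      then have "agree_on_ball (real n) S S1" by (metis (no_types, lifting) image_iff mem_Collect_eq tau_sigma)
      then have "\<forall>S'\<in>Y. agree_on_ball (real n) S1 S' \<longrightarrow> \<sigma> S' \<in> ?C"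
        using agree_on_ball_trans by blast
      then show "\<exists>m. \<forall>S'\<in>Y. agree_on_ball (real m) S1 S' \<longrightarrow> \<sigma> S' \<in> ?C" by blast
    qed
    moreover have "r \<in> ?C" using S by auto
    moreover have "U \<times> ?C \<subseteq> ?W"
    proof
      fix z assume "z \<in> U \<times> ?C"
      then obtain g' S' where z: "z = (g', \<sigma> S')" "g' \<in> U" "S' \<in> Y" "agree_on_ball (real n) S S'" by blast
      have g': "g' \<in> SE" using z(2) U(1) openin_subset by fastforce
      have "agree_on_ball (1/e) (move (act g) S) (move (act g) S')"
        by (rule agree_on_ball_move[OF S(1) z(4) n])
      then have "move (act (gmul g' (ginv g))) (move (act g) S') \<in> V"
        using z S(1) g' U(3) by (intro e(2) hull_move SE_gmul SE_ginv Y_Hull)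
      then have "move (act g') S' \<in> V" by (simp add: move_gmul move_ginv S(1))
      then show "z \<in> ?W" using z g' by (simp add: topspace_X_Y)
    qed
    ultimately show "\<exists>U V. openin (top_of_set SE) U \<and> openin X V \<and> g \<in> U \<and> r \<in> V \<and> U \<times> V \<subseteq> ?W"
      using U(1,2) by blast
  qed
qed

text \<open>A tiling near \<open>g S\<close> has the form \<open>k S2\<close> with \<open>k\<close>
  near 1 and \<open>S2\<close> agreeing with \<open>g S\<close> on a large ball. Then
  \<open>S3\<close>, the image of \<open>S2\<close> under the inverse of \<open>g\<close>, agrees
  with \<open>S\<close> near the origin and so contains \<open>t\<close>, and \<open>k S2\<close> is
  \<open>(k g) S3\<close>.\<close>

lemma open_action:
  assumes t: "t \<in> Q"
  shows "open_map (prod_topology (top_of_set SE) (subtopology X (transversal t))) Omega (\<lambda>(g, r). move (act g) (\<tau> r))"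
  unfolding open_map_def
proof (intro allI impI)
  fix W :: "('n motion \<times> real) set"
  assume W: "openin (prod_topology (top_of_set SE) (subtopology X (transversal t))) W"
  have sub: "g \<in> SE \<and> r \<in> transversal t" if "(g, r) \<in> W" for g r
    using openin_subset[OF W] that by auto
  show "openin Omega ((\<lambda>(g, r). move (act g) (\<tau> r)) ` W)"
    unfolding openin_hull_iff
  proof (intro conjI ballI)
    show "(\<lambda>(g, r). move (act g) (\<tau> r)) ` W \<subseteq> Hull"
    proof (intro image_subsetI)
      fix z assume z: "z \<in> W"
      have "fst z \<in> SE" "snd z \<in> transversal t" using sub[of "fst z" "snd z"] z by simp_all
      then have "move (act (fst z)) (\<tau> (snd z)) \<in> Hull"
        by (intro hull_move Xi_Hull(1)[OF tau_transversal[OF _ t]])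
      then show "(case z of (g, r) \<Rightarrow> move (act g) (\<tau> r)) \<in> Hull" by (simp add: case_prod_beta)
    qed
    fix S0 assume "S0 \<in> (\<lambda>(g, r). move (act g) (\<tau> r)) ` W"
    then obtain g r where gr: "(g, r) \<in> W" "S0 = move (act g) (\<tau> r)" by auto
    have g: "g \<in> SE" and "r \<in> transversal t" using sub[OF gr(1)] by simp_all
    then obtain S where S: "S \<in> Xi t" and r: "r = \<sigma> S" by (auto simp: transversal_def)
    have SY: "S \<in> Y" by (rule subsetD[OF Xi_subset_Y[OF t] S])
    from W[unfolded openin_prod_topology_alt, rule_format, OF gr(1)]
    obtain U V where UV: "openin (top_of_set SE) U" "openin (subtopology X (transversal t)) V" "g \<in> U" "r \<in> V" "U \<times> V \<subseteq> W"
      by (elim exE conjE)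
    have "openin X V" by (rule openin_trans_full[OF UV(2) openin_transversal[OF t]])
    from this[unfolded openin_X_iff, THEN conjunct2, rule_format, OF SY UV(4)[unfolded r]]
    obtain n where n: "\<And>S'. \<lbrakk>S' \<in> Y; agree_on_ball (real n) S S'\<rbrakk> \<Longrightarrow> \<sigma> S' \<in> V"
      by auto
    obtain B where B: "open B" "U = SE \<inter> B" using UV(1) by (auto simp: openin_open)
    have "open ((\<lambda>k. gmul k g) -` B)"
      by (intro open_vimage B continuous_on_gmul continuous_intros)
    moreover have "gone \<in> (\<lambda>k. gmul k g) -` B" using B UV(3) by simp
    ultimately obtain d where d: "0 < d" "\<And>k. dist k gone < d \<Longrightarrow> gmul k g \<in> B"
      unfolding open_dist by (elim ballE exE conjE) auto
    \<comment> \<open>Half of \<open>d\<close> because \<open>near_one e\<close> bounds the distance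
      by \<open>2 * e\<close>; the second bound leaves radius \<open>n\<close> after moving back by
      \<open>g\<close>.\<close>
    define e where "e = min (d / 2) (1 / (real n + norm (snd g) + 1))"
    have pos: "0 < real n + norm (snd g) + 1" by (simp add: add_nonneg_pos)
    have e: "0 < e" "2 * e \<le> d" using d(1) pos by (auto simp: e_def)
    have "1 / (1 / (real n + norm (snd g) + 1)) \<le> 1/e"
      using e(1) pos by (intro divide_left_mono) (auto simp: e_def)
    then have en: "real n + norm (snd g) \<le> 1/e" by simp
    have "move (act k) S2 \<in> (\<lambda>(g, r). move (act g) (\<tau> r)) ` W"
      if S2: "S2 \<in> Hull" "k \<in> SE" "near_one e k" "agree_on_ball (1/e) S0 S2" for S2 k
    proof -
      define S3 where "S3 = move (act (ginv g)) S2"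
      have "agree_on_ball (real n) (move (act (ginv g)) S0) S3"
        unfolding S3_def using en norm_snd_ginv[OF g]
        by (intro agree_on_ball_move[OF SE_ginv[OF g] S2(4)]) simp
      then have agr: "agree_on_ball (real n) S S3" by (simp add: gr(2) r SY move_ginv g)
      have "t \<in> S3" using agree_tile[OF agr t] S Xi_Hull by simp
      moreover have H3: "S3 \<in> Hull" unfolding S3_def using g S2(1) by (intro hull_move SE_ginv)
      ultimately have Y3: "S3 \<in> Y" using t by (auto simp: Y_def)
      have "gmul k g \<in> B" using d(2) dist_if_near_one[OF S2(3)] e(2) by simp
      then have "gmul k g \<in> U" using B SE_gmul[OF S2(2) g] by blast
      then have "(gmul k g, \<sigma> S3) \<in> W" using n[OF Y3 agr] UV(5) by blast
      moreover have "move (act k) S2 = (\<lambda>(g, r). move (act g) (\<tau> r)) (gmul k g, \<sigma> S3)"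
        using Y3 by (simp add: S3_def move_gmul move_ginv g)
      ultimately show ?thesis by (rule rev_image_eqI)
    qed
    then show "\<exists>e>0. \<forall>S'\<in>Hull. \<forall>g\<in>SE. near_one e g \<and> agree_on_ball (1/e) S0 S' \<longrightarrow>
        move (act g) S' \<in> (\<lambda>(g, r). move (act g) (\<tau> r)) ` W"
      using e(1) by blast
  qed
qed

section \<open>Compactness and connectedness of the hull\<close>

lemma hull_representation:
  assumes "S \<in> Hull"
  obtains t h S0 where "t \<in> Q" "h \<in> SE" "S0 \<in> Xi t" "S = move (act h) S0" "0 \<in> act h ` fst t"
proof -
  \<comment> \<open>The marked tile is chosen over the origin, which confines \<open>h\<close> to a
    compact set for each prototile.\<close>
  have "0 \<in> \<Union>(fst ` S)" using hull_is_tiling[OF assms] by (simp add: is_tiling_def)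
  then obtain s where s: "s \<in> S" "0 \<in> fst s" by auto
  obtain t h where th: "t \<in> Q" "h \<in> SE" "s = move_tile h t" using Q_cover[OF assms s(1)] by blast
  have "t \<in> move (act (ginv h)) S"
    using s(1) th by (simp add: mem_move_iff SE_ginv ginv_ginv)
  then show thesis
    using that[of t h "move (act (ginv h)) S"] th s(2) assms
    by (simp add: Xi_def hull_move SE_ginv move_ginv)
qed

lemma compact_Omega: "compact_space Omega"
proof -
  let ?F = "\<lambda>(g, r). move (act g) (\<tau> r)"
  let ?K = "\<lambda>t. {g \<in> SE. 0 \<in> act g ` fst t}"
  have c: "compactin Omega (?F ` (?K t \<times> transversal t))" if t: "t \<in> Q" for t
  proof (rule image_compactin[OF _ continuous_action])
    have "compactin (top_of_set SE) (?K t)"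
      using compact_SE_Collect[OF polyhedral_tile_compact[OF Q_tile[OF t]]]
      by (simp add: compactin_subtopology)
    then show "compactin (prod_topology (top_of_set SE) X) (?K t \<times> transversal t)"
      using compactin_transversal[OF t] by (simp add: compactin_Times)
  qed
  have "Hull \<subseteq> (\<Union>t\<in>Q. ?F ` (?K t \<times> transversal t))"
  proof
    fix S assume "S \<in> Hull"
    then obtain t h S0 where h: "t \<in> Q" "h \<in> SE" "S0 \<in> Xi t" "S = move (act h) S0" "0 \<in> act h ` fst t"
      by (rule hull_representation)
    have "S0 \<in> Y" by (rule subsetD[OF Xi_subset_Y h(3)]) (rule h(1))
    with h have *: "(h, \<sigma> S0) \<in> ?K t \<times> transversal t" "S = ?F (h, \<sigma> S0)"
      by (simp_all add: transversal_def)
    show "S \<in> (\<Union>t\<in>Q. ?F ` (?K t \<times> transversal t))"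
      by (rule UN_I[OF h(1)], rule rev_image_eqI, rule *(1), rule *(2))
  qed
  then have cover: "topspace Omega \<subseteq> (\<Union>t\<in>Q. ?F ` (?K t \<times> transversal t))"
    by (simp only: topspace_rotational_hull)
  have *: "compactin Omega (\<Union>t\<in>Q. ?F ` (?K t \<times> transversal t))"
    using c finite_Q by (intro compactin_Union) auto
  have "topspace Omega = (\<Union>t\<in>Q. ?F ` (?K t \<times> transversal t))"
    by (rule subset_antisym[OF cover compactin_subset_topspace[OF *]])
  with * show ?thesis by (simp only: compact_space_def)
qed

lemma connected_Omega:
  assumes "2 \<le> CARD('n)"
  shows "connected_space Omega"
proof -
  obtain t h S0 where h: "t \<in> Q" "h \<in> SE" "S0 \<in> Xi t" "T = move (act h) S0"
    using hull_representation[OF T_in_hull] by metis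
  have S0: "S0 \<in> Y" using Xi_subset_Y h by blast
  \<comment> \<open>\<open>T\<close> need not contain a prototile in its reference position, so its
    orbit is written through \<open>S0\<close> with the motions \<open>gmul g h\<close>.\<close>
  have "continuous_map (top_of_set SE) (prod_topology (top_of_set SE) X) (\<lambda>g. (gmul g h, \<sigma> S0))"
    using h(2) S0
    by (simp add: continuous_map_pairwise comp_def continuous_map_in_subtopology topspace_X_Y
        continuous_on_gmul image_subset_iff SE_gmul)
  then have "continuous_map (top_of_set SE) Omega ((\<lambda>(g, r). move (act g) (\<tau> r)) \<circ> (\<lambda>g. (gmul g h, \<sigma> S0)))"
    using continuous_action by (rule continuous_map_compose)
  then have "connectedin Omega (((\<lambda>(g, r). move (act g) (\<tau> r)) \<circ> (\<lambda>g. (gmul g h, \<sigma> S0))) ` SE)"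
    using connected_SE[OF assms]
    by (elim connectedin_continuous_map_image) (simp add: connectedin_subtopology)
  moreover have "((\<lambda>(g, r). move (act g) (\<tau> r)) \<circ> (\<lambda>g. (gmul g h, \<sigma> S0))) ` SE = (\<lambda>g. move (act g) T) ` SE"
    using S0 by (intro image_cong refl) (simp add: move_gmul flip: h(4))
  ultimately have con: "connectedin Omega ((\<lambda>g. move (act g) T) ` SE)" by simp
  have "Hull \<subseteq> Omega closure_of ((\<lambda>g. move (act g) T) ` SE)"
  proof
    fix S assume S: "S \<in> Hull"
    show "S \<in> Omega closure_of ((\<lambda>g. move (act g) T) ` SE)"
      unfolding in_closure_of
    proof (intro conjI allI impI)
      show "S \<in> topspace Omega" using S by (simp add: topspace_rotational_hull)
      fix V assume V: "S \<in> V \<and> openin Omega V"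
      then obtain e where e: "0 < e" "\<And>S' k. \<lbrakk>S' \<in> Hull; k \<in> SE; near_one e k; agree_on_ball (1/e) S S'\<rbrakk>
        \<Longrightarrow> move (act k) S' \<in> V"
        unfolding openin_hull_iff by meson
      \<comment> \<open>A patch of \<open>S\<close> around the origin occurs in \<open>T\<close> up
        to motion; undoing that motion puts a copy of \<open>T\<close> into the given
        neighbourhood.\<close>
      obtain g where g: "g \<in> SE" "r_patch T (1/e) (act g 0) = move (act g) (r_patch S (1/e) 0)"
        using hull_patch_in_T[OF S] by blast
      have "r_patch (move (act (ginv g)) T) (1/e) 0 = r_patch (move (act (ginv g)) T) (1/e) (act (ginv g) (act g 0))"
        by (simp add: act_ginv g)
      also have "\<dots> = move (act (ginv g)) (r_patch T (1/e) (act g 0))"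
        by (rule r_patch_move[OF SE_ginv[OF g(1)]])
      also have "\<dots> = r_patch S (1/e) 0"
        by (simp add: g move_ginv)
      finally have "agree_on_ball (1/e) S (move (act (ginv g)) T)"
        by (simp add: agree_on_ball_def)
      then have "move (act gone) (move (act (ginv g)) T) \<in> V"
        using g e(1) by (intro e(2) hull_move SE_ginv SE_gone near_one_gone T_in_hull)
      then have "move (act (ginv g)) T \<in> V" by (simp del: act_gone_fun)
      then show "\<exists>y. y \<in> (\<lambda>g. move (act g) T) ` SE \<and> y \<in> V" using SE_ginv[OF g(1)] by blast
    qed
  qed
  then have "Omega closure_of ((\<lambda>g. move (act g) T) ` SE) = topspace Omega"
    by (intro subset_antisym closure_of_subset_topspace) (simp add: topspace_rotational_hull)
  then have "connectedin Omega (topspace Omega)"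
    using connectedin_closure_of[OF con] by simp
  then show ?thesis by (simp add: connectedin_topspace)
qed

end

section \<open>Metrizability of the hull\<close>

text \<open>The cap 1 gives a meaningful value when \<open>S\<close> contains no copy of \<open>t\<close>, and it makes the value
  depend on a bounded part of \<open>S\<close> only.\<close>

definition placement :: "('n::finite, 'l) tile \<Rightarrow> 'n motion \<Rightarrow> ('n, 'l) tiling \<Rightarrow> real" where
  "placement t a S = Inf (insert 1 {dist a g | g. g \<in> SE \<and> move_tile g t \<in> S})"

lemma placement_bdd: "bdd_below (insert 1 {dist a g | g. g \<in> SE \<and> move_tile g t \<in> S})"
  by (rule bdd_belowI[of _ 0]) auto

lemma placement_le_one: "placement t a S \<le> 1"
  unfolding placement_def by (rule cInf_lower[OF _ placement_bdd]) simp

lemma placement_le: "g \<in> SE \<Longrightarrow> move_tile g t \<in> S \<Longrightarrow> placement t a S \<le> dist a g"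
  unfolding placement_def by (rule cInf_lower[OF _ placement_bdd]) blast

lemma placement_ge:
  assumes "c \<le> 1" "\<And>g. g \<in> SE \<Longrightarrow> move_tile g t \<in> S \<Longrightarrow> c \<le> dist a g"
  shows "c \<le> placement t a S"
  unfolding placement_def by (rule cInf_greatest) (use assms in auto)

lemma dist_gmul_near:
  assumes "near_one e k" "g \<in> SE"
  shows "dist g (gmul k g) \<le> e * (2 + norm (snd g))"
proof -
  have o: "orthogonal_matrix (fst g)" using assms(2) by (simp add: SE_def rotation_matrix_def)
  have k: "norm (fst k - mat 1) < e" "norm (snd k) < e" using assms(1) by (auto simp: near_one_def)
  have "gmul k g - g = ((fst k - mat 1) ** fst g, (fst k - mat 1) *v snd g + snd k)"
    by (simp add: gmul_def prod_eq_iff matrix_diff_rdistrib matrix_vector_mult_diff_rdistrib)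
  then have "dist g (gmul k g) \<le> norm ((fst k - mat 1) ** fst g) + norm ((fst k - mat 1) *v snd g + snd k)"
    by (metis dist_commute dist_norm norm_Pair_le)
  also have "\<dots> \<le> norm (fst k - mat 1) + (norm (fst k - mat 1) * norm (snd g) + norm (snd k))"
    using norm_orthogonal_mul_right[OF o]
    by (intro add_mono order_trans[OF norm_triangle_ineq]) (auto simp: norm_matrix_vector_le)
  also have "\<dots> \<le> e + (e * norm (snd g) + e)"
    using k by (intro add_mono mult_right_mono) auto
  finally show ?thesis by (simp add: algebra_simps)
qed

text \<open>A motion \<open>g\<close> at distance at most 1 from \<open>a\<close> puts the tile over
  the point \<open>snd g\<close>, inside the ball where \<open>S\<close> and \<open>S'\<close>
  agree, so \<open>gmul k g\<close> competes for the moved tiling. The constant is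
  \<open>2 + (norm (snd a) + 1)\<close>, from \<open>dist_gmul_near\<close>. More distant
  competitors are dealt with by the cap.\<close>

lemma placement_move_le:
  fixes t :: "('n::finite, 'l) tile"
  assumes t: "0 \<in> fst t" and k: "k \<in> SE" "near_one e k" "e \<le> 1"
    and agr: "agree_on_ball (norm (snd a) + 1) S S'"
  shows "placement t a (move (act k) S') \<le> placement t a S + e * (3 + norm (snd a))"
proof -
  have e: "0 < e" using k(2) by (auto simp: near_one_def intro: le_less_trans[OF norm_ge_zero])
  have nn: "0 \<le> e * (3 + norm (snd a))" using e by simp
  have "placement t a (move (act k) S') - e * (3 + norm (snd a)) \<le> placement t a S"
  proof (rule placement_ge)
    show "placement t a (move (act k) S') - e * (3 + norm (snd a)) \<le> 1"
      using placement_le_one[of t a "move (act k) S'"] nn by linarith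
    fix g assume g: "g \<in> SE" "move_tile g t \<in> S"
    show "placement t a (move (act k) S') - e * (3 + norm (snd a)) \<le> dist a g"
    proof (cases "dist a g \<le> 1")
      case True
      have "norm (snd g) \<le> norm (snd a) + dist (snd a) (snd g)"
        using norm_triangle_ineq2[of "snd g" "snd a"] by (simp add: dist_norm norm_minus_commute)
      also have "\<dots> \<le> norm (snd a) + 1"
        using dist_snd_le[of a g] True by linarith
      finally have ng: "norm (snd g) \<le> norm (snd a) + 1" .
      have "act g 0 \<in> fst (move_tile g t) \<inter> cball 0 (norm (snd a) + 1)"
        using imageI[OF t, of "act g"] ng by (simp add: act_def)
      then have "fst (move_tile g t) \<inter> cball 0 (norm (snd a) + 1) \<noteq> {}" by (rule ex_in_conv[THEN iffD1, OF exI])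
      then have "move_tile g t \<in> S'" using agr[unfolded agree_on_ball_iff, rule_format] g(2) by simp
      then have "move_tile (gmul k g) t \<in> move (act k) S'"
        using k(1) by (simp add: move_tile_gmul move_tile_mem_iff)
      then have "placement t a (move (act k) S') \<le> dist a (gmul k g)"
        using k(1) g(1) by (intro placement_le SE_gmul)
      also have "\<dots> \<le> dist a g + dist g (gmul k g)" by (rule dist_triangle)
      also have "dist g (gmul k g) \<le> e * (2 + norm (snd g))" by (rule dist_gmul_near[OF k(2) g(1)])
      also have "\<dots> \<le> e * (3 + norm (snd a))" using ng e by (intro mult_left_mono) auto
      finally show ?thesis by simp
    next
      case False
      then show ?thesis using placement_le_one[of t a "move (act k) S'"] nn by linarith
    qed
  qed
  then show ?thesis by linarith
qed

context hull_transversal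
begin

text \<open>The one-sided estimate is used twice, the second time for the inverse motion with the
  roles of the tilings exchanged.\<close>

lemma continuous_placement:
  assumes t: "t \<in> Q"
  shows "continuous_map Omega euclideanreal (placement t a)"
  unfolding continuous_map_def
proof (intro conjI allI impI)
  show "placement t a \<in> topspace Omega \<rightarrow> topspace euclideanreal" by simp
  fix U :: "real set" assume U: "openin euclideanreal U"
  show "openin Omega {S \<in> topspace Omega. placement t a S \<in> U}"
    unfolding openin_hull_iff topspace_rotational_hull
  proof (intro conjI ballI)
    fix S assume S: "S \<in> {S \<in> Hull. placement t a S \<in> U}"
    then obtain c where c: "0 < c" "ball (placement t a S) c \<subseteq> U"
      using U by (auto simp: open_contains_ball)
    \<comment> \<open>The 4 in place of 3 makes the error strictly smaller than \<open>c\<close>;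
      the second bound leaves a ball of radius \<open>norm (snd a) + 1\<close> after a motion of
      size at most 1.\<close>
    define e where "e = min (c / (4 + norm (snd a))) (1 / (3 + norm (snd a)))"
    have pos: "0 < 4 + norm (snd a)" "0 < 3 + norm (snd a)" by (simp_all add: add_pos_nonneg)
    have e0: "0 < e" using c(1) pos by (simp add: e_def)
    have "1 / (3 + norm (snd a)) \<le> 1"
      using norm_ge_zero[of "snd a"] pos by (simp add: divide_le_eq_1)
    then have e1: "e \<le> 1" by (simp add: e_def min.coboundedI2)
    have "e * (4 + norm (snd a)) \<le> c / (4 + norm (snd a)) * (4 + norm (snd a))"
      using pos by (intro mult_right_mono) (auto simp: e_def)
    also have "\<dots> = c" using pos by simp
    finally have "e + e * (3 + norm (snd a)) \<le> c" by (simp add: algebra_simps)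
    then have ec: "e * (3 + norm (snd a)) < c" using e0 by linarith
    have "1 / (1 / (3 + norm (snd a))) \<le> 1 / e"
      using e0 pos by (intro divide_left_mono) (auto simp: e_def)
    then have eR: "3 + norm (snd a) \<le> 1 / e" by simp
    have "move (act k) S' \<in> {S \<in> Hull. placement t a S \<in> U}"
      if k: "S' \<in> Hull" "k \<in> SE" "near_one e k" "agree_on_ball (1/e) S S'" for S' k
    proof -
      have "agree_on_ball (norm (snd a) + 1) S S'"
        using eR by (intro agree_on_ball_mono[OF k(4)]) simp
      then have 1: "placement t a (move (act k) S') \<le> placement t a S + e * (3 + norm (snd a))"
        by (rule placement_move_le[OF Q_origin[OF t] k(2,3) e1])
      have "norm (snd k) \<le> 1" using k(3) e1 by (simp add: near_one_def)
      then have "agree_on_ball (norm (snd a) + 1) (move (act k) S') (move (act k) S)"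
        using eR by (intro agree_on_ball_move[OF k(2) agree_on_ball_sym[OF k(4)]]) simp
      then have "placement t a (move (act (ginv k)) (move (act k) S)) \<le> placement t a (move (act k) S') + e * (3 + norm (snd a))"
        by (rule placement_move_le[OF Q_origin[OF t] SE_ginv[OF k(2)] near_one_ginv[OF k(3,2)] e1])
      then have 2: "placement t a S \<le> placement t a (move (act k) S') + e * (3 + norm (snd a))"
        by (simp add: move_ginv k(2))
      have "placement t a (move (act k) S') \<in> ball (placement t a S) c"
        using 1 2 ec by (simp add: dist_real_def abs_less_iff)
      then show ?thesis using c(2) k hull_move by blast
    qed
    then show "\<exists>e>0. \<forall>S'\<in>Hull. \<forall>g\<in>SE. near_one e g \<and> agree_on_ball (1/e) S S' \<longrightarrow>
        move (act g) S' \<in> {S \<in> Hull. placement t a S \<in> U}"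
      using e0 by blast
  qed simp
qed

text \<open>Only finitely many tiles of \<open>S\<close> lie near, and each is the image of
  \<open>t\<close> under finitely many motions; so the placements of \<open>t\<close> within
  distance 1 of \<open>h\<close> form a finite set, and \<open>h\<close> is not among them.\<close>

lemma placements_isolated:
  assumes S: "S \<in> Hull" and t: "t \<in> Q" and h: "h \<in> SE" "move_tile h t \<notin> S"
  obtains d where "0 < d" "d \<le> 1" "\<And>g. g \<in> SE \<Longrightarrow> move_tile g t \<in> S \<Longrightarrow> d \<le> dist h g"
proof -
  let ?R = "norm (snd h) + 1"
  let ?G = "{g \<in> SE. dist h g < 1 \<and> move_tile g t \<in> S}"
  have "?G \<subseteq> (\<Union>u\<in>r_patch S ?R 0. {g \<in> SE. act g ` fst t = fst u})"
  proof
    fix g assume g: "g \<in> ?G"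
    have "norm (snd g) \<le> norm (snd h) + dist (snd h) (snd g)"
      using norm_triangle_ineq2[of "snd g" "snd h"] by (simp add: dist_norm norm_minus_commute)
    also have "\<dots> \<le> ?R"
      using dist_snd_le[of h g] g by simp
    finally have "act g 0 \<in> fst (move_tile g t) \<inter> cball 0 ?R"
      using imageI[OF Q_origin[OF t], of "act g"] by (simp add: act_def)
    then have "fst (move_tile g t) \<inter> cball 0 ?R \<noteq> {}" by (rule ex_in_conv[THEN iffD1, OF exI])
    then have "move_tile g t \<in> r_patch S ?R 0" using g by (simp add: r_patch_def)
    then show "g \<in> (\<Union>u\<in>r_patch S ?R 0. {g \<in> SE. act g ` fst t = fst u})"
      using g by (intro UN_I[of "move_tile g t"]) simp_all
  qed
  moreover have "finite (\<Union>u\<in>r_patch S ?R 0. {g \<in> SE. act g ` fst t = fst u})"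
  proof (rule finite_UN_I)
    show "finite (r_patch S ?R 0)" using hull_is_tiling[OF S] by (simp add: is_tiling_def)
    fix u assume "u \<in> r_patch S ?R 0"
    then have "polyhedral_tile (fst u)"
      using hull_is_tiling[OF S] by (simp add: is_tiling_def r_patch_def)
    then show "finite {g \<in> SE. act g ` fst t = fst u}"
      by (rule finite_tile_motions[OF Q_tile[OF t]])
  qed
  ultimately have "finite ?G" by (rule finite_subset)
  then obtain d where d: "0 < d" "\<forall>g\<in>?G. g \<noteq> h \<longrightarrow> d \<le> dist h g"
    using finite_set_avoid[of ?G h] by blast
  show thesis
  proof
    show "0 < min d 1" "min d 1 \<le> 1" using d(1) by auto
    fix g assume g: "g \<in> SE" "move_tile g t \<in> S"
    then have "g \<noteq> h" using h(2) by auto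
    show "min d 1 \<le> dist h g"
    proof (cases "dist h g < 1")
      case True
      then have "d \<le> dist h g" using d(2)[rule_format, of g] g \<open>g \<noteq> h\<close> by simp
      then show ?thesis by simp
    qed simp
  qed
qed

text \<open>If the tile \<open>move_tile h t\<close> belongs to only one of the tilings, a point
  \<open>a\<close> of \<open>D\<close> within \<open>d / 4\<close> of \<open>h\<close> has a value
  below \<open>d / 4\<close> for that tiling and at least \<open>d / 2\<close> for the
  other.\<close>

lemma placements_separate:
  fixes D :: "'n motion set"
  assumes S: "S \<in> Hull" "S' \<in> Hull" "S \<noteq> S'" and D: "\<And>h e. 0 < e \<Longrightarrow> \<exists>a\<in>D. dist a h < e"
  shows "\<exists>t\<in>Q. \<exists>a\<in>D. placement t a S \<noteq> placement t a S'"
proof -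
  have *: "\<exists>t\<in>Q. \<exists>a\<in>D. placement t a S \<noteq> placement t a S'"
    if S: "S \<in> Hull" "S' \<in> Hull" and s: "s \<in> S" "s \<notin> S'" for S S' s
  proof -
    obtain t h where th: "t \<in> Q" "h \<in> SE" "s = move_tile h t" using Q_cover[OF S(1) s(1)] by blast
    obtain d where d: "0 < d" "d \<le> 1" "\<And>g. g \<in> SE \<Longrightarrow> move_tile g t \<in> S' \<Longrightarrow> d \<le> dist h g"
      using placements_isolated[OF S(2) th(1,2)] s(2) th(3) by blast
    obtain a where a: "a \<in> D" "dist a h < d / 4" using D[of "d/4" h] d(1) by auto
    have "placement t a S \<le> dist a h"
      using s(1) th by (intro placement_le) auto
    moreover have "d / 2 \<le> placement t a S'"
    proof (rule placement_ge)
      show "d / 2 \<le> 1" using d by simp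
      show "d / 2 \<le> dist a g" if "g \<in> SE" "move_tile g t \<in> S'" for g
        using d(3)[OF that] a(2) d(1) dist_triangle[of h g a] by (simp add: dist_commute)
    qed
    ultimately have "placement t a S \<noteq> placement t a S'" using a(2) d(1) by linarith
    then show ?thesis using th(1) a(1) by blast
  qed
  from S(3) consider s where "s \<in> S" "s \<notin> S'" | s where "s \<in> S'" "s \<notin> S" by blast
  then show ?thesis
  proof cases
    case 1
    then show ?thesis using *[OF S(1,2)] by blast
  next
    case 2
    then show ?thesis using *[OF S(2,1)] by metis
  qed
qed

lemma metrizable_Omega: "metrizable_space Omega"
proof -
  \<comment> \<open>\<open>D\<close> is dense in the whole linear space; a base point of
    \<open>placement\<close> need not be a rigid motion.\<close>
  obtain D :: "'n motion set" where D: "countable D" "\<And>U. open U \<Longrightarrow> U \<noteq> {} \<Longrightarrow> \<exists>a\<in>D. a \<in> U"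
    using countable_dense_exists by blast
  have D': "\<exists>a\<in>D. dist a h < e" if "0 < e" for h e
    using D(2)[of "ball h e"] that by (auto simp: dist_commute)
  define E where "E = from_nat_into (Q \<times> D)"
  define F where "F S n = placement (fst (E n)) (snd (E n)) S" for S n
  obtain t0 where "t0 \<in> Q" using hull_representation[OF T_in_hull] by blast
  moreover obtain a0 where "a0 \<in> D" using D'[of 1] by (metis zero_less_one)
  ultimately have ne: "Q \<times> D \<noteq> {}" by blast
  have rE: "range E = Q \<times> D"
    unfolding E_def using ne finite_Q D(1) by (intro range_from_nat_into countable_SIGMA) (auto intro: countable_finite)
  then have EQ: "fst (E n) \<in> Q" for n by (metis mem_Times_iff rangeI)
  have cont: "continuous_map Omega euclidean F"
    unfolding euclidean_product_topology[symmetric] continuous_map_componentwise_UNIV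
    using continuous_placement[OF EQ] by (simp add: F_def[abs_def])
  have inj: "inj_on F (topspace Omega)"
  proof (rule inj_onI, rule ccontr)
    fix S S' assume S: "S \<in> topspace Omega" "S' \<in> topspace Omega" and eq: "F S = F S'" and "S \<noteq> S'"
    then obtain t a where ta: "t \<in> Q" "a \<in> D" "placement t a S \<noteq> placement t a S'"
      using placements_separate[of S S' D] D' unfolding topspace_rotational_hull by metis
    then have "(t, a) \<in> range E" using rE by blast
    then obtain n where "E n = (t, a)" by (metis imageE)
    then show False using fun_cong[OF eq, of n] ta(3) by (simp add: F_def)
  qed
  have "homeomorphic_map Omega (top_of_set (F ` topspace Omega)) F"
  proof (rule continuous_imp_homeomorphic_map)
    show "continuous_map Omega (top_of_set (F ` topspace Omega)) F"
      using cont by (simp add: continuous_map_in_subtopology)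
    show "Hausdorff_space (top_of_set (F ` topspace Omega))"
      by (intro Hausdorff_space_subtopology) simp
  qed (use compact_Omega inj in simp_all)
  then show ?thesis
    using homeomorphic_metrizable_space[OF homeomorphic_map_imp_homeomorphic_space]
      metrizable_space_euclidean metrizable_space_subtopology by metis
qed

lemma Hausdorff_Omega: "Hausdorff_space Omega"
  using metrizable_Omega metrizable_imp_Hausdorff_space by blast

end

section \<open>The charts\<close>

context hull_transversal
begin

text \<open>Conjugated by \<open>h\<close>, the motion \<open>k\<close> takes the marked tile
  \<open>t\<close> of \<open>S\<close> to a tile of \<open>S'\<close>, which contains
  \<open>t\<close> as well; being small, it is trivial by
  \<open>tile_rigid_in_tiling\<close>.\<close>

lemma uniform_rigidity:
  obtains d where "0 < d"
    "\<And>k t h S S'. \<lbrakk>k \<in> SE; near_one d k; t \<in> Q; h \<in> SE; 0 \<in> act h ` fst t; S \<in> Xi t; S' \<in> Xi t;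
       move (act k) (move (act h) S) = move (act h) S'\<rbrakk> \<Longrightarrow> k = gone"
proof -
  have ex: "\<exists>d>0. \<forall>k h S S'. k \<in> SE \<and> near_one d k \<and> h \<in> SE \<and> 0 \<in> act h ` fst t \<and> S \<in> Xi t \<and> S' \<in> Xi t \<and>
      move (act k) (move (act h) S) = move (act h) S' \<longrightarrow> k = gone" if t: "t \<in> Q" for t
  proof -
    obtain e where e: "0 < e" "\<And>g S l. \<lbrakk>g \<in> SE; near_one e g; is_tiling S; (fst t, l :: 'l) \<in> S; move_tile g (fst t, l) \<in> S\<rbrakk> \<Longrightarrow> g = gone"
      using tile_rigid_in_tiling[OF Q_tile[OF t]] by blast
    obtain c where c: "\<And>x. x \<in> fst t \<Longrightarrow> norm x \<le> c"
      using compact_imp_bounded[OF polyhedral_tile_compact[OF Q_tile[OF t]]] by (auto simp: bounded_iff)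
    have c0: "0 \<le> c" using c[OF Q_origin[OF t]] by simp
    \<comment> \<open>Dividing by \<open>1 + c\<close> compensates the loss in
      \<open>near_one_conj\<close>: \<open>c\<close> bounds the points of the tile, and hence the
      translation part of \<open>h\<close>, which brings one of them to the origin.\<close>
    have "k = gone" if k: "k \<in> SE" "near_one (e / (1 + c)) k" "h \<in> SE" "0 \<in> act h ` fst t" "S \<in> Xi t" "S' \<in> Xi t"
      "move (act k) (move (act h) S) = move (act h) S'" for k h S S'
    proof -
      let ?g = "gmul (ginv h) (gmul k h)"
      obtain x where x: "x \<in> fst t" "act h x = 0" using k(4) by (metis imageE)
      have "norm (snd h) = norm x"
      proof -
        have "snd h = - (fst h *v x)" using x(2) by (simp add: act_def eq_neg_iff_add_eq_0 add.commute)
        moreover have "orthogonal_matrix (fst h)" using k(3) by (simp add: SE_def rotation_matrix_def)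
        ultimately show ?thesis by (simp add: orthogonal_matrix_norm)
      qed
      then have "norm (snd h) \<le> c" using c[OF x(1)] by simp
      then have "near_one (e / (1 + c) * (1 + c)) ?g"
        by (rule near_one_conj[OF k(2,1,3)])
      then have n: "near_one e ?g" using c0 by simp
      have g: "?g \<in> SE" using k by (intro SE_gmul SE_ginv)
      have "move (act ?g) S = S'"
        by (simp add: move_gmul k(7) move_ginv k(3))
      then have "move_tile ?g t \<in> S'"
        using move_tile_mem_iff[OF g, of t S] Xi_Hull(2)[OF k(5)] by simp
      then have "?g = gone"
        using e(2)[OF g n hull_is_tiling[OF Xi_Hull(1)[OF k(6)]], of "snd t"] Xi_Hull(2)[OF k(6)] by simp
      then have "gmul h (gmul ?g (ginv h)) = gmul h (gmul gone (ginv h))" by simp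
      then show "k = gone"
        by (simp add: gmul_assoc gmul_cancel_left' gmul_ginv_right k(3))
    qed
    then show ?thesis using e(1) c0 by (intro exI[of _ "e / (1 + c)"]) auto
  qed
  then obtain d where d: "\<And>t. t \<in> Q \<Longrightarrow> 0 < d t"
    "\<And>t k h S S'. \<lbrakk>t \<in> Q; k \<in> SE; near_one (d t) k; h \<in> SE; 0 \<in> act h ` fst t; S \<in> Xi t; S' \<in> Xi t;
      move (act k) (move (act h) S) = move (act h) S'\<rbrakk> \<Longrightarrow> k = gone"
    by metis
  show thesis
  proof
    let ?d = "Min (insert 1 (d ` Q))"
    show "0 < ?d" using d(1) finite_Q by simp
    fix k t h S S'
    assume k: "k \<in> SE" "near_one ?d k" "t \<in> Q" "h \<in> SE" "0 \<in> act h ` fst t" "S \<in> Xi t" "S' \<in> Xi t"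
       "move (act k) (move (act h) S) = move (act h) S'"
    have "?d \<le> d t" using k(3) finite_Q by (intro Min_le) auto
    then show "k = gone" using d(2)[OF k(3,1) near_one_mono[OF k(2)] k(4-8)] by blast
  qed
qed

end

text \<open>A tiling \<open>x\<close> is written as the image under \<open>hh x\<close> of \<open>ss x\<close>, which contains the prototile \<open>tt x\<close>;
  outside the hull, \<open>tt\<close> and \<open>hh\<close> have arbitrary admissible values.\<close>

locale hull_charts = hull_transversal T Q X \<sigma>
  for T :: "('n::finite, 'l) tiling" and Q X \<sigma> +
  fixes P :: "real^'m::finite \<Rightarrow> 'n motion" and R :: "'n motion \<Rightarrow> real^'m" and D :: "'n motion set"
    and tt :: "('n, 'l) tiling \<Rightarrow> ('n, 'l) tile" and hh :: "('n, 'l) tiling \<Rightarrow> 'n motion"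
    and ss :: "('n, 'l) tiling \<Rightarrow> ('n, 'l) tiling"
  assumes D_open: "open D" and R_cont: "continuous_on D R" and P_cont: "continuous_on UNIV P"
    and P_SE: "\<And>v. P v \<in> SE" and P_D: "\<And>v. P v \<in> D" and P_0: "P 0 = gone"
    and R_P: "\<And>v. R (P v) = v" and P_R: "\<And>g. g \<in> SE \<Longrightarrow> g \<in> D \<Longrightarrow> P (R g) = g"
    and P_smooth: "\<And>k c. Ck_on k {v. gmul (P v) c \<in> D} (\<lambda>v. R (gmul (P v) c))"
    and rigid: "\<And>v1 v2 v3 v4 t h S S'. \<lbrakk>v1 \<in> cbox (-2) 2; v2 \<in> cbox (-2) 2; v3 \<in> cbox (-2) 2; v4 \<in> cbox (-2) 2;
      t \<in> Q; h \<in> SE; 0 \<in> act h ` fst t; S \<in> Xi t; S' \<in> Xi t;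
      move (act (gmul (ginv (P v1)) (gmul (P v2) (gmul (ginv (P v3)) (P v4))))) (move (act h) S) = move (act h) S'\<rbrakk>
      \<Longrightarrow> gmul (ginv (P v1)) (gmul (P v2) (gmul (ginv (P v3)) (P v4))) = gone"
    and tt: "\<And>x. tt x \<in> Q" and hh: "\<And>x. hh x \<in> SE" and hh_zero: "\<And>x. 0 \<in> act (hh x) ` fst (tt x)"
    and ss: "\<And>x. x \<in> Hull \<Longrightarrow> ss x \<in> Xi (tt x)"
    and hh_ss: "\<And>x. x \<in> Hull \<Longrightarrow> move (act (hh x)) (ss x) = x"

text \<open>Turns \<open>uniform_rigidity\<close> into the form used for charts: four factors from
  the cube, each within \<open>d / 4\<close> of the identity, multiply to a motion within
  \<open>d\<close>.\<close>

lemma (in hull_transversal) hull_charts_exist: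
  assumes "CARD('m::finite) = CARD('n) + CARD('n) * (CARD('n) - 1) div 2"
  shows "\<exists>(P :: real^'m \<Rightarrow> 'n motion) R D tt hh ss. hull_charts T Q X \<sigma> P R D tt hh ss"
proof -
  obtain d where d: "0 < d"
    "\<And>k t h S S'. \<lbrakk>k \<in> SE; near_one d k; t \<in> Q; h \<in> SE; 0 \<in> act h ` fst t; S \<in> Xi t; S' \<in> Xi t;
       move (act k) (move (act h) S) = move (act h) S'\<rbrakk> \<Longrightarrow> k = gone"
    using uniform_rigidity by blast
  have d4: "0 < d / 4" using d(1) by simp
  show ?thesis
  proof (rule motion_chart[OF assms d4])
    fix P :: "real^'m \<Rightarrow> 'n motion" and R D
    assume P: "open D" "continuous_on D R" "continuous_on UNIV P"
      "\<And>v. P v \<in> SE \<inter> D" "P 0 = gone"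
      "\<And>v. R (P v) = v" "\<And>g. g \<in> SE \<inter> D \<Longrightarrow> P (R g) = g"
      "\<And>v. v \<in> cbox (-2) 2 \<Longrightarrow> near_one (d / 4) (P v)"
      "\<And>k c. Ck_on k {v. gmul (P v) c \<in> D} (\<lambda>v. R (gmul (P v) c))"
    have P_SE: "P v \<in> SE" for v using P(4) by blast
    have near: "near_one d (gmul (ginv (P v1)) (gmul (P v2) (gmul (ginv (P v3)) (P v4))))"
      if "v1 \<in> cbox (-2) 2" "v2 \<in> cbox (-2) 2" "v3 \<in> cbox (-2) 2" "v4 \<in> cbox (-2) 2" for v1 v2 v3 v4
    proof -
      have "near_one (d/4 + (d/4 + (d/4 + d/4))) (gmul (ginv (P v1)) (gmul (P v2) (gmul (ginv (P v3)) (P v4))))"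
        using that by (intro near_one_gmul near_one_ginv P(8) P_SE SE_ginv)
      then show ?thesis by simp
    qed
    have "\<exists>t h S0. t \<in> Q \<and> h \<in> SE \<and> 0 \<in> act h ` fst t \<and> (S \<in> Hull \<longrightarrow> S0 \<in> Xi t \<and> move (act h) S0 = S)" for S
    proof (cases "S \<in> Hull")
      case True
      then obtain t h S0 where "t \<in> Q" "h \<in> SE" "S0 \<in> Xi t" "S = move (act h) S0" "0 \<in> act h ` fst t"
        by (rule hull_representation)
      then show ?thesis by (intro exI[of _ t] exI[of _ h] exI[of _ S0]) simp
    next
      \<comment> \<open>Outside the hull the data of \<open>T\<close> serve as default.\<close>
      case False
      obtain t h S0 where "t \<in> Q" "h \<in> SE" "S0 \<in> Xi t" "T = move (act h) S0" "0 \<in> act h ` fst t"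
        by (rule hull_representation[OF T_in_hull])
      then show ?thesis using False by (intro exI[of _ t] exI[of _ h] exI[of _ S0]) simp
    qed
    then obtain tt hh ss where base: "\<And>S. tt S \<in> Q \<and> hh S \<in> SE \<and> 0 \<in> act (hh S) ` fst (tt S) \<and>
        (S \<in> Hull \<longrightarrow> ss S \<in> Xi (tt S) \<and> move (act (hh S)) (ss S) = S)"
      by metis
    have "hull_charts T Q X \<sigma> P R D tt hh ss"
    proof (unfold_locales)
      show "open D" "continuous_on D R" "continuous_on UNIV P" "P 0 = gone" by (rule P)+
      show "P v \<in> SE" "P v \<in> D" "R (P v) = v" for v using P(4,6) by blast+
      show "P (R g) = g" if "g \<in> SE" "g \<in> D" for g using P(7) that by blast
      show "Ck_on k {v. gmul (P v) c \<in> D} (\<lambda>v. R (gmul (P v) c))" for k c by (rule P(9))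
      show "tt S \<in> Q" "hh S \<in> SE" "0 \<in> act (hh S) ` fst (tt S)" for S using base by blast+
      show "ss S \<in> Xi (tt S)" "move (act (hh S)) (ss S) = S" if "S \<in> Hull" for S using base that by blast+
      fix v1 v2 v3 v4 :: "real^'m" and t h S S'
      assume v: "v1 \<in> cbox (-2) 2" "v2 \<in> cbox (-2) 2" "v3 \<in> cbox (-2) 2" "v4 \<in> cbox (-2) 2"
      assume hS: "t \<in> Q" "h \<in> SE" "0 \<in> act h ` fst t" "S \<in> Xi t" "S' \<in> Xi t"
        "move (act (gmul (ginv (P v1)) (gmul (P v2) (gmul (ginv (P v3)) (P v4))))) (move (act h) S) = move (act h) S'"
      then show "gmul (ginv (P v1)) (gmul (P v2) (gmul (ginv (P v3)) (P v4))) = gone"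
        by (intro d(2)[OF _ near[OF v] hS] SE_gmul SE_ginv P_SE)
    qed
    then show ?thesis by blast
  qed
qed

lemma cube_subsets:
  "cbox (-1) 1 \<subseteq> (box (-2) 2 :: (real^'m::finite) set)"
  "box (-1) 1 \<subseteq> (cbox (-1) 1 :: (real^'m) set)"
  "box (-2) 2 \<subseteq> (cbox (-2) 2 :: (real^'m) set)"
proof -
  show "cbox (-1) 1 \<subseteq> (box (-2) 2 :: (real^'m::finite) set)"
  proof
    fix x :: "real^'m" assume "x \<in> cbox (-1) 1"
    then have "-1 \<le> x $ i \<and> x $ i \<le> 1" for i by (simp add: mem_box_cart)
    then have "-2 < x $ i \<and> x $ i < 2" for i by (smt (verit))
    then show "x \<in> box (-2) 2" by (simp add: mem_box_cart)
  qed
qed (rule box_subset_cbox)+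

lemma cube_zero: "(0 :: real^'m::finite) \<in> box (-1) 1"
  by (simp add: mem_box_cart)

context hull_charts
begin

section \<open>Chart coordinates of tilings and their rigidity\<close>

definition place :: "('n, 'l) tiling \<Rightarrow> real^'m \<Rightarrow> ('n, 'l) tiling \<Rightarrow> ('n, 'l) tiling" where
  "place x v S = move (act (gmul (P v) (hh x))) S"

lemma place_alt: "place x v S = move (act (P v)) (move (act (hh x)) S)"
  by (simp add: place_def move_gmul)

text \<open>After \<open>P v\<close> is cancelled, both sides describe the same tiling, and
  \<open>P w\<close> applies to it; \<open>P_R\<close> then expresses the resulting motion in the
  coordinates of the chart at \<open>y\<close>.\<close>

lemma place_transition:
  assumes "place x v S = place y v' S'" "gmul (P w) (gmul (ginv (P v)) (P v')) \<in> D"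
  shows "place x w S = place y (R (gmul (P w) (gmul (ginv (P v)) (P v')))) S'"
proof -
  let ?g = "gmul (P w) (gmul (ginv (P v)) (P v'))"
  have g: "?g \<in> SE" by (intro SE_gmul SE_ginv P_SE)
  have "move (act (P w)) (move (act (ginv (P v))) (place x v S)) = move (act (P w)) (move (act (ginv (P v))) (place y v' S'))"
    using assms(1) by simp
  then have "place x w S = move (act ?g) (move (act (hh y)) S')"
    by (simp add: place_alt move_gmul move_ginv P_SE)
  then show ?thesis by (simp add: place_alt P_R[OF g assms(2)])
qed

text \<open>Two coincidences of plaques differ by a small motion that maps a tiling with a marked tile near
  the origin to another such tiling; so the motion is trivial.\<close>

lemma place_rigid:
  assumes "place x v S = place y v' S'" "place x w S = place y w' S''"
    and cube: "v \<in> box (-2) 2" "v' \<in> box (-2) 2" "w \<in> box (-2) 2" "w' \<in> box (-2) 2"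
    and S: "S' \<in> Xi (tt y)" "S'' \<in> Xi (tt y)"
  shows "S' = S''" "gmul (P w) (gmul (ginv (P v)) (P v')) = P w'"
proof -
  \<comment> \<open>The motion leads from \<open>S'\<close> in the chart at \<open>y\<close> through
    the first coincidence to the chart at \<open>x\<close>, and through the second one back to
    \<open>y\<close>.\<close>
  let ?k = "gmul (ginv (P w')) (gmul (P w) (gmul (ginv (P v)) (P v')))"
  have "move (act ?k) (move (act (hh y)) S') =
      move (act (ginv (P w'))) (move (act (P w)) (move (act (ginv (P v))) (place y v' S')))"
    by (simp add: place_alt move_gmul)
  also have "move (act (ginv (P v))) (place y v' S') = move (act (hh x)) S"
    unfolding assms(1)[symmetric] by (simp add: place_alt move_ginv P_SE)
  also have "move (act (P w)) (move (act (hh x)) S) = place x w S"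
    by (simp only: place_alt)
  also have "place x w S = place y w' S''"
    by (rule assms(2))
  also have "move (act (ginv (P w'))) (place y w' S'') = move (act (hh y)) S''"
    by (simp add: place_alt move_ginv P_SE)
  finally have k: "move (act ?k) (move (act (hh y)) S') = move (act (hh y)) S''" .
  have "?k = gone"
    by (rule rigid[OF _ _ _ _ tt hh hh_zero S k]) (use cube cube_subsets(3) in blast)+
  then have "move (act (ginv (hh y))) (move (act (hh y)) S') = move (act (ginv (hh y))) (move (act (hh y)) S'')"
    using k by (simp del: act_gone_fun)
  then show "S' = S''" by (simp add: move_ginv hh)
  have "gmul (P w') ?k = P w'" using \<open>?k = gone\<close> by simp
  then show "gmul (P w) (gmul (ginv (P v)) (P v')) = P w'"
    by (simp add: gmul_cancel_left' P_SE)
qed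

text \<open>The coincidence is compared with the trivial one of \<open>place x v S\<close> with
  itself.\<close>

lemma place_inj:
  assumes "place x v S = place x w S'" "v \<in> box (-2) 2" "w \<in> box (-2) 2" "S \<in> Xi (tt x)" "S' \<in> Xi (tt x)"
  shows "v = w" "S = S'"
proof -
  show "S = S'" using place_rigid(1)[OF refl assms(1) assms(2) assms(2) assms(2,3,4,5)] .
  have "gmul (P v) (gmul (ginv (P v)) (P v)) = P w"
    using place_rigid(2)[OF refl assms(1) assms(2) assms(2) assms(2,3,4,5)] .
  then have "P v = P w" by (simp add: gmul_ginv_left P_SE)
  then show "v = w" using R_P by metis
qed

definition chart_map :: "('n, 'l) tiling \<Rightarrow> (real^'m) \<times> real \<Rightarrow> ('n, 'l) tiling" where
  "chart_map x = (\<lambda>(v, r). place x v (\<tau> r))"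

text \<open>The inverse is taken over the larger open cube, so that one map serves as the chart and
  as its extension.\<close>

definition phi :: "('n, 'l) tiling \<Rightarrow> ('n, 'l) tiling \<Rightarrow> (real^'m) \<times> real" where
  "phi x = inv_into (box (-2) 2 \<times> transversal (tt x)) (chart_map x)"

definition chart_dom :: "('n, 'l) tiling \<Rightarrow> ('n, 'l) tiling set" where
  "chart_dom x = chart_map x ` (box (-1) 1 \<times> transversal (tt x))"

lemma Xi_Y: "S \<in> Xi (tt x) \<Longrightarrow> S \<in> Y"
  by (rule subsetD[OF Xi_subset_Y[OF tt]])

lemma chart_map_image: "chart_map x ` (B \<times> transversal (tt x)) = {place x v S | v S. v \<in> B \<and> S \<in> Xi (tt x)}"
proof -
  have "chart_map x (v, \<sigma> S) = place x v S" if "S \<in> Xi (tt x)" for v S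
    using Xi_Y[OF that] by (simp add: chart_map_def)
  then show ?thesis
    unfolding transversal_def by (auto simp: image_iff) (metis (no_types, opaque_lifting) image_eqI mem_Sigma_iff)
qed

lemma chart_map_inj: "inj_on (chart_map x) (box (-2) 2 \<times> transversal (tt x))"
proof (rule inj_onI)
  fix p q assume p: "p \<in> box (-2) 2 \<times> transversal (tt x)" and q: "q \<in> box (-2) 2 \<times> transversal (tt x)"
    and eq: "chart_map x p = chart_map x q"
  obtain v S where vS: "p = (v, \<sigma> S)" "v \<in> box (-2) 2" "S \<in> Xi (tt x)" using p by (auto simp: transversal_def)
  obtain w S' where wS: "q = (w, \<sigma> S')" "w \<in> box (-2) 2" "S' \<in> Xi (tt x)" using q by (auto simp: transversal_def)
  have "place x v S = place x w S'"
    using eq vS wS Xi_Y by (simp add: chart_map_def)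
  then show "p = q" using place_inj[OF _ vS(2) wS(2) vS(3) wS(3)] vS(1) wS(1) by simp
qed

lemma phi_place:
  assumes "v \<in> box (-2) 2" "S \<in> Xi (tt x)"
  shows "phi x (place x v S) = (v, \<sigma> S)"
proof -
  have "place x v S = chart_map x (v, \<sigma> S)"
    using Xi_Y[OF assms(2)] by (simp add: chart_map_def)
  then show ?thesis
    unfolding phi_def using inv_into_f_f[OF chart_map_inj] assms by (simp add: transversal_def)
qed

text \<open>The image is cut out of \<open>SE\<close> by the preimage of \<open>U\<close> under
  \<open>R\<close>, which is continuous on the open set \<open>D\<close> of the ambient space; no
  invariance of domain enters.\<close>

lemma open_motion_image:
  assumes "open U"
  shows "openin (top_of_set SE) ((\<lambda>v. gmul (P v) (hh x)) ` U)"
proof -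
  have "open (D \<inter> R -` U)"
    by (rule continuous_open_preimage[OF R_cont D_open assms])
  then have "open ((\<lambda>g. gmul g (ginv (hh x))) -` (D \<inter> R -` U))"
    by (intro open_vimage continuous_on_gmul continuous_intros)
  moreover have "(\<lambda>v. gmul (P v) (hh x)) ` U = SE \<inter> (\<lambda>g. gmul g (ginv (hh x))) -` (D \<inter> R -` U)"
  proof
    show "(\<lambda>v. gmul (P v) (hh x)) ` U \<subseteq> SE \<inter> (\<lambda>g. gmul g (ginv (hh x))) -` (D \<inter> R -` U)"
      using hh P_SE P_D R_P by (auto simp: gmul_assoc gmul_ginv_right SE_gmul)
    show "SE \<inter> (\<lambda>g. gmul g (ginv (hh x))) -` (D \<inter> R -` U) \<subseteq> (\<lambda>v. gmul (P v) (hh x)) ` U"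
    proof
      fix g assume g: "g \<in> SE \<inter> (\<lambda>g. gmul g (ginv (hh x))) -` (D \<inter> R -` U)"
      then have "P (R (gmul g (ginv (hh x)))) = gmul g (ginv (hh x))"
        by (intro P_R SE_gmul SE_ginv hh) auto
      then have "g = gmul (P (R (gmul g (ginv (hh x))))) (hh x)"
        by (simp add: gmul_assoc gmul_ginv_left hh)
      then show "g \<in> (\<lambda>v. gmul (P v) (hh x)) ` U" using g by blast
    qed
  qed
  ultimately show ?thesis by (auto simp: openin_open)
qed

lemma chart_map_alt: "chart_map x = (\<lambda>(g, r). move (act g) (\<tau> r)) \<circ> (\<lambda>(v, r). (gmul (P v) (hh x), r))"
  by (auto simp: chart_map_def place_def)

lemma continuous_chart_map:
  "continuous_map (prod_topology (top_of_set B) (subtopology X (transversal (tt x)))) Omega (chart_map x)"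
  unfolding chart_map_alt
proof (rule continuous_map_compose[OF _ continuous_action])
  let ?Z = "prod_topology (top_of_set B) (subtopology X (transversal (tt x)))"
  have "continuous_map (top_of_set B) (top_of_set SE) (\<lambda>v. gmul (P v) (hh x))"
    using continuous_on_subset[OF P_cont subset_UNIV]
    by (simp add: continuous_map_in_subtopology continuous_on_gmul image_subset_iff SE_gmul P_SE hh)
  then have 1: "continuous_map ?Z (top_of_set SE) ((\<lambda>v. gmul (P v) (hh x)) \<circ> fst)"
    by (rule continuous_map_compose[OF continuous_map_fst])
  have 2: "continuous_map ?Z X snd"
    by (rule continuous_map_into_fulltopology[OF continuous_map_snd])
  show "continuous_map ?Z (prod_topology (top_of_set SE) X) (\<lambda>(v, r). (gmul (P v) (hh x), r))"
    using 1 2 by (simp add: continuous_map_pairwise comp_def case_prod_beta)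
qed

lemma open_chart_map:
  assumes "open B"
  shows "open_map (prod_topology (top_of_set B) (subtopology X (transversal (tt x)))) Omega (chart_map x)"
  unfolding chart_map_alt
proof (rule open_map_compose[OF _ open_action[OF tt]])
  let ?f = "\<lambda>(v, r). (gmul (P v) (hh x), r :: real)"
  show "open_map (prod_topology (top_of_set B) (subtopology X (transversal (tt x))))
     (prod_topology (top_of_set SE) (subtopology X (transversal (tt x)))) ?f"
    unfolding open_map_def
  proof (intro allI impI)
    fix W :: "((real^'m) \<times> real) set"
    assume W: "openin (prod_topology (top_of_set B) (subtopology X (transversal (tt x)))) W"
    show "openin (prod_topology (top_of_set SE) (subtopology X (transversal (tt x)))) (?f ` W)"
      unfolding openin_prod_topology_alt
    proof (intro allI impI)
      fix g r assume "(g, r) \<in> ?f ` W"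
      then obtain v where v: "(v, r) \<in> W" "g = gmul (P v) (hh x)" by auto
      from W[unfolded openin_prod_topology_alt, rule_format, OF v(1)]
      obtain U V where UV: "openin (top_of_set B) U" "openin (subtopology X (transversal (tt x))) V" "v \<in> U" "r \<in> V" "U \<times> V \<subseteq> W"
        by (elim exE conjE)
      have "open U" using UV(1) assms by (simp add: openin_open_eq)
      then have "openin (top_of_set SE) ((\<lambda>v. gmul (P v) (hh x)) ` U)" by (rule open_motion_image)
      moreover have "(\<lambda>v. gmul (P v) (hh x)) ` U \<times> V \<subseteq> ?f ` W" using UV(5) by force
      ultimately show "\<exists>U V. openin (top_of_set SE) U \<and> openin (subtopology X (transversal (tt x))) V \<and>
          g \<in> U \<and> r \<in> V \<and> U \<times> V \<subseteq> ?f ` W"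
        using UV(2,3,4) v(2) by (intro exI[of _ "(\<lambda>v. gmul (P v) (hh x)) ` U"] exI[of _ V]) simp
    qed
  qed
qed

lemma topspace_transversal [simp]: "topspace X \<inter> transversal (tt x) = transversal (tt x)"
  using openin_subset[OF openin_transversal[OF tt]] by (rule inf.absorb2)

lemma openin_chart_image:
  assumes "open B"
  shows "openin Omega (chart_map x ` (B \<times> transversal (tt x)))"
proof -
  have "openin (prod_topology (top_of_set B) (subtopology X (transversal (tt x)))) (B \<times> transversal (tt x))"
    using openin_topspace[of "prod_topology (top_of_set B) (subtopology X (transversal (tt x)))"] by simp
  then show ?thesis using open_chart_map[OF assms] unfolding open_map_def by blast
qed

lemma phi_chart_map: "p \<in> box (-2) 2 \<times> transversal (tt x) \<Longrightarrow> phi x (chart_map x p) = p"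
  unfolding phi_def by (rule inv_into_f_f[OF chart_map_inj])

text \<open>Openness of \<open>chart_map\<close> is available for open cubes only, so the
  homeomorphism is established on the largest one and then restricted to \<open>B\<close>, which may
  be closed.\<close>

lemma homeomorphic_maps_phi:
  assumes B: "B \<subseteq> box (-2) 2"
  shows "homeomorphic_maps (prod_topology (top_of_set B) (subtopology X (transversal (tt x))))
    (subtopology Omega (chart_map x ` (B \<times> transversal (tt x)))) (chart_map x) (phi x)"
proof -
  let ?C = "box (-2) 2 :: (real^'m) set"
  let ?Z = "prod_topology (top_of_set ?C) (subtopology X (transversal (tt x)))"
  let ?I = "chart_map x ` (?C \<times> transversal (tt x))"
  let ?W = "subtopology Omega ?I"
  have tZ: "topspace ?Z = ?C \<times> transversal (tt x)" by simp
  have tI: "topspace ?W = ?I"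
    using openin_subset[OF openin_chart_image[OF open_box, of x "-2" 2]] by (simp add: inf.absorb2)
  have cont: "continuous_map ?Z ?W (chart_map x)"
    unfolding continuous_map_in_subtopology by (intro conjI continuous_chart_map) (simp add: tZ)
  have op: "open_map ?Z ?W (chart_map x)"
    by (rule open_map_into_subtopology[OF open_chart_map[OF open_box]]) (simp add: tZ)
  have 1: "chart_map x p \<in> topspace ?W \<and> phi x (chart_map x p) = p" if "p \<in> topspace ?Z" for p
    using that phi_chart_map[of p x] unfolding tI tZ by blast
  have 2: "phi x z \<in> topspace ?Z \<and> chart_map x (phi x z) = z" if z: "z \<in> topspace ?W" for z
  proof -
    obtain p where "z = chart_map x p" "p \<in> ?C \<times> transversal (tt x)" using z[unfolded tI] by (rule imageE)
    then show ?thesis using phi_chart_map[of p x] by (simp only: tZ)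
  qed
  have "continuous_map ?W ?Z (phi x)"
    using open_eq_continuous_inverse_map[OF 1 2] op by blast
  then have h: "homeomorphic_maps ?Z ?W (chart_map x) (phi x)"
    unfolding homeomorphic_maps_def using cont 1 2 by simp
  have sub: "B \<times> transversal (tt x) \<subseteq> ?C \<times> transversal (tt x)" using B by blast
  then have subI: "chart_map x ` (B \<times> transversal (tt x)) \<subseteq> ?I" by (rule image_mono)
  have "homeomorphic_maps (subtopology ?Z (B \<times> transversal (tt x))) (subtopology ?W (chart_map x ` (B \<times> transversal (tt x))))
     (chart_map x) (phi x)"
    by (rule homeomorphic_maps_subtopologies[OF h])
       (simp only: tZ tI inf.absorb2[OF sub] inf.absorb2[OF subI])
  moreover have "subtopology ?Z (B \<times> transversal (tt x)) = prod_topology (top_of_set B) (subtopology X (transversal (tt x)))"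
    unfolding subtopology_Times subtopology_subtopology by (simp add: inf.absorb2[OF B])
  moreover have "subtopology ?W (chart_map x ` (B \<times> transversal (tt x))) = subtopology Omega (chart_map x ` (B \<times> transversal (tt x)))"
    unfolding subtopology_subtopology by (simp only: inf.absorb2[OF subI])
  ultimately show ?thesis by simp
qed

lemma homeomorphic_phi:
  "B \<subseteq> box (-2) 2 \<Longrightarrow> homeomorphic_map (subtopology Omega (chart_map x ` (B \<times> transversal (tt x))))
    (prod_topology (top_of_set B) (subtopology X (transversal (tt x)))) (phi x)"
  using homeomorphic_maps_phi homeomorphic_maps_map by blast

text \<open>The chart map is continuous on the whole linear space, also where it need not be
  injective; so the image of the closed cube is compact, and closed because the hull is Hausdorff.
  The reverse inclusion is continuity.\<close>

lemma closure_chart_dom: "Omega closure_of chart_dom x = chart_map x ` (cbox (-1) 1 \<times> transversal (tt x))"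
proof
  have c: "continuous_map (prod_topology (top_of_set UNIV) (subtopology X (transversal (tt x)))) Omega (chart_map x)"
    by (rule continuous_chart_map)
  have "compactin (prod_topology (top_of_set UNIV) (subtopology X (transversal (tt x)))) (cbox (-1) 1 \<times> transversal (tt x))"
    using compactin_transversal[OF tt] by (simp add: compactin_Times compactin_subtopology)
  then have "compactin Omega (chart_map x ` (cbox (-1) 1 \<times> transversal (tt x)))"
    using c by (rule image_compactin)
  then have "closedin Omega (chart_map x ` (cbox (-1) 1 \<times> transversal (tt x)))"
    by (rule compactin_imp_closedin[OF Hausdorff_Omega])
  then show "Omega closure_of chart_dom x \<subseteq> chart_map x ` (cbox (-1) 1 \<times> transversal (tt x))"
    unfolding chart_dom_def
    by (intro closure_of_minimal image_mono) (use cube_subsets(2) in blast)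
  have "closure (box (-1) (1::real^'m)) = cbox (-1) 1"
    by (rule closure_box) (use cube_zero in blast)
  then have "cbox (-1) (1::real^'m) \<times> transversal (tt x) =
      prod_topology (top_of_set UNIV) (subtopology X (transversal (tt x))) closure_of (box (-1) 1 \<times> transversal (tt x))"
    using closure_of_topspace[of "subtopology X (transversal (tt x))"] by (simp add: closure_of_Times)
  then show "chart_map x ` (cbox (-1) 1 \<times> transversal (tt x)) \<subseteq> Omega closure_of chart_dom x"
    unfolding chart_dom_def using continuous_map_image_closure_subset[OF c] by simp
qed

lemma matchbox_chart_phi:
  assumes x: "x \<in> Hull"
  shows "matchbox_chart Omega X x (chart_dom x) (transversal (tt x)) (phi x)"
  unfolding matchbox_chart_def closure_chart_dom
proof (intro conjI)
  have ssx: "ss x \<in> Xi (tt x)" by (rule ss[OF x])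
  have x0: "x = place x 0 (ss x)" by (simp add: place_def P_0 hh_ss x)
  have z2: "(0 :: real^'m) \<in> box (-2) 2" using cube_zero cube_subsets by blast
  show "compactin X (transversal (tt x))" by (rule compactin_transversal[OF tt])
  show "openin Omega (chart_dom x)" unfolding chart_dom_def by (rule openin_chart_image[OF open_box])
  show "x \<in> chart_dom x"
    unfolding chart_dom_def chart_map_image using x0 ssx cube_zero by blast
  show "homeomorphic_map (subtopology Omega (chart_map x ` (cbox (-1) 1 \<times> transversal (tt x))))
     (prod_topology (top_of_set (cbox (-1) 1)) (subtopology X (transversal (tt x)))) (phi x)"
    by (rule homeomorphic_phi[OF cube_subsets(1)])
  have "phi x x = (0, \<sigma> (ss x))"
    using phi_place[OF z2 ssx] x0 by simp
  moreover have "\<sigma> (ss x) \<in> X interior_of transversal (tt x)"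
    using ssx interior_of_openin[OF openin_transversal[OF tt]] by (simp add: transversal_def)
  ultimately show "\<exists>w\<in>X interior_of transversal (tt x). phi x x = (0, w)" by blast
  show "\<exists>U' \<phi>'. openin Omega U' \<and> chart_map x ` (cbox (-1) 1 \<times> transversal (tt x)) \<subseteq> U' \<and>
        homeomorphic_map (subtopology Omega U')
         (prod_topology (top_of_set (box (-2) 2)) (subtopology X (transversal (tt x)))) \<phi>' \<and>
        (\<forall>z\<in>chart_map x ` (cbox (-1) 1 \<times> transversal (tt x)). \<phi>' z = phi x z)"
  proof (intro exI conjI ballI)
    show "openin Omega (chart_map x ` (box (-2) 2 \<times> transversal (tt x)))" by (rule openin_chart_image[OF open_box])
    show "chart_map x ` (cbox (-1) 1 \<times> transversal (tt x)) \<subseteq> chart_map x ` (box (-2) 2 \<times> transversal (tt x))"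
      by (intro image_mono) (use cube_subsets(1) in blast)
    show "homeomorphic_map (subtopology Omega (chart_map x ` (box (-2) 2 \<times> transversal (tt x))))
         (prod_topology (top_of_set (box (-2) 2)) (subtopology X (transversal (tt x)))) (phi x)"
      by (rule homeomorphic_phi) simp
  qed simp
qed

section \<open>Compatibility of the charts\<close>

lemma mem_closure_chart_dom:
  "z \<in> Omega closure_of chart_dom x \<longleftrightarrow> (\<exists>v\<in>cbox (-1) 1. \<exists>S\<in>Xi (tt x). z = place x v S)"
  unfolding closure_chart_dom chart_map_image by blast

lemma phi_place_cbox: "v \<in> cbox (-1) 1 \<Longrightarrow> S \<in> Xi (tt x) \<Longrightarrow> phi x (place x v S) = (v, \<sigma> S)"
  using phi_place cube_subsets(1) by blast

lemma sigma_eq_iff: "S \<in> Xi (tt x) \<Longrightarrow> S' \<in> Xi (tt x) \<Longrightarrow> \<sigma> S = \<sigma> S' \<longleftrightarrow> S = S'"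
  by (metis Xi_Y tau_sigma)

lemma plaque_place:
  assumes "v \<in> cbox (-1) 1" "S \<in> Xi (tt x)"
  shows "plaque Omega chart_dom phi x (place x v S) = (\<lambda>w. place x w S) ` cbox (-1) 1"
proof -
  have "q \<in> plaque Omega chart_dom phi x (place x v S) \<longleftrightarrow> q \<in> (\<lambda>w. place x w S) ` cbox (-1) 1" for q
  proof
    assume q: "q \<in> plaque Omega chart_dom phi x (place x v S)"
    then obtain w S' where w: "w \<in> cbox (-1) 1" "S' \<in> Xi (tt x)" "q = place x w S'"
      unfolding plaque_def mem_Collect_eq mem_closure_chart_dom by blast
    then have "\<sigma> S' = \<sigma> S" using q assms by (simp add: plaque_def phi_place_cbox)
    then have "S' = S" using sigma_eq_iff w(2) assms(2) by blast
    then show "q \<in> (\<lambda>w. place x w S) ` cbox (-1) 1" using w by blast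
  next
    assume "q \<in> (\<lambda>w. place x w S) ` cbox (-1) 1"
    then obtain w where w: "w \<in> cbox (-1) 1" "q = place x w S" by blast
    then show "q \<in> plaque Omega chart_dom phi x (place x v S)"
      using assms unfolding plaque_def mem_Collect_eq mem_closure_chart_dom by (auto simp: phi_place_cbox)
  qed
  then show ?thesis by blast
qed

lemma plaque_interior_place:
  assumes "v \<in> cbox (-1) 1" "S \<in> Xi (tt x)"
  shows "plaque_interior Omega chart_dom phi x (place x v S) = (\<lambda>w. place x w S) ` box (-1) 1"
  unfolding plaque_interior_def plaque_place[OF assms]
  using cube_subsets(2) by (auto simp: phi_place_cbox assms(2))

text \<open>The set is the trace on the plaque of the open chart box over \<open>B\<close>: by
  \<open>place_inj\<close>, a point of the plaque lies over no transversal tiling other than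
  \<open>S\<close>.\<close>

lemma openin_plaque:
  assumes "open B" "B \<subseteq> box (-1) 1" "S \<in> Xi (tt x)"
  shows "openin (subtopology Omega ((\<lambda>w. place x w S) ` cbox (-1) 1)) ((\<lambda>w. place x w S) ` B)"
proof -
  have "(\<lambda>w. place x w S) ` B = chart_map x ` (B \<times> transversal (tt x)) \<inter> (\<lambda>w. place x w S) ` cbox (-1) 1"
  proof
    show "(\<lambda>w. place x w S) ` B \<subseteq> chart_map x ` (B \<times> transversal (tt x)) \<inter> (\<lambda>w. place x w S) ` cbox (-1) 1"
      unfolding chart_map_image using assms(2,3) cube_subsets(2) by blast
    show "chart_map x ` (B \<times> transversal (tt x)) \<inter> (\<lambda>w. place x w S) ` cbox (-1) 1 \<subseteq> (\<lambda>w. place x w S) ` B"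
    proof
      fix q assume "q \<in> chart_map x ` (B \<times> transversal (tt x)) \<inter> (\<lambda>w. place x w S) ` cbox (-1) 1"
      then obtain v S' w where q: "q = place x v S'" "v \<in> B" "S' \<in> Xi (tt x)" "q = place x w S" "w \<in> cbox (-1) 1"
        unfolding chart_map_image by blast
      have "v \<in> box (-2) 2" "w \<in> box (-2) 2" using q assms(2) cube_subsets by blast+
      then have "S' = S" using place_inj(2)[of x v S' w S] q assms(3) by simp
      then show "q \<in> (\<lambda>w. place x w S) ` B" using q by blast
    qed
  qed
  then show ?thesis
    using openin_chart_image[OF assms(1), of x] by (auto simp: openin_subtopology)
qed

text \<open>Along a plaque, a change of charts is the right multiplication by some \<open>c\<close> in the group.\<close>

definition pull :: "'n motion \<Rightarrow> (real^'m) set \<Rightarrow> (real^'m) set" where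
  "pull c B = {w. gmul (P w) c \<in> D \<and> R (gmul (P w) c) \<in> B}"

lemma open_pull: "open B \<Longrightarrow> open (pull c B)"
proof -
  assume "open B"
  then have "open (D \<inter> R -` B)"
    by (rule continuous_open_preimage[OF R_cont D_open])
  then have "open ((\<lambda>w. gmul (P w) c) -` (D \<inter> R -` B))"
    by (intro open_vimage continuous_on_gmul P_cont continuous_on_const)
  moreover have "pull c B = (\<lambda>w. gmul (P w) c) -` (D \<inter> R -` B)" by (auto simp: pull_def)
  ultimately show ?thesis by simp
qed

text \<open>One coincidence fixes the matching: any further common point satisfies
  \<open>P w' = gmul (P w) c\<close> by \<open>place_rigid\<close>, and conversely
  \<open>place_transition\<close> makes every such \<open>w\<close> a common point. For open
  \<open>B\<close> this is an open condition on \<open>w\<close>.\<close>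

lemma plaque_interior_Int:
  assumes e: "place x v S = place y v' S'" and v: "v \<in> box (-1) 1" "v' \<in> box (-1) 1"
    and S: "S \<in> Xi (tt x)" "S' \<in> Xi (tt y)" and B: "B \<subseteq> box (-1) 1"
  shows "(\<lambda>w. place x w S) ` box (-1) 1 \<inter> (\<lambda>w. place y w S') ` B =
    (\<lambda>w. place x w S) ` (box (-1) 1 \<inter> pull (gmul (ginv (P v)) (P v')) B)"
proof -
  let ?c = "gmul (ginv (P v)) (P v')"
  have c2: "w \<in> box (-2) 2" if "w \<in> box (-1) 1" for w :: "real^'m"
    using that cube_subsets by blast
  have "q \<in> (\<lambda>w. place x w S) ` box (-1) 1 \<inter> (\<lambda>w. place y w S') ` B \<longleftrightarrow>
    q \<in> (\<lambda>w. place x w S) ` (box (-1) 1 \<inter> pull ?c B)" for q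
  proof
    assume "q \<in> (\<lambda>w. place x w S) ` box (-1) 1 \<inter> (\<lambda>w. place y w S') ` B"
    then obtain w w' where w: "w \<in> box (-1) 1" "q = place x w S" "w' \<in> B" "q = place y w' S'" by blast
    have "gmul (P w) ?c = P w'"
      by (rule place_rigid(2)[OF e _ _ _ _ _ S(2) S(2)]) (use w v B c2 in auto)
    then have "w \<in> pull ?c B" using w(3) by (simp add: pull_def P_D R_P)
    then show "q \<in> (\<lambda>w. place x w S) ` (box (-1) 1 \<inter> pull ?c B)" using w by blast
  next
    assume "q \<in> (\<lambda>w. place x w S) ` (box (-1) 1 \<inter> pull ?c B)"
    then obtain w where w: "w \<in> box (-1) 1" "gmul (P w) ?c \<in> D" "R (gmul (P w) ?c) \<in> B" "q = place x w S"
      by (auto simp: pull_def)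
    have "q = place y (R (gmul (P w) ?c)) S'"
      using place_transition[OF e w(2)] w(4) by simp
    then show "q \<in> (\<lambda>w. place x w S) ` box (-1) 1 \<inter> (\<lambda>w. place y w S') ` B" using w by blast
  qed
  then show ?thesis by blast
qed

lemma openin_plaque_interior_Int:
  assumes z: "z \<in> Omega closure_of chart_dom x" "z' \<in> Omega closure_of chart_dom y"
  shows "openin (plaque_topology Omega chart_dom phi x z)
    (plaque_interior Omega chart_dom phi x z \<inter> plaque_interior Omega chart_dom phi y z')"
proof -
  obtain v0 S where S: "v0 \<in> cbox (-1) 1" "S \<in> Xi (tt x)" "z = place x v0 S"
    using z(1) unfolding mem_closure_chart_dom by blast
  obtain v0' S' where S': "v0' \<in> cbox (-1) 1" "S' \<in> Xi (tt y)" "z' = place y v0' S'"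
    using z(2) unfolding mem_closure_chart_dom by blast
  have eqs: "plaque Omega chart_dom phi x z = (\<lambda>w. place x w S) ` cbox (-1) 1"
    "plaque_interior Omega chart_dom phi x z = (\<lambda>w. place x w S) ` box (-1) 1"
    "plaque_interior Omega chart_dom phi y z' = (\<lambda>w. place y w S') ` box (-1) 1"
    by (simp_all only: S(3) S'(3) plaque_place[OF S(1,2)] plaque_interior_place[OF S(1,2)] plaque_interior_place[OF S'(1,2)])
  show ?thesis
  proof (cases "(\<lambda>w. place x w S) ` box (-1) 1 \<inter> (\<lambda>w. place y w S') ` box (-1) 1 = {}")
    case False
    then obtain v v' where v: "v \<in> box (-1) 1" "v' \<in> box (-1) 1" "place x v S = place y v' S'" by blast
    have "open (box (-1) 1 \<inter> pull (gmul (ginv (P v)) (P v')) (box (-1) 1))"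
      by (intro open_Int open_box open_pull)
    then show ?thesis
      unfolding eqs plaque_interior_Int[OF v(3,1,2) S(2) S'(2) order_refl]
      by (rule openin_plaque[OF _ inf_le1 S(2)])
  qed (simp add: eqs)
qed

text \<open>Both intersections are coincidences with the same tiling \<open>S\<close> on the side of
  \<open>x\<close>, so \<open>place_rigid\<close> identifies the tilings \<open>S'\<close> and
  \<open>S''\<close> that label the two plaques of \<open>y\<close>.\<close>

lemma plaques_meet_unique:
  assumes z: "z \<in> Omega closure_of chart_dom x" "z' \<in> Omega closure_of chart_dom y" "z'' \<in> Omega closure_of chart_dom y"
    and ne: "plaque Omega chart_dom phi x z \<inter> plaque Omega chart_dom phi y z' \<noteq> {}"
      "plaque Omega chart_dom phi x z \<inter> plaque Omega chart_dom phi y z'' \<noteq> {}"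
  shows "plaque Omega chart_dom phi y z' = plaque Omega chart_dom phi y z''"
proof -
  obtain v0 S where S: "v0 \<in> cbox (-1) 1" "S \<in> Xi (tt x)" "z = place x v0 S"
    using z(1) unfolding mem_closure_chart_dom by blast
  obtain v1 S' where S': "v1 \<in> cbox (-1) 1" "S' \<in> Xi (tt y)" "z' = place y v1 S'"
    using z(2) unfolding mem_closure_chart_dom by blast
  obtain v2 S'' where S'': "v2 \<in> cbox (-1) 1" "S'' \<in> Xi (tt y)" "z'' = place y v2 S''"
    using z(3) unfolding mem_closure_chart_dom by blast
  note pl = S(3) S'(3) S''(3) plaque_place[OF S(1,2)] plaque_place[OF S'(1,2)] plaque_place[OF S''(1,2)]
  obtain v v' where v: "v \<in> cbox (-1) 1" "v' \<in> cbox (-1) 1" "place x v S = place y v' S'"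
    using ne(1) unfolding pl by blast
  obtain w w' where w: "w \<in> cbox (-1) 1" "w' \<in> cbox (-1) 1" "place x w S = place y w' S''"
    using ne(2) unfolding pl by blast
  have "S' = S''"
    by (rule place_rigid(1)[OF v(3) w(3) _ _ _ _ S'(2) S''(2)]) (use v w cube_subsets(1) in blast)+
  then show ?thesis unfolding pl by simp
qed

lemma smooth_map_on_open:
  assumes "open B" "\<And>k. Ck_on k V h" "B \<subseteq> V" "\<And>y. y \<in> B \<Longrightarrow> h y = f y"
  shows "smooth_map_on B f"
  unfolding smooth_map_on_def
  using assms Ck_on_subset[OF assms(2,3)] by (intro ballI exI[of _ B] exI[of _ h]) auto

text \<open>In coordinates the transition is \<open>w \<mapsto> R (gmul (P w) c)\<close>, smooth by
  \<open>P_smooth\<close>, and its inverse is the same map for \<open>c'\<close>, the inverse of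
  \<open>c\<close>.\<close>

lemma smooth_plaque_transition:
  assumes z: "z \<in> plaque_interior Omega chart_dom phi x z \<inter> plaque_interior Omega chart_dom phi y z"
  shows "\<exists>W. W \<subseteq> plaque Omega chart_dom phi x z \<inter> plaque Omega chart_dom phi y z \<and> z \<in> W \<and> connectedin Omega W \<and>
    openin (plaque_topology Omega chart_dom phi x z) W \<and> openin (plaque_topology Omega chart_dom phi y z) W \<and>
    smooth_diffeo ((fst \<circ> phi x) ` W) ((fst \<circ> phi y) ` W) (plaque_transition Omega chart_dom phi x y z)"
proof -
  have zc: "z \<in> Omega closure_of chart_dom x" "z \<in> Omega closure_of chart_dom y"
    using z by (auto simp: plaque_interior_def plaque_def)
  obtain v S where S: "v \<in> cbox (-1) 1" "S \<in> Xi (tt x)" "z = place x v S"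
    using zc(1) unfolding mem_closure_chart_dom by blast
  obtain v' S' where S': "v' \<in> cbox (-1) 1" "S' \<in> Xi (tt y)" "z = place y v' S'"
    using zc(2) unfolding mem_closure_chart_dom by blast
  have e: "place x v S = place y v' S'" using S(3) S'(3) by simp
  have phz: "phi x z = (v, \<sigma> S)" "phi y z = (v', \<sigma> S')"
    using phi_place_cbox[OF S(1,2)] phi_place_cbox[OF S'(1,2)] S(3) S'(3) by simp_all
  then have v: "v \<in> box (-1) 1" "v' \<in> box (-1) 1"
    using z by (auto simp: plaque_interior_def)
  have plx: "plaque Omega chart_dom phi x z = (\<lambda>w. place x w S) ` cbox (-1) 1"
    and ply: "plaque Omega chart_dom phi y z = (\<lambda>w. place y w S') ` cbox (-1) 1"
    using plaque_place[OF S(1,2)] plaque_place[OF S'(1,2)] S(3) S'(3) by simp_all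
  define c where "c = gmul (ginv (P v)) (P v')"
  define c' where "c' = gmul (ginv (P v')) (P v)"
  have cc': "gmul (gmul g c) c' = g" "gmul (gmul g c') c = g" for g
    by (simp_all add: c_def c'_def gmul_assoc gmul_cancel_left' gmul_ginv_left P_SE)
  have Pvc: "gmul (P v) c = P v'" by (simp add: c_def gmul_cancel_left' P_SE)
  define f where "f w = R (gmul (P w) c)" for w
  define f' where "f' w = R (gmul (P w) c')" for w
  have cSE: "c \<in> SE" "c' \<in> SE" by (simp_all add: c_def c'_def SE_gmul SE_ginv P_SE)
  have f'f: "f' (f w) = w" "f w \<in> pull c' {w}" if "gmul (P w) c \<in> D" for w
    using that by (simp_all add: f_def f'_def pull_def P_R SE_gmul P_SE cSE cc' R_P P_D)
  have ff': "f (f' w) = w" "f' w \<in> pull c {w}" if "gmul (P w) c' \<in> D" for w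
    using that by (simp_all add: f_def f'_def pull_def P_R SE_gmul P_SE cSE cc' R_P P_D)
  have "open (box (-1) 1 \<inter> pull c (box (-1) 1))"
    by (intro open_Int open_box open_pull)
  moreover have "v \<in> box (-1) 1 \<inter> pull c (box (-1) 1)"
    using v by (simp add: pull_def Pvc P_D R_P)
  ultimately obtain r where r: "0 < r" "ball v r \<subseteq> box (-1) 1 \<inter> pull c (box (-1) 1)"
    by (meson open_contains_ball)
  \<comment> \<open>A ball is connected, hence so is \<open>W\<close>; it is small enough for the
    transition to be defined on it with values in the open cube.\<close>
  define B where "B = ball v r"
  have B: "open B" "v \<in> B" "B \<subseteq> box (-1) 1" "B \<subseteq> pull c (box (-1) 1)" "connected B"
    using r by (auto simp: B_def)
  define W where "W = (\<lambda>w. place x w S) ` B"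
  define B' where "B' = f ` B"
  have BD: "gmul (P w) c \<in> D" "f w \<in> box (-1) 1" if "w \<in> B" for w
    using B(4) that by (auto simp: pull_def f_def)
  \<comment> \<open>Described as a preimage under the inverse transition, \<open>B'\<close> is open
    without appeal to the inverse function theorem.\<close>
  have B'eq: "B' = box (-1) 1 \<inter> pull c' B"
  proof
    show "B' \<subseteq> box (-1) 1 \<inter> pull c' B"
      using BD f'f by (auto simp: B'_def pull_def)
    show "box (-1) 1 \<inter> pull c' B \<subseteq> B'"
    proof
      fix w assume w: "w \<in> box (-1) 1 \<inter> pull c' B"
      then have "gmul (P w) c' \<in> D" "f' w \<in> B" by (auto simp: pull_def f'_def)
      then show "w \<in> B'" unfolding B'_def using ff'(1) by (metis imageI)
    qed
  qed
  have B'o: "open B'" unfolding B'eq by (intro open_Int open_box open_pull B(1))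
  have BD': "gmul (P w) c' \<in> D" if "w \<in> B'" for w using that B'eq by (auto simp: pull_def)
  have WW: "place x w S = place y (f w) S'" if "w \<in> B" for w
    using place_transition[OF e] BD(1)[OF that] by (simp add: f_def c_def)
  have W': "W = (\<lambda>w. place y w S') ` B'"
    unfolding W_def B'_def image_image using WW by (rule image_cong[OF refl])
  have B2: "w \<in> cbox (-1) 1" if "w \<in> B" for w using that B(3) cube_subsets(2) by blast
  have B'2: "w \<in> cbox (-1) 1" if "w \<in> B'" for w using that B'eq cube_subsets(2) by blast
  have bij: "bij_betw f B B'"
    unfolding bij_betw_def B'_def using f'f(1) BD(1) by (metis inj_on_inverseI)
  have tr: "plaque_transition Omega chart_dom phi x y z w = f w" if w: "w \<in> B" for w
  proof -
    have inj: "inj_on (phi x) (Omega closure_of chart_dom x)"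
    proof (rule inj_onI)
      fix a b assume "a \<in> Omega closure_of chart_dom x" "b \<in> Omega closure_of chart_dom x" and eq: "phi x a = phi x b"
      then obtain va Sa vb Sb where ab: "va \<in> cbox (-1) 1" "Sa \<in> Xi (tt x)" "a = place x va Sa"
        "vb \<in> cbox (-1) 1" "Sb \<in> Xi (tt x)" "b = place x vb Sb"
        unfolding mem_closure_chart_dom by blast
      then show "a = b" using eq sigma_eq_iff by (simp add: phi_place_cbox)
    qed
    have m: "place x w S \<in> Omega closure_of chart_dom x"
      unfolding mem_closure_chart_dom using B2[OF w] S(2) by blast
    have "(w, snd (phi x z)) = phi x (place x w S)"
      using phz(1) phi_place_cbox[OF B2[OF w] S(2)] by simp
    then have "inv_into (Omega closure_of chart_dom x) (phi x) (w, snd (phi x z)) = place x w S"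
      using inv_into_f_f[OF inj m] by simp
    moreover have "phi y (place x w S) = (f w, \<sigma> S')"
      using WW[OF w] phi_place_cbox[OF _ S'(2)] cube_subsets(2) BD(2)[OF w] by auto
    ultimately show ?thesis by (simp add: plaque_transition_def)
  qed
  have fW: "(fst \<circ> phi x) ` W = B"
  proof -
    have "(fst \<circ> phi x) ` W = (\<lambda>w. w) ` B"
      unfolding W_def image_image using phi_place_cbox[OF B2 S(2)] by (intro image_cong) auto
    then show ?thesis by simp
  qed
  have fW': "(fst \<circ> phi y) ` W = B'"
  proof -
    have "(fst \<circ> phi y) ` W = (\<lambda>w. w) ` B'"
      unfolding W' image_image using phi_place_cbox[OF B'2 S'(2)] by (intro image_cong) auto
    then show ?thesis by simp
  qed
  let ?pt = "plaque_transition Omega chart_dom phi x y z"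
  have "smooth_diffeo ((fst \<circ> phi x) ` W) ((fst \<circ> phi y) ` W) ?pt"
    unfolding smooth_diffeo_def fW fW'
  proof (intro conjI)
    show b: "bij_betw ?pt B B'" using bij bij_betw_cong[of B ?pt f B', OF tr] by simp
    show "smooth_map_on B ?pt"
      by (rule smooth_map_on_open[OF B(1) P_smooth[of _ c]]) (use BD(1) tr in \<open>auto simp: f_def\<close>)
    show "smooth_map_on B' (inv_into B ?pt)"
    proof (rule smooth_map_on_open[OF B'o P_smooth[of _ c']])
      show "B' \<subseteq> {v. gmul (P v) c' \<in> D}" using BD' by blast
      fix w assume w: "w \<in> B'"
      then obtain u where u: "u \<in> B" "w = f u" by (auto simp: B'_def)
      have "inv_into B ?pt w = u"
        using b u tr[OF u(1)] by (metis bij_betw_inv_into_left)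
      then show "R (gmul (P w) c') = inv_into B ?pt w"
        using f'f(1)[OF BD(1)[OF u(1)]] u(2) by (simp add: f'_def)
    qed
  qed
  moreover have "connectedin Omega W"
  proof -
    have "continuous_map (prod_topology (top_of_set B) (subtopology X (transversal (tt x)))) Omega (chart_map x)"
      by (rule continuous_chart_map)
    moreover have "connectedin (prod_topology (top_of_set B) (subtopology X (transversal (tt x)))) (B \<times> {\<sigma> S})"
      using B(5) S(2) openin_subset[OF openin_transversal[OF tt, of x]]
      by (auto simp: connectedin_Times connectedin_subtopology transversal_def)
    ultimately have "connectedin Omega (chart_map x ` (B \<times> {\<sigma> S}))"
      by (rule connectedin_continuous_map_image)
    moreover have "chart_map x ` (B \<times> {\<sigma> S}) = W"
      using Xi_Y[OF S(2)] by (auto simp: chart_map_def W_def image_iff)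
    ultimately show ?thesis by simp
  qed
  moreover have "openin (plaque_topology Omega chart_dom phi x z) W"
    unfolding plx W_def by (rule openin_plaque[OF B(1,3) S(2)])
  moreover have "openin (plaque_topology Omega chart_dom phi y z) W"
    unfolding ply W' by (rule openin_plaque[OF B'o _ S'(2)]) (simp add: B'eq)
  moreover have "W \<subseteq> plaque Omega chart_dom phi x z \<inter> plaque Omega chart_dom phi y z"
  proof (rule Int_greatest)
    show "W \<subseteq> plaque Omega chart_dom phi x z"
      unfolding plx W_def using B2 by (intro image_mono subsetI)
    show "W \<subseteq> plaque Omega chart_dom phi y z"
      unfolding ply W' using B'2 by (intro image_mono subsetI)
  qed
  moreover have "z \<in> W" using S(3) B(2) by (simp add: W_def)
  ultimately show ?thesis by (intro exI[of _ W] conjI)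
qed

lemma compatible_phi: "compatible_charts Omega chart_dom phi x y"
  unfolding compatible_charts_def
proof (intro conjI ballI allI impI)
  fix z z' assume z: "z \<in> Omega closure_of chart_dom x" "z' \<in> Omega closure_of chart_dom y"
  show "openin (plaque_topology Omega chart_dom phi x z)
    (plaque_interior Omega chart_dom phi x z \<inter> plaque_interior Omega chart_dom phi y z')"
    by (rule openin_plaque_interior_Int[OF z])
  show "openin (plaque_topology Omega chart_dom phi y z')
    (plaque_interior Omega chart_dom phi x z \<inter> plaque_interior Omega chart_dom phi y z')"
    using openin_plaque_interior_Int[OF z(2,1)] by (simp only: Int_commute)
next
  fix z z' z''
  assume "z \<in> Omega closure_of chart_dom x" "z' \<in> Omega closure_of chart_dom y" "z'' \<in> Omega closure_of chart_dom y"
    "plaque Omega chart_dom phi x z \<inter> plaque Omega chart_dom phi y z' \<noteq> {} \<and>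
     plaque Omega chart_dom phi x z \<inter> plaque Omega chart_dom phi y z'' \<noteq> {}"
  then show "plaque Omega chart_dom phi y z' = plaque Omega chart_dom phi y z''"
    using plaques_meet_unique by blast
next
  fix z assume "z \<in> plaque_interior Omega chart_dom phi x z \<inter> plaque_interior Omega chart_dom phi y z"
  then show "\<exists>W. W \<subseteq> plaque Omega chart_dom phi x z \<inter> plaque Omega chart_dom phi y z \<and> z \<in> W \<and> connectedin Omega W \<and>
    openin (plaque_topology Omega chart_dom phi x z) W \<and> openin (plaque_topology Omega chart_dom phi y z) W \<and>
    smooth_diffeo ((fst \<circ> phi x) ` W) ((fst \<circ> phi y) ` W) (plaque_transition Omega chart_dom phi x y z)"
    by (rule smooth_plaque_transition)
qed

lemma matchbox_structure_phi:
  assumes "2 \<le> CARD('n)"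
  shows "matchbox_structure Omega X chart_dom (\<lambda>x. transversal (tt x)) phi"
  unfolding matchbox_structure_def topspace_rotational_hull
  by (intro conjI ballI compact_Omega connected_Omega[OF assms] metrizable_Omega compact_X separable_X
    totally_disconnected_X metrizable_X matchbox_chart_phi compatible_phi)

end

section \<open>Leaves\<close>

text \<open>A plaque that meets the leaf meets some plaque reached by a chain, and so prolongs that
  chain.\<close>

lemma plaque_subset_leaf:
  assumes L: "L \<in> leaves M U \<phi>" and R: "R \<in> plaques M U \<phi>" "R \<inter> L \<noteq> {}"
  shows "R \<subseteq> L"
proof -
  let ?O = "overlapping_plaques M U \<phi>"
  obtain P where P: "P \<in> plaques M U \<phi>" "L = \<Union>(?O\<^sup>* `` {P})"
    using L by (auto simp: leaves_def)
  then obtain P' where P': "(P, P') \<in> ?O\<^sup>*" "R \<inter> P' \<noteq> {}" using R(2) by blast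
  have "P' \<in> plaques M U \<phi>"
    using P'(1) P(1) by (cases rule: rtrancl.cases) (auto simp: overlapping_plaques_def)
  then have "(P', R) \<in> ?O" using R(1) P'(2) by (auto simp: overlapping_plaques_def)
  then have "(P, R) \<in> ?O\<^sup>*" using P'(1) by (rule rtrancl_into_rtrancl[rotated])
  then show ?thesis using P(2) by blast
qed

lemma leaf_subset_topspace:
  assumes "L \<in> leaves M U \<phi>"
  shows "L \<subseteq> topspace M"
proof -
  obtain P where P: "P \<in> plaques M U \<phi>" "L = \<Union>((overlapping_plaques M U \<phi>)\<^sup>* `` {P})"
    using assms by (auto simp: leaves_def)
  have "P' \<subseteq> topspace M" if "(P, P') \<in> (overlapping_plaques M U \<phi>)\<^sup>*" for P'
  proof -
    have "P' \<in> plaques M U \<phi>"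
      using that P(1) by (cases rule: rtrancl.cases) (auto simp: overlapping_plaques_def)
    then show ?thesis
      using closure_of_subset_topspace by (fastforce simp: plaques_def plaque_def)
  qed
  then show ?thesis using P(2) by blast
qed

lemma plaque_interior_subset: "plaque_interior M U \<phi> x z \<subseteq> plaque M U \<phi> x z"
  by (auto simp: plaque_interior_def)

text \<open>A plaque that meets \<open>L\<close> lies in \<open>L\<close>, so \<open>L\<close> cuts
  out its whole interior; that this is open in the plaque is the compatibility of a chart with
  itself.\<close>

lemma openin_leaf:
  assumes "matchbox_structure M X U Tr \<phi>" "L \<in> leaves M U \<phi>"
  shows "openin (leaf_topology M U \<phi> L) L"
  unfolding openin_leaf_topology
proof (intro conjI ballI)
  fix x z assume x: "x \<in> topspace M" and z: "z \<in> M closure_of U x"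
  have R: "plaque M U \<phi> x z \<in> plaques M U \<phi>" using x z by (auto simp: plaques_def)
  show "openin (plaque_topology M U \<phi> x z) (L \<inter> plaque_interior M U \<phi> x z)"
  proof (cases "plaque M U \<phi> x z \<inter> L = {}")
    case True
    then have "L \<inter> plaque_interior M U \<phi> x z = {}" using plaque_interior_subset[of M U \<phi> x z] by blast
    then show ?thesis by simp
  next
    case False
    then have "plaque M U \<phi> x z \<subseteq> L" by (rule plaque_subset_leaf[OF assms(2) R])
    then have "L \<inter> plaque_interior M U \<phi> x z = plaque_interior M U \<phi> x z \<inter> plaque_interior M U \<phi> x z"
      using plaque_interior_subset[of M U \<phi> x z] by blast
    moreover have "compatible_charts M U \<phi> x x" using assms(1) x by (simp add: matchbox_structure_def)
    then have "openin (plaque_topology M U \<phi> x z) (plaque_interior M U \<phi> x z \<inter> plaque_interior M U \<phi> x z)"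
      unfolding compatible_charts_def using z by blast
    ultimately show ?thesis by simp
  qed
qed simp

lemma topspace_leaf_topology:
  assumes "matchbox_structure M X U Tr \<phi>" "L \<in> leaves M U \<phi>"
  shows "topspace (leaf_topology M U \<phi> L) = L"
proof
  show "topspace (leaf_topology M U \<phi> L) \<subseteq> L"
    using openin_topspace[of "leaf_topology M U \<phi> L"] unfolding openin_leaf_topology by blast
  show "L \<subseteq> topspace (leaf_topology M U \<phi> L)"
    by (rule openin_subset[OF openin_leaf[OF assms]])
qed

text \<open>The chart takes the plaque interior to an open cube times a point, and an open cube is
  homeomorphic to the whole space.\<close>

lemma plaque_interior_homeomorphic_space:
  fixes \<phi> :: "'a \<Rightarrow> 'a \<Rightarrow> (real^'m::finite) \<times> real"
  assumes "matchbox_structure M X U Tr \<phi>" and p: "p \<in> topspace M"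
  shows "subtopology M (plaque_interior M U \<phi> p p) homeomorphic_space (euclidean :: (real^'m) topology)"
proof -
  let ?C = "M closure_of U p"
  let ?Z = "prod_topology (top_of_set (cbox (-1) 1)) (subtopology X (Tr p)) :: ((real^'m) \<times> real) topology"
  let ?V = "plaque_interior M U \<phi> p p"
  have ch: "matchbox_chart M X p (U p) (Tr p) (\<phi> p)"
    using assms by (simp add: matchbox_structure_def)
  obtain w where w: "\<phi> p p = (0, w)" "w \<in> X interior_of (Tr p)"
    using ch by (auto simp: matchbox_chart_def)
  have w': "w \<in> topspace X" "w \<in> Tr p"
    using w(2) interior_of_subset_topspace[of X "Tr p"] interior_of_subset[of X "Tr p"] by blast+
  have hom: "homeomorphic_map (subtopology M ?C) ?Z (\<phi> p)"
    using ch by (simp add: matchbox_chart_def)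
  have tC: "topspace (subtopology M ?C) = ?C"
    using closure_of_subset_topspace[of M "U p"] by (simp add: inf.absorb2)
  have VC: "?V \<subseteq> ?C" by (auto simp: plaque_interior_def plaque_def)
  have VD: "?V = {q \<in> ?C. snd (\<phi> p q) = w \<and> fst (\<phi> p q) \<in> box (-1) 1}"
    by (auto simp: plaque_interior_def plaque_def w(1))
  have surj: "\<phi> p ` ?C = topspace ?Z"
    using homeomorphic_imp_surjective_map[OF hom] unfolding tC .
  have sub: "box (-1) 1 \<times> {w} \<subseteq> topspace ?Z"
    using w' cube_subsets(2) by (auto simp: subset_iff)
  have "\<phi> p ` ?V = box (-1) 1 \<times> {w}"
  proof
    show "\<phi> p ` ?V \<subseteq> box (-1) 1 \<times> {w}"
      unfolding VD by (intro image_subsetI) (simp add: mem_Times_iff)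
    show "box (-1) 1 \<times> {w} \<subseteq> \<phi> p ` ?V"
    proof
      fix y assume y: "y \<in> box (-1) (1::real^'m) \<times> {w}"
      then have "y \<in> \<phi> p ` ?C" using sub surj by blast
      then obtain q where q: "q \<in> ?C" "y = \<phi> p q" by blast
      then have "q \<in> ?V" using y unfolding VD by auto
      then show "y \<in> \<phi> p ` ?V" using q(2) by blast
    qed
  qed
  then have "homeomorphic_map (subtopology (subtopology M ?C) ?V) (subtopology ?Z (box (-1) 1 \<times> {w})) (\<phi> p)"
    by (intro homeomorphic_map_subtopologies[OF hom]) (simp only: tC inf.absorb2[OF VC] inf.absorb2[OF sub])
  moreover have "subtopology (subtopology M ?C) ?V = subtopology M ?V"
    unfolding subtopology_subtopology by (simp only: inf.absorb2[OF VC])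
  moreover have "subtopology ?Z (box (-1) 1 \<times> {w}) = prod_topology (top_of_set (box (-1) 1)) (subtopology X {w})"
    unfolding subtopology_Times subtopology_subtopology using w'(2)
    by (simp add: inf.absorb2[OF cube_subsets(2)])
  ultimately have "subtopology M ?V homeomorphic_space prod_topology (top_of_set (box (-1) (1::real^'m))) (subtopology X {w})"
    using homeomorphic_map_imp_homeomorphic_space by metis
  also have "prod_topology (top_of_set (box (-1) (1::real^'m))) (subtopology X {w})
      homeomorphic_space top_of_set (box (-1) (1::real^'m))"
    using homeomorphic_space_prod_topology_sing1[OF w'(1)] homeomorphic_space_sym by blast
  also have "top_of_set (box (-1) (1::real^'m)) homeomorphic_space (euclidean :: (real^'m) topology)"
  proof -
    have "box (-1) (1::real^'m) homeomorphic (UNIV :: (real^'m) set)"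
      by (rule homeomorphic_box_UNIV) (use cube_zero in blast)
    then obtain f g where fg: "homeomorphism (box (-1) (1::real^'m)) (UNIV :: (real^'m) set) f g"
      unfolding homeomorphic_def by blast
    then have "homeomorphic_maps (top_of_set (box (-1) (1::real^'m))) (top_of_set (UNIV :: (real^'m) set)) f g"
      unfolding homeomorphic_maps_def homeomorphism_def by (auto simp: continuous_map_in_subtopology)
    then show ?thesis
      unfolding homeomorphic_space_def by auto
  qed
  finally show ?thesis .
qed

text \<open>The interior of the plaque through \<open>p\<close> is open in the leaf topology by
  compatibility with all charts, and on it the leaf topology agrees with the subspace topology of
  \<open>M\<close>.\<close>

lemma leaf_locally_euclidean:
  fixes \<phi> :: "'a \<Rightarrow> 'a \<Rightarrow> (real^'m::finite) \<times> real"
  assumes ms: "matchbox_structure M X U Tr \<phi>" and L: "L \<in> leaves M U \<phi>"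
  shows "locally_euclidean TYPE('m) (leaf_topology M U \<phi> L)"
  unfolding locally_euclidean_def topspace_leaf_topology[OF assms]
proof
  fix p assume pL: "p \<in> L"
  let ?V = "plaque_interior M U \<phi> p p"
  let ?LT = "leaf_topology M U \<phi> L"
  have p: "p \<in> topspace M" using leaf_subset_topspace[OF L] pL by blast
  have "matchbox_chart M X p (U p) (Tr p) (\<phi> p)"
    using ms p by (simp add: matchbox_structure_def)
  then have pU: "p \<in> U p" "fst (\<phi> p p) = 0" "openin M (U p)" by (auto simp: matchbox_chart_def)
  have pC: "p \<in> M closure_of U p"
    using closure_of_subset[OF openin_subset[OF pU(3)]] pU(1) by blast
  have pV: "p \<in> ?V" using pC pU(2) cube_zero by (simp add: plaque_interior_def plaque_def)
  have VP: "?V \<subseteq> plaque M U \<phi> p p" by (rule plaque_interior_subset)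
  have "plaque M U \<phi> p p \<in> plaques M U \<phi>" using p pC by (auto simp: plaques_def)
  then have "plaque M U \<phi> p p \<subseteq> L" using plaque_subset_leaf[OF L] VP pV pL by blast
  then have VL: "?V \<subseteq> L" using VP by blast
  have Vo: "openin (plaque_topology M U \<phi> x z) (?V \<inter> plaque_interior M U \<phi> x z)"
    if "x \<in> topspace M" "z \<in> M closure_of U x" for x z
  proof -
    have "compatible_charts M U \<phi> p x" using ms p that(1) by (simp add: matchbox_structure_def)
    then show ?thesis unfolding compatible_charts_def using pC that(2) by blast
  qed
  have VLT: "openin ?LT ?V"
    unfolding openin_leaf_topology using VL Vo by blast
  have "subtopology ?LT ?V = subtopology M ?V"
    unfolding topology_eq
  proof
    fix W
    have "openin (subtopology ?LT ?V) W \<longleftrightarrow> openin ?LT W \<and> W \<subseteq> ?V"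
      by (rule openin_open_subtopology[OF VLT])
    also have "\<dots> \<longleftrightarrow> openin (subtopology M ?V) W"
    proof
      assume W: "openin ?LT W \<and> W \<subseteq> ?V"
      then have "openin (plaque_topology M U \<phi> p p) (W \<inter> ?V)"
        using p pC unfolding openin_leaf_topology by blast
      then obtain G where G: "openin M G" "W \<inter> ?V = G \<inter> plaque M U \<phi> p p"
        by (auto simp: openin_subtopology)
      then have "W = G \<inter> ?V" using W VP by blast
      then show "openin (subtopology M ?V) W" using G(1) by (auto simp: openin_subtopology)
    next
      \<comment> \<open>\<open>W\<close> is cut out of \<open>?V\<close> by an open set of
        \<open>M\<close>, so it inherits from \<open>?V\<close> that its traces on the plaque
        interiors are open in the plaques.\<close>
      assume "openin (subtopology M ?V) W"
      then obtain G where G: "openin M G" "W = G \<inter> ?V" by (auto simp: openin_subtopology)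
      have "openin (plaque_topology M U \<phi> x z) (W \<inter> plaque_interior M U \<phi> x z)"
        if xz: "x \<in> topspace M" "z \<in> M closure_of U x" for x z
      proof -
        obtain H where H: "openin M H" "?V \<inter> plaque_interior M U \<phi> x z = H \<inter> plaque M U \<phi> x z"
          using Vo[OF xz] by (auto simp: openin_subtopology)
        have "W \<inter> plaque_interior M U \<phi> x z = G \<inter> H \<inter> plaque M U \<phi> x z" using G(2) H(2) by blast
        then show ?thesis using openin_Int[OF G(1) H(1)] by (auto simp: openin_subtopology)
      qed
      then show "openin ?LT W \<and> W \<subseteq> ?V"
        unfolding openin_leaf_topology using G(2) VL by blast
    qed
    finally show "openin (subtopology ?LT ?V) W \<longleftrightarrow> openin (subtopology M ?V) W" .
  qed
  then show "\<exists>V. openin ?LT V \<and> p \<in> V \<and> subtopology ?LT V homeomorphic_space (euclidean :: (real^'m) topology)"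
    using VLT pV plaque_interior_homeomorphic_space[OF ms p] by (intro exI[of _ ?V]) simp
qed

theorem proposition2p16:
  fixes T :: "('n::finite, 'l) tiling"
  assumes "CARD('n) \<ge> 2"
    and "is_tiling T"
    and "euclidean_FLC T"
    and "CARD('m::finite) = CARD('n) + CARD('n) * (CARD('n) - 1) div 2"
  shows "matchbox_manifold_with_euclidean_leaves TYPE('m) (rotational_hull T)"
proof -
  interpret flc_tiling T using assms(2,3) by unfold_locales
  obtain Q X \<sigma> where "hull_transversal T Q X \<sigma>" using hull_transversal_exists by blast
  then interpret hull_transversal T Q X \<sigma> .
  obtain P :: "real^'m \<Rightarrow> 'n motion" and R D tt hh ss where "hull_charts T Q X \<sigma> P R D tt hh ss"
    using hull_charts_exist[OF assms(4)] by blast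
  then interpret hull_charts T Q X \<sigma> P R D tt hh ss .
  have ms: "matchbox_structure (rotational_hull T) X chart_dom (\<lambda>x. transversal (tt x)) phi"
    by (rule matchbox_structure_phi[OF assms(1)])
  show ?thesis
    unfolding matchbox_manifold_with_euclidean_leaves_def
    using ms topspace_leaf_topology[OF ms] leaf_locally_euclidean[OF ms]
    by (intro exI conjI ballI)
qed

end
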